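(* Let $W=\langle S|M\rangle$ be a (finite rank) Coxeter system and fix $p\in[1,\infty]$. Let $E_0$ be the set of pairs $\{s_i,s_j\}$, $i\ne j$, with $m_{i,j}$ finite and even, and $E_1$ the set of pairs $\{s_i,s_j\}$, $i\neq j$, with $m_{i,j}$ finite and odd. Suppose that the graph $(S,E_1)$ is a forest, and that for every connected component $C$ of $(S,E_1)$ there is at most one edge $\{t,r\}\in E_0$ with $t\in C$ and $r\notin C$, and no edge $\{t,t'\}\in E_0$ with $t,t'\in C$. Then the quantum Markov semi-group $(\Phi_t)_{t\ge0}$ on $\mathcal{L}(W)$ associated to the word length $\psi_S$ is gradient-$\mathcal{S}_p$.
   Context: A finite rank Coxeter system $W=\langle S|M\rangle$ consists of a finite set $S=\{s_1,\dots,s_n\}$ and a symmetric matrix $M=(m_{i,j})$ with $m_{i,j}\in\mathbb{N}\cup\{\infty\}$, $m_{i,i}=1$, $m_{i,j}\ge2$ for $i\ne j$; $W$ is the group generated by $S$ subject to $(s_is_j)^{m_{i,j}}=e$ whenever $m_{i,j}<\infty$. $\psi_S(\mathbf w)=|\mathbf w|$ is the word length; it is conditionally of negative type, so $\Phi_t(\lambda_{\mathbf w})=e^{-t|\mathbf w|}\lambda_{\mathbf w}$ defines a quantum Markov semi-group on the group von Neumann algebra $\mathcal{L}(W)$. Gradient-$\mathcal{S}_p$: let $\mathbb{C}[W]=\mathrm{span}\{\lambda_{\mathbf w}\}$ and $\Delta(\lambda_{\mathbf w})=|\mathbf w|\lambda_{\mathbf w}$. The semi-group is gradient-$\mathcal{S}_p$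 if for all $a,b\in\mathbb{C}[W]$ the map $\Psi^{a,b}(x)=\Delta(axb)+a\Delta(x)b-\Delta(ax)b-a\Delta(xb)$ on $\mathbb{C}[W]$ extends (via $x\mapsto x\delta_e$) to a bounded operator on $\ell_2(W)$ in the Schatten class $\mathcal{S}_p$ ($\mathcal{S}_\infty$ = compact operators). *)

theory Defs
  imports
    "HOL-Analysis.Analysis"
    "HOL-Algebra.Group"
    "HOL-Library.Function_Algebras"
    "HOL-Library.Extended_Nat"
begin

unbundle no m_inv_syntax

section \<open>Groups given by generators and relations\<close>

datatype 's letter = Gen 's | Inv 's

definition letters :: "'s set \<Rightarrow> 's letter set" where
  "letters S = Gen ` S \<union> Inv ` S"

text \<open>
  The congruence on words that is generated by the relators \<open>R\<close> and the free cancellations.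
\<close>
inductive pres_cong :: "'s set \<Rightarrow> 's letter list set \<Rightarrow> 's letter list \<Rightarrow> 's letter list \<Rightarrow> bool"
  for S R where
  refl: "w \<in> lists (letters S) \<Longrightarrow> pres_cong S R w w"
| sym: "pres_cong S R v w \<Longrightarrow> pres_cong S R w v"
| trans: "pres_cong S R u v \<Longrightarrow> pres_cong S R v w \<Longrightarrow> pres_cong S R u w"
| cancel: "u \<in> lists (letters S) \<Longrightarrow> v \<in> lists (letters S) \<Longrightarrow> s \<in> S \<Longrightarrow>
    r = [Gen s, Inv s] \<or> r = [Inv s, Gen s] \<Longrightarrow> pres_cong S R (u @ r @ v) (u @ v)"
| relator: "u \<in> lists (letters S) \<Longrightarrow> v \<in> lists (letters S) \<Longrightarrow> r \<in> R \<inter> lists (letters S) \<Longrightarrow>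
    pres_cong S R (u @ r @ v) (u @ v)"

definition pres_class :: "'s set \<Rightarrow> 's letter list set \<Rightarrow> 's letter list \<Rightarrow> 's letter list set" where
  "pres_class S R w = {v. pres_cong S R w v}"

definition presented_group :: "'s set \<Rightarrow> 's letter list set \<Rightarrow> 's letter list set monoid" where
  "presented_group S R =
    \<lparr>carrier = pres_class S R ` lists (letters S),
     mult = (\<lambda>A B. \<Union>a\<in>A. \<Union>b\<in>B. pres_class S R (a @ b)),
     one = pres_class S R []\<rparr>"

lemma pres_cong_lists:
  "pres_cong S R v w \<Longrightarrow> v \<in> lists (letters S) \<and> w \<in> lists (letters S)"
  by (induction rule: pres_cong.induct) (auto simp: letters_def)

lemma pres_class_eq_iff:
  assumes "v \<in> lists (letters S)" "w \<in> lists (letters S)"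
  shows "pres_class S R v = pres_class S R w \<longleftrightarrow> pres_cong S R v w"
proof
  assume "pres_class S R v = pres_class S R w"
  moreover have "w \<in> pres_class S R w"
    using assms by (simp add: pres_class_def pres_cong.refl)
  ultimately show "pres_cong S R v w"
    by (simp add: pres_class_def set_eq_iff)
next
  assume vw: "pres_cong S R v w"
  show "pres_class S R v = pres_class S R w"
    unfolding pres_class_def
  proof (rule Collect_cong, rule iffI)
    show "pres_cong S R w u" if "pres_cong S R v u" for u
      using pres_cong.trans[OF pres_cong.sym[OF vw] that] .
    show "pres_cong S R v u" if "pres_cong S R w u" for u
      using pres_cong.trans[OF vw that] .
  qed
qed

lemma pres_cong_context:
  assumes "pres_cong S R v w" "x \<in> lists (letters S)" "y \<in> lists (letters S)"
  shows "pres_cong S R (x @ v @ y) (x @ w @ y)"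
  using assms
proof (induction rule: pres_cong.induct)
  case (refl w)
  then show ?case by (intro pres_cong.refl) auto
next
  case (sym v w)
  from pres_cong.sym[OF sym.IH[OF sym.prems]] show ?case .
next
  case (trans u v w)
  from pres_cong.trans[OF trans.IH(1)[OF trans.prems] trans.IH(2)[OF trans.prems]] show ?case .
next
  case (cancel u v s r)
  then show ?case using pres_cong.cancel[of "x @ u" S "v @ y" s r R] by simp
next
  case (relator u v r)
  then show ?case using pres_cong.relator[of "x @ u" S "v @ y" r R] by simp
qed

lemma pres_cong_append:
  assumes "pres_cong S R v v'" "pres_cong S R w w'"
  shows "pres_cong S R (v @ w) (v' @ w')"
proof -
  have "pres_cong S R (v @ w) (v' @ w)"
    using pres_cong_context[OF assms(1), of "[]" w] pres_cong_lists[OF assms(2)] by simp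
  moreover have "pres_cong S R (v' @ w) (v' @ w')"
    using pres_cong_context[OF assms(2), of v' "[]"] pres_cong_lists[OF assms(1)] by simp
  ultimately show ?thesis by (rule pres_cong.trans)
qed

lemma presented_group_mult:
  assumes "v \<in> lists (letters S)" "w \<in> lists (letters S)"
  shows "pres_class S R v \<otimes>\<^bsub>presented_group S R\<^esub> pres_class S R w = pres_class S R (v @ w)"
proof -
  have *: "pres_class S R (v' @ w') = pres_class S R (v @ w)"
    if "v' \<in> pres_class S R v" "w' \<in> pres_class S R w" for v' w'
  proof -
    from that have "pres_cong S R v v'" "pres_cong S R w w'"
      by (simp_all add: pres_class_def)
    then have "pres_cong S R (v @ w) (v' @ w')"
      by (rule pres_cong_append)
    then show ?thesis
      using pres_cong_lists pres_class_eq_iff by blast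
  qed
  moreover have "v \<in> pres_class S R v" "w \<in> pres_class S R w"
    using assms by (simp_all add: pres_class_def pres_cong.refl)
  ultimately have "(\<Union>v'\<in>pres_class S R v. \<Union>w'\<in>pres_class S R w. pres_class S R (v' @ w')) =
      pres_class S R (v @ w)"
    by blast
  then show ?thesis
    by (simp add: presented_group_def)
qed

lemma group_presented_group: "group (presented_group S R)"
proof (rule groupI)
  let ?G = "presented_group S R"
  have carr: "carrier ?G = pres_class S R ` lists (letters S)"
    and one: "\<one>\<^bsub>?G\<^esub> = pres_class S R []"
    by (simp_all add: presented_group_def)
  have one_carr: "\<one>\<^bsub>?G\<^esub> \<in> carrier ?G"
    unfolding carr one by (rule imageI) simp
  then show "\<one>\<^bsub>?G\<^esub> \<in> carrier ?G" .
  show "x \<otimes>\<^bsub>?G\<^esub> y \<in> carrier ?G" if "x \<in> carrier ?G" "y \<in> carrier ?G" for x y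
    using that unfolding carr by (elim imageE) (simp add: presented_group_mult)
  show "x \<otimes>\<^bsub>?G\<^esub> y \<otimes>\<^bsub>?G\<^esub> z = x \<otimes>\<^bsub>?G\<^esub> (y \<otimes>\<^bsub>?G\<^esub> z)"
    if "x \<in> carrier ?G" "y \<in> carrier ?G" "z \<in> carrier ?G" for x y z
    using that unfolding carr by (elim imageE) (simp add: presented_group_mult)
  show "\<one>\<^bsub>?G\<^esub> \<otimes>\<^bsub>?G\<^esub> x = x" if "x \<in> carrier ?G" for x
    using that unfolding carr one by (elim imageE) (simp add: presented_group_mult)
  have "\<exists>v\<in>lists (letters S). pres_cong S R (v @ w) []" if "w \<in> lists (letters S)" for w
    using that
  proof (induction w)
    case Nil
    show ?case by (rule bexI[of _ "[]"]) (auto intro: pres_cong.refl)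
  next
    case (Cons a w)
    then obtain v where v: "v \<in> lists (letters S)" "pres_cong S R (v @ w) []" by auto
    from Cons obtain s where s: "s \<in> S" "a = Gen s \<or> a = Inv s"
      by (auto simp: letters_def)
    define a' where "a' = (if a = Gen s then Inv s else Gen s)"
    have "a' \<in> letters S" using s by (auto simp: a'_def letters_def)
    moreover have "pres_cong S R (v @ [a', a] @ w) (v @ w)"
      using s v Cons by (intro pres_cong.cancel[of _ _ _ s]) (auto simp: a'_def)
    ultimately have "pres_cong S R ((v @ [a']) @ a # w) []" "v @ [a'] \<in> lists (letters S)"
      using v pres_cong.trans[of S R "v @ [a', a] @ w" "v @ w" "[]"] by simp_all
    then show ?case by blast
  qed
  then show "\<exists>y\<in>carrier ?G. y \<otimes>\<^bsub>?G\<^esub> x = \<one>\<^bsub>?G\<^esub>" if x: "x \<in> carrier ?G" for x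
  proof -
    from x obtain w where w: "w \<in> lists (letters S)" "x = pres_class S R w"
      unfolding carr by (rule imageE)
    with \<open>\<And>w. w \<in> lists (letters S) \<Longrightarrow> \<exists>v\<in>lists (letters S). pres_cong S R (v @ w) []\<close>
    obtain v where v: "v \<in> lists (letters S)" "pres_cong S R (v @ w) []" by blast
    then have "pres_class S R v \<otimes>\<^bsub>?G\<^esub> x = \<one>\<^bsub>?G\<^esub>"
      unfolding one w(2) presented_group_mult[OF v(1) w(1)]
      using w(1) by (simp add: pres_class_eq_iff)
    moreover have "pres_class S R v \<in> carrier ?G" unfolding carr using v(1) by (rule imageI)
    ultimately show ?thesis by (rule bexI)
  qed
qed


section \<open>Coxeter systems\<close>

definition coxeter_matrix :: "'s set \<Rightarrow> ('s \<Rightarrow> 's \<Rightarrow> enat) \<Rightarrow> bool" where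
  "coxeter_matrix S M \<longleftrightarrow> finite S \<and>
    (\<forall>s\<in>S. M s s = 1) \<and>
    (\<forall>s\<in>S. \<forall>t\<in>S. M s t = M t s) \<and>
    (\<forall>s\<in>S. \<forall>t\<in>S. s \<noteq> t \<longrightarrow> 2 \<le> M s t)"

definition coxeter_relators :: "'s set \<Rightarrow> ('s \<Rightarrow> 's \<Rightarrow> enat) \<Rightarrow> 's letter list set" where
  "coxeter_relators S M =
    {concat (replicate m [Gen s, Gen t]) |s t m. s \<in> S \<and> t \<in> S \<and> M s t = enat m}"

definition coxeter_group :: "'s set \<Rightarrow> ('s \<Rightarrow> 's \<Rightarrow> enat) \<Rightarrow> 's letter list set monoid" where
  "coxeter_group S M = presented_group S (coxeter_relators S M)"

definition coxeter_gens :: "'s set \<Rightarrow> ('s \<Rightarrow> 's \<Rightarrow> enat) \<Rightarrow> 's letter list set set" where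
  "coxeter_gens S M = (\<lambda>s. pres_class S (coxeter_relators S M) [Gen s]) ` S"

text \<open>
  Only words in the generators themselves are considered, without inverses; Coxeter generators are
  involutions.
\<close>
definition word_length :: "('g, 'm) monoid_scheme \<Rightarrow> 'g set \<Rightarrow> 'g \<Rightarrow> nat" where
  "word_length G X g =
    (LEAST n. \<exists>xs\<in>lists X. length xs = n \<and> foldr (\<otimes>\<^bsub>G\<^esub>) xs \<one>\<^bsub>G\<^esub> = g)"

definition coxeter_length :: "'s set \<Rightarrow> ('s \<Rightarrow> 's \<Rightarrow> enat) \<Rightarrow> 's letter list set \<Rightarrow> nat" where
  "coxeter_length S M = word_length (coxeter_group S M) (coxeter_gens S M)"

lemma group_coxeter_group: "group (coxeter_group S M)"
  unfolding coxeter_group_def by (rule group_presented_group)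

definition even_edges :: "'s set \<Rightarrow> ('s \<Rightarrow> 's \<Rightarrow> enat) \<Rightarrow> 's set set" where
  "even_edges S M = {{s, t} |s t. s \<in> S \<and> t \<in> S \<and> s \<noteq> t \<and> (\<exists>k. M s t = enat k \<and> even k)}"

definition odd_edges :: "'s set \<Rightarrow> ('s \<Rightarrow> 's \<Rightarrow> enat) \<Rightarrow> 's set set" where
  "odd_edges S M = {{s, t} |s t. s \<in> S \<and> t \<in> S \<and> s \<noteq> t \<and> (\<exists>k. M s t = enat k \<and> odd k)}"

definition graph_cycle :: "'v set set \<Rightarrow> 'v list \<Rightarrow> bool" where
  "graph_cycle E c \<longleftrightarrow> 3 \<le> length c \<and> distinct c \<and>
    (\<forall>i<length c. {c ! i, c ! (Suc i mod length c)} \<in> E)"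

definition graph_forest :: "'v set set \<Rightarrow> bool" where
  "graph_forest E \<longleftrightarrow> (\<nexists>c. graph_cycle E c)"

definition graph_components :: "'v set \<Rightarrow> 'v set set \<Rightarrow> 'v set set" where
  "graph_components V E = {{w \<in> V. (v, w) \<in> {(x, y). {x, y} \<in> E}\<^sup>*} |v. v \<in> V}"


section \<open>Operators on \<open>\<ell>\<^sub>2\<close>\<close>

definition fun_scale :: "complex \<Rightarrow> ('a \<Rightarrow> complex) \<Rightarrow> 'a \<Rightarrow> complex" where
  "fun_scale c \<xi> = (\<lambda>x. c * \<xi> x)"

definition op_scale ::
  "complex \<Rightarrow> ('b \<Rightarrow> 'a \<Rightarrow> complex) \<Rightarrow> 'b \<Rightarrow> 'a \<Rightarrow> complex" where
  "op_scale c T = (\<lambda>\<xi>. fun_scale c (T \<xi>))"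

global_interpretation fun_cspace: vector_space fun_scale
  by standard (auto simp: fun_scale_def fun_eq_iff algebra_simps)

global_interpretation op_cspace: vector_space op_scale
  by standard (auto simp: op_scale_def fun_scale_def fun_eq_iff algebra_simps)

text \<open>
  The elements of \<open>\<ell>\<^sub>2(A)\<close> are functions on the whole type that vanish outside \<open>A\<close>. Similarly an
  operator on \<open>\<ell>\<^sub>2(A)\<close> is a function on all of \<open>'a \<Rightarrow> complex\<close> that is \<open>0\<close> outside \<open>\<ell>\<^sub>2(A)\<close>, so that
  equality of operators is equality in HOL.
\<close>
definition ell2 :: "'a set \<Rightarrow> ('a \<Rightarrow> complex) set" where
  "ell2 A = {\<xi>. (\<forall>x. x \<notin> A \<longrightarrow> \<xi> x = 0) \<and> (\<lambda>x. (cmod (\<xi> x))\<^sup>2) summable_on A}"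

definition ell2_norm :: "'a set \<Rightarrow> ('a \<Rightarrow> complex) \<Rightarrow> real" where
  "ell2_norm A \<xi> = sqrt (\<Sum>\<^sub>\<infinity>x\<in>A. (cmod (\<xi> x))\<^sup>2)"

definition ell2_inner :: "'a set \<Rightarrow> ('a \<Rightarrow> complex) \<Rightarrow> ('a \<Rightarrow> complex) \<Rightarrow> complex" where
  "ell2_inner A \<xi> \<eta> = (\<Sum>\<^sub>\<infinity>x\<in>A. \<xi> x * cnj (\<eta> x))"

definition delta :: "'a \<Rightarrow> 'a \<Rightarrow> complex" where
  "delta x = (\<lambda>y. if y = x then 1 else 0)"

type_synonym 'a op = "('a \<Rightarrow> complex) \<Rightarrow> 'a \<Rightarrow> complex"

definition bounded_ops :: "'a set \<Rightarrow> 'a op set" where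
  "bounded_ops A = {T.
    (\<forall>\<xi>\<in>ell2 A. T \<xi> \<in> ell2 A) \<and> (\<forall>\<xi>. \<xi> \<notin> ell2 A \<longrightarrow> T \<xi> = 0) \<and>
    (\<forall>\<xi>\<in>ell2 A. \<forall>\<eta>\<in>ell2 A. T (\<xi> + \<eta>) = T \<xi> + T \<eta>) \<and>
    (\<forall>c. \<forall>\<xi>\<in>ell2 A. T (fun_scale c \<xi>) = fun_scale c (T \<xi>)) \<and>
    (\<exists>C. \<forall>\<xi>\<in>ell2 A. ell2_norm A (T \<xi>) \<le> C * ell2_norm A \<xi>)}"

definition compact_ops :: "'a set \<Rightarrow> 'a op set" where
  "compact_ops A = {T \<in> bounded_ops A.
    \<forall>\<xi> :: nat \<Rightarrow> 'a \<Rightarrow> complex. (\<forall>n. \<xi> n \<in> ell2 A \<and> ell2_norm A (\<xi> n) \<le> 1) \<longrightarrow>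
      (\<exists>r \<eta>. strict_mono r \<and> \<eta> \<in> ell2 A \<and> (\<lambda>n. ell2_norm A (T (\<xi> (r n)) - \<eta>)) \<longlonglongrightarrow> 0)}"

text \<open>The adjoint, through its coordinates \<open>\<langle>T\<^sup>* \<xi>, \<delta>\<^sub>x\<rangle> = \<langle>\<xi>, T \<delta>\<^sub>x\<rangle>\<close>.\<close>
definition adjoint_op :: "'a set \<Rightarrow> 'a op \<Rightarrow> 'a op" where
  "adjoint_op A T \<xi> =
    (if \<xi> \<in> ell2 A then (\<lambda>x. if x \<in> A then ell2_inner A \<xi> (T (delta x)) else 0) else 0)"

text \<open>
  The positive singular values of \<open>T\<close> are the \<open>\<sigma> > 0\<close> such that \<open>\<sigma>\<^sup>2\<close> is an eigenvalue of \<open>T\<^sup>* T\<close>,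
  counted with the dimension of the eigenspace. For compact \<open>T\<close> these dimensions are finite, so
  the convention that \<open>dim\<close> is \<open>0\<close> in infinite dimension is harmless in \<open>schatten\<close>.
\<close>
definition singular_mult :: "'a set \<Rightarrow> 'a op \<Rightarrow> real \<Rightarrow> nat" where
  "singular_mult A T \<sigma> =
    fun_cspace.dim {\<xi> \<in> ell2 A. adjoint_op A T (T \<xi>) = fun_scale (of_real (\<sigma>\<^sup>2)) \<xi>}"

definition schatten :: "'a set \<Rightarrow> ennreal \<Rightarrow> 'a op set" where
  "schatten A p =
    (if p = \<infinity> then compact_ops A
     else {T \<in> compact_ops A.
       (\<lambda>\<sigma>. real (singular_mult A T \<sigma>) * \<sigma> powr enn2real p) summable_on {0<..}})"


section \<open>Group von Neumann algebras and the semi-group of a length function\<close>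

definition left_reg :: "('g, 'm) monoid_scheme \<Rightarrow> 'g \<Rightarrow> 'g op" where
  "left_reg G g \<xi> =
    (if \<xi> \<in> ell2 (carrier G)
     then (\<lambda>h. if h \<in> carrier G then \<xi> (m_inv G g \<otimes>\<^bsub>G\<^esub> h) else 0) else 0)"

definition group_algebra :: "('g, 'm) monoid_scheme \<Rightarrow> 'g op set" where
  "group_algebra G = op_cspace.span (left_reg G ` carrier G)"

definition commutant :: "'a set \<Rightarrow> 'a op set \<Rightarrow> 'a op set" where
  "commutant A X = {T \<in> bounded_ops A. \<forall>R\<in>X. T \<circ> R = R \<circ> T}"

definition group_vN :: "('g, 'm) monoid_scheme \<Rightarrow> 'g op set" where
  "group_vN G = commutant (carrier G) (commutant (carrier G) (left_reg G ` carrier G))"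

text \<open>
  The Fourier coefficients of \<open>x\<close> in \<open>group_vN G\<close> are the coordinates of \<open>x \<delta>\<^sub>e\<close>, and they determine
  \<open>x\<close>. The maps below are the Fourier multipliers \<open>\<lambda>\<^sub>g \<mapsto> exp (- t \<psi>(g)) \<lambda>\<^sub>g\<close>.
\<close>
definition length_semigroup ::
  "('g, 'm) monoid_scheme \<Rightarrow> ('g \<Rightarrow> real) \<Rightarrow> real \<Rightarrow> 'g op \<Rightarrow> 'g op" where
  "length_semigroup G \<psi> t x = (THE y. y \<in> group_vN G \<and>
    (\<forall>g\<in>carrier G. y (delta \<one>\<^bsub>G\<^esub>) g = of_real (exp (- t * \<psi> g)) * x (delta \<one>\<^bsub>G\<^esub>) g))"

text \<open>
  The generator \<open>\<Delta>\<close> of \<open>\<Phi>\<^sub>t = exp (- t \<Delta>)\<close> on the group algebra, the derivative being taken in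
  \<open>\<ell>\<^sub>2\<close> after \<open>x \<mapsto> x \<delta>\<^sub>e\<close>; see \<open>generator_left_reg\<close> and \<open>generator_linear\<close> below.
\<close>
definition generator ::
  "('g, 'm) monoid_scheme \<Rightarrow> (real \<Rightarrow> 'g op \<Rightarrow> 'g op) \<Rightarrow> 'g op \<Rightarrow> 'g op" where
  "generator G \<Phi> x = (THE y. y \<in> group_algebra G \<and>
    ((\<lambda>t. ell2_norm (carrier G)
        (fun_scale (of_real (1 / t)) ((x - \<Phi> t x) (delta \<one>\<^bsub>G\<^esub>)) - y (delta \<one>\<^bsub>G\<^esub>)))
      \<longlongrightarrow> 0) (at_right 0))"

definition gradient_map ::
  "('g, 'm) monoid_scheme \<Rightarrow> (real \<Rightarrow> 'g op \<Rightarrow> 'g op) \<Rightarrow> 'g op \<Rightarrow> 'g op \<Rightarrow> 'g op \<Rightarrow> 'g op" where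
  "gradient_map G \<Phi> a b x = (let \<Delta> = generator G \<Phi> in
    \<Delta> (a \<circ> x \<circ> b) + (a \<circ> \<Delta> x \<circ> b) - (\<Delta> (a \<circ> x) \<circ> b) - (a \<circ> \<Delta> (x \<circ> b)))"

definition gradient_schatten ::
  "('g, 'm) monoid_scheme \<Rightarrow> (real \<Rightarrow> 'g op \<Rightarrow> 'g op) \<Rightarrow> ennreal \<Rightarrow> bool" where
  "gradient_schatten G \<Phi> p \<longleftrightarrow>
    (\<forall>a\<in>group_algebra G. \<forall>b\<in>group_algebra G. \<exists>T\<in>schatten (carrier G) p.
      \<forall>x\<in>group_algebra G. T (x (delta \<one>\<^bsub>G\<^esub>)) = gradient_map G \<Phi> a b x (delta \<one>\<^bsub>G\<^esub>))"


section \<open>The semi-group and its generator on the group algebra\<close>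

lemma ell2_finite_support:
  assumes "finite F" "F \<subseteq> A" "\<And>x. x \<notin> F \<Longrightarrow> \<xi> x = 0"
  shows "\<xi> \<in> ell2 A" "ell2_norm A \<xi> = sqrt (\<Sum>x\<in>F. (cmod (\<xi> x))\<^sup>2)"
proof -
  have "((\<lambda>x. (cmod (\<xi> x))\<^sup>2) has_sum (\<Sum>x\<in>F. (cmod (\<xi> x))\<^sup>2)) A"
    using assms by (intro has_sum_finite_neutralI) auto
  then show "\<xi> \<in> ell2 A" "ell2_norm A \<xi> = sqrt (\<Sum>x\<in>F. (cmod (\<xi> x))\<^sup>2)"
    using assms by (auto simp: ell2_def ell2_norm_def summable_on_def dest: infsumI)
qed

lemma delta_in_ell2: "x \<in> A \<Longrightarrow> delta x \<in> ell2 A"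
  by (rule ell2_finite_support(1)[of "{x}"]) (auto simp: delta_def)

lemma ell2_scale: "\<xi> \<in> ell2 A \<Longrightarrow> fun_scale c \<xi> \<in> ell2 A"
  by (auto simp: ell2_def fun_scale_def norm_mult power_mult_distrib intro: summable_on_cmult_right)

lemma ell2_norm_scale: "ell2_norm A (fun_scale c \<xi>) = cmod c * ell2_norm A \<xi>"
  by (simp add: ell2_norm_def fun_scale_def norm_mult power_mult_distrib infsum_cmult_right'
      real_sqrt_mult)

lemma ell2_norm_ge_0: "0 \<le> ell2_norm A \<xi>"
  by (simp add: ell2_norm_def infsum_nonneg)

lemma cmod_add_sq: "(cmod (a + b))\<^sup>2 \<le> 2 * (cmod a)\<^sup>2 + 2 * (cmod b)\<^sup>2"
proof -
  have "(cmod (a + b))\<^sup>2 \<le> (cmod a + cmod b)\<^sup>2"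
    by (intro power_mono norm_triangle_ineq) auto
  also have "\<dots> \<le> 2 * (cmod a)\<^sup>2 + 2 * (cmod b)\<^sup>2"
    using sum_squares_bound[of "cmod a" "cmod b"] by (simp add: power2_sum)
  finally show ?thesis .
qed

lemma ell2_add:
  assumes "\<xi> \<in> ell2 A" "\<eta> \<in> ell2 A"
  shows "\<xi> + \<eta> \<in> ell2 A"
    and "(ell2_norm A (\<xi> + \<eta>))\<^sup>2 \<le> 2 * (ell2_norm A \<xi>)\<^sup>2 + 2 * (ell2_norm A \<eta>)\<^sup>2"
proof -
  have s: "(\<lambda>x. 2 * (cmod (\<xi> x))\<^sup>2) summable_on A" "(\<lambda>x. 2 * (cmod (\<eta> x))\<^sup>2) summable_on A"
    using assms by (auto simp: ell2_def intro: summable_on_cmult_right)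
  then have s2: "(\<lambda>x. 2 * (cmod (\<xi> x))\<^sup>2 + 2 * (cmod (\<eta> x))\<^sup>2) summable_on A"
    by (rule summable_on_add)
  then have s3: "(\<lambda>x. (cmod ((\<xi> + \<eta>) x))\<^sup>2) summable_on A"
    by (rule summable_on_comparison_test) (simp_all add: cmod_add_sq)
  with assms show "\<xi> + \<eta> \<in> ell2 A"
    by (auto simp: ell2_def)
  have "(\<Sum>\<^sub>\<infinity>x\<in>A. (cmod ((\<xi> + \<eta>) x))\<^sup>2) \<le> (\<Sum>\<^sub>\<infinity>x\<in>A. 2 * (cmod (\<xi> x))\<^sup>2 + 2 * (cmod (\<eta> x))\<^sup>2)"
    using s2 s3 by (intro infsum_mono) (simp_all add: cmod_add_sq)
  also have "\<dots> = 2 * (\<Sum>\<^sub>\<infinity>x\<in>A. (cmod (\<xi> x))\<^sup>2) + 2 * (\<Sum>\<^sub>\<infinity>x\<in>A. (cmod (\<eta> x))\<^sup>2)"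
    using s by (simp add: infsum_add infsum_cmult_right')
  finally show "(ell2_norm A (\<xi> + \<eta>))\<^sup>2 \<le> 2 * (ell2_norm A \<xi>)\<^sup>2 + 2 * (ell2_norm A \<eta>)\<^sup>2"
    by (simp add: ell2_norm_def infsum_nonneg)
qed

lemma zero_in_ell2: "0 \<in> ell2 A"
  by (simp add: ell2_def)

lemma
  assumes "T \<in> bounded_ops A"
  shows bounded_ops_ell2: "\<xi> \<in> ell2 A \<Longrightarrow> T \<xi> \<in> ell2 A"
    and bounded_ops_outside: "\<xi> \<notin> ell2 A \<Longrightarrow> T \<xi> = 0"
    and bounded_ops_add: "\<xi> \<in> ell2 A \<Longrightarrow> \<eta> \<in> ell2 A \<Longrightarrow> T (\<xi> + \<eta>) = T \<xi> + T \<eta>"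
    and bounded_ops_scale: "\<xi> \<in> ell2 A \<Longrightarrow> T (fun_scale c \<xi>) = fun_scale c (T \<xi>)"
    and bounded_ops_bound: "\<exists>C. \<forall>\<xi>\<in>ell2 A. ell2_norm A (T \<xi>) \<le> C * ell2_norm A \<xi>"
    and bounded_ops_0: "T 0 = 0"
proof -
  show *: "\<xi> \<in> ell2 A \<Longrightarrow> T (fun_scale c \<xi>) = fun_scale c (T \<xi>)" for \<xi> c
    using assms unfolding bounded_ops_def by blast
  show "T 0 = 0"
    using *[OF zero_in_ell2, of 0] by simp
qed (use assms in \<open>unfold bounded_ops_def, blast+\<close>)

lemma op_subspace_bounded_ops: "op_cspace.subspace (bounded_ops A)"
proof (rule op_cspace.subspaceI)
  show "0 \<in> bounded_ops A"
    by (auto simp: bounded_ops_def ell2_def ell2_norm_def fun_scale_def fun_eq_iff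
        intro!: exI[of _ 0])
next
  fix S T assume S: "S \<in> bounded_ops A" and T: "T \<in> bounded_ops A"
  obtain C where C: "\<forall>\<xi>\<in>ell2 A. ell2_norm A (S \<xi>) \<le> C * ell2_norm A \<xi>"
    using bounded_ops_bound[OF S] by blast
  obtain D where D: "\<forall>\<xi>\<in>ell2 A. ell2_norm A (T \<xi>) \<le> D * ell2_norm A \<xi>"
    using bounded_ops_bound[OF T] by blast
  have "ell2_norm A (S \<xi> + T \<xi>) \<le> sqrt (2 * C\<^sup>2 + 2 * D\<^sup>2) * ell2_norm A \<xi>" if \<xi>: "\<xi> \<in> ell2 A" for \<xi>
  proof -
    have "(ell2_norm A (S \<xi> + T \<xi>))\<^sup>2 \<le> 2 * (ell2_norm A (S \<xi>))\<^sup>2 + 2 * (ell2_norm A (T \<xi>))\<^sup>2"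
      by (intro ell2_add(2) bounded_ops_ell2[OF S] bounded_ops_ell2[OF T] \<xi>)
    also have "\<dots> \<le> 2 * (C * ell2_norm A \<xi>)\<^sup>2 + 2 * (D * ell2_norm A \<xi>)\<^sup>2"
      by (intro add_mono mult_left_mono power_mono C[rule_format] D[rule_format] \<xi> ell2_norm_ge_0) auto
    also have "\<dots> = (2 * C\<^sup>2 + 2 * D\<^sup>2) * (ell2_norm A \<xi>)\<^sup>2"
      by (simp add: power_mult_distrib algebra_simps)
    finally have "ell2_norm A (S \<xi> + T \<xi>) \<le> sqrt ((2 * C\<^sup>2 + 2 * D\<^sup>2) * (ell2_norm A \<xi>)\<^sup>2)"
      by (rule real_le_rsqrt)
    then show ?thesis
      unfolding real_sqrt_mult real_sqrt_abs abs_of_nonneg[OF ell2_norm_ge_0] .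
  qed
  then show "S + T \<in> bounded_ops A"
    using S T by (auto simp: bounded_ops_def ell2_add(1) fun_cspace.scale_right_distrib)
next
  fix c T assume T: "T \<in> bounded_ops A"
  obtain D where D: "\<forall>\<xi>\<in>ell2 A. ell2_norm A (T \<xi>) \<le> D * ell2_norm A \<xi>"
    using bounded_ops_bound[OF T] by blast
  then have "ell2_norm A (fun_scale c (T \<xi>)) \<le> (cmod c * D) * ell2_norm A \<xi>" if "\<xi> \<in> ell2 A" for \<xi>
    using that by (simp add: ell2_norm_scale mult.assoc mult_left_mono)
  then have "\<exists>C. \<forall>\<xi>\<in>ell2 A. ell2_norm A (op_scale c T \<xi>) \<le> C * ell2_norm A \<xi>"
    unfolding op_scale_def by blast
  moreover have "fun_scale c (fun_scale d (T \<xi>)) = fun_scale d (fun_scale c (T \<xi>))" for d \<xi>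
    by (simp add: mult.commute)
  ultimately show "op_scale c T \<in> bounded_ops A"
    unfolding bounded_ops_def mem_Collect_eq
    by (simp del: fun_cspace.scale_scale add: op_scale_def ell2_scale fun_cspace.scale_right_distrib bounded_ops_ell2[OF T]
        bounded_ops_outside[OF T] bounded_ops_add[OF T] bounded_ops_scale[OF T])
qed

lemma commutantD:
  assumes "T \<in> commutant A X"
  shows "T \<in> bounded_ops A" "R \<in> X \<Longrightarrow> T (R \<xi>) = R (T \<xi>)"
  using assms by (auto simp: commutant_def fun_eq_iff)

lemma commutantI:
  assumes "T \<in> bounded_ops A" "X \<subseteq> bounded_ops A"
    and "\<And>R \<xi>. R \<in> X \<Longrightarrow> \<xi> \<in> ell2 A \<Longrightarrow> T (R \<xi>) = R (T \<xi>)"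
  shows "T \<in> commutant A X"
proof -
  have "T (R \<xi>) = R (T \<xi>)" if "R \<in> X" for R \<xi>
  proof (cases "\<xi> \<in> ell2 A")
    case False
    have "R \<in> bounded_ops A" using that assms by blast
    then show ?thesis
      unfolding bounded_ops_outside[OF \<open>R \<in> bounded_ops A\<close> False]
        bounded_ops_outside[OF assms(1) False] bounded_ops_0[OF assms(1)]
      by (rule bounded_ops_0[symmetric])
  qed (use that assms in blast)
  then show ?thesis using assms(1) by (auto simp: commutant_def fun_eq_iff)
qed

lemma op_subspace_commutant:
  assumes X: "X \<subseteq> bounded_ops A"
  shows "op_cspace.subspace (commutant A X)"
proof (rule op_cspace.subspaceI)
  show "0 \<in> commutant A X"
  proof (rule commutantI[OF op_cspace.subspace_0[OF op_subspace_bounded_ops] X])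
    show "0 (R \<xi>) = R (0 \<xi>)" if "R \<in> X" for R \<xi>
      using that X bounded_ops_0[of R A] unfolding zero_fun_apply by force
  qed
next
  fix S T assume S: "S \<in> commutant A X" and T: "T \<in> commutant A X"
  show "S + T \<in> commutant A X"
  proof (rule commutantI[OF op_cspace.subspace_add[OF op_subspace_bounded_ops] X])
    fix R \<xi> assume R: "R \<in> X" and \<xi>: "\<xi> \<in> ell2 A"
    have "R (S \<xi> + T \<xi>) = R (S \<xi>) + R (T \<xi>)"
      using X R by (intro bounded_ops_add[of R A] bounded_ops_ell2[OF _ \<xi>] commutantD(1)[OF S]
          commutantD(1)[OF T]) auto
    then show "(S + T) (R \<xi>) = R ((S + T) \<xi>)"
      using commutantD(2)[OF S R] commutantD(2)[OF T R] by simp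
  qed (use S T commutantD(1) in blast)+
next
  fix c T assume T: "T \<in> commutant A X"
  show "op_scale c T \<in> commutant A X"
  proof (rule commutantI[OF op_cspace.subspace_scale[OF op_subspace_bounded_ops] X])
    fix R \<xi> assume R: "R \<in> X" and \<xi>: "\<xi> \<in> ell2 A"
    have "R (fun_scale c (T \<xi>)) = fun_scale c (R (T \<xi>))"
      using X R by (intro bounded_ops_scale[of R A] bounded_ops_ell2[OF _ \<xi>] commutantD(1)[OF T]) auto
    then show "op_scale c T (R \<xi>) = R (op_scale c T \<xi>)"
      using commutantD(2)[OF T R] by (simp add: op_scale_def)
  qed (use T commutantD(1) in blast)+
qed

lemma bounded_ops_eqI:
  assumes S: "S \<in> bounded_ops A" and T: "T \<in> bounded_ops A"
    and eq: "\<And>x. x \<in> A \<Longrightarrow> S (delta x) = T (delta x)"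
  shows "S = T"
proof
  fix \<xi>
  define D where "D = S - T"
  have D: "D \<in> bounded_ops A"
    unfolding D_def by (rule op_cspace.subspace_diff[OF op_subspace_bounded_ops S T])
  have D0: "D (delta x) = 0" if "x \<in> A" for x
    using eq[OF that] by (simp add: D_def)
  have fin: "D \<eta> = 0" if "finite F" "F \<subseteq> A" "\<And>x. x \<notin> F \<Longrightarrow> \<eta> x = 0" for \<eta> F
    using that
  proof (induction F arbitrary: \<eta> rule: finite_induct)
    case empty
    then have "\<eta> = 0" by (simp add: fun_eq_iff)
    then show ?case using bounded_ops_0[OF D] by metis
  next
    case (insert a F)
    define \<zeta> where "\<zeta> = \<eta>(a := 0)"
    have "D \<zeta> = 0" using insert by (intro insert.IH) (auto simp: \<zeta>_def)
    moreover have "\<zeta> \<in> ell2 A"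
      using insert by (intro ell2_finite_support(1)[of F]) (auto simp: \<zeta>_def)
    moreover have "\<eta> = \<zeta> + fun_scale (\<eta> a) (delta a)"
      by (auto simp: \<zeta>_def fun_scale_def delta_def)
    moreover have "a \<in> A" using insert by simp
    ultimately have "D \<eta> = fun_scale (\<eta> a) (D (delta a))"
      using bounded_ops_add[OF D \<open>\<zeta> \<in> ell2 A\<close> ell2_scale[OF delta_in_ell2[OF \<open>a \<in> A\<close>]]]
        bounded_ops_scale[OF D delta_in_ell2[OF \<open>a \<in> A\<close>]] by (metis add_0)
    then show ?case using D0[OF \<open>a \<in> A\<close>] by simp
  qed
  have "D \<xi> = 0"
  proof (cases "\<xi> \<in> ell2 A")
    case True
    obtain C where C: "\<forall>\<xi>\<in>ell2 A. ell2_norm A (D \<xi>) \<le> C * ell2_norm A \<xi>"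
      using bounded_ops_bound[OF D] by blast
    have summ: "(\<lambda>x. (cmod (\<xi> x))\<^sup>2) summable_on A" using True by (simp add: ell2_def)
    have "(ell2_norm A (D \<xi>))\<^sup>2 \<le> C\<^sup>2 * ((\<Sum>\<^sub>\<infinity>x\<in>A. (cmod (\<xi> x))\<^sup>2) - (\<Sum>x\<in>F. (cmod (\<xi> x))\<^sup>2))"
      if F: "finite F" "F \<subseteq> A" for F
    proof -
      define \<eta> where "\<eta> = (\<lambda>x. if x \<in> F then \<xi> x else 0)"
      have \<eta>: "\<eta> \<in> ell2 A"
        using F by (intro ell2_finite_support(1)[of F]) (auto simp: \<eta>_def)
      have d: "\<xi> = (\<xi> - \<eta>) + \<eta>" by simp
      have "- \<eta> = fun_scale (-1) \<eta>" by (simp add: fun_eq_iff fun_scale_def)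
      then have \<xi>\<eta>: "\<xi> - \<eta> \<in> ell2 A"
        using ell2_add(1)[OF True ell2_scale[OF \<eta>, of "-1"]] by simp
      have "D \<xi> = D (\<xi> - \<eta>)"
        using bounded_ops_add[OF D \<xi>\<eta> \<eta>] fin[OF F, of \<eta>] by (simp add: \<eta>_def)
      then have "(ell2_norm A (D \<xi>))\<^sup>2 \<le> (C * ell2_norm A (\<xi> - \<eta>))\<^sup>2"
        using C[rule_format, OF \<xi>\<eta>] by (intro power_mono ell2_norm_ge_0) simp
      moreover have "(ell2_norm A (\<xi> - \<eta>))\<^sup>2 = (\<Sum>\<^sub>\<infinity>x\<in>A. (cmod ((\<xi> - \<eta>) x))\<^sup>2)"
        by (simp add: ell2_norm_def infsum_nonneg)
      moreover have "(\<Sum>\<^sub>\<infinity>x\<in>A. (cmod ((\<xi> - \<eta>) x))\<^sup>2) = (\<Sum>\<^sub>\<infinity>x\<in>A - F. (cmod (\<xi> x))\<^sup>2)"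
        by (intro infsum_cong_neutral) (auto simp: \<eta>_def)
      moreover have "(\<Sum>\<^sub>\<infinity>x\<in>A - F. (cmod (\<xi> x))\<^sup>2) = (\<Sum>\<^sub>\<infinity>x\<in>A. (cmod (\<xi> x))\<^sup>2) - (\<Sum>x\<in>F. (cmod (\<xi> x))\<^sup>2)"
        using infsum_Diff[OF summ summable_on_finite[OF F(1)] F(2)] F(1) by simp
      ultimately show ?thesis unfolding power_mult_distrib by simp
    qed
    then have "\<forall>\<^sub>F F in finite_subsets_at_top A. (ell2_norm A (D \<xi>))\<^sup>2 \<le>
        C\<^sup>2 * ((\<Sum>\<^sub>\<infinity>x\<in>A. (cmod (\<xi> x))\<^sup>2) - (\<Sum>x\<in>F. (cmod (\<xi> x))\<^sup>2))"
      by (intro eventually_finite_subsets_at_top_weakI) auto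
    moreover have "((\<lambda>F. C\<^sup>2 * ((\<Sum>\<^sub>\<infinity>x\<in>A. (cmod (\<xi> x))\<^sup>2) - (\<Sum>x\<in>F. (cmod (\<xi> x))\<^sup>2))) \<longlongrightarrow>
        C\<^sup>2 * ((\<Sum>\<^sub>\<infinity>x\<in>A. (cmod (\<xi> x))\<^sup>2) - (\<Sum>\<^sub>\<infinity>x\<in>A. (cmod (\<xi> x))\<^sup>2))) (finite_subsets_at_top A)"
      using summ by (intro tendsto_intros infsum_tendsto)
    ultimately have "(ell2_norm A (D \<xi>))\<^sup>2 \<le> 0"
      using tendsto_lowerbound[OF _ _ finite_subsets_at_top_neq_bot] by fastforce
    then have "ell2_norm A (D \<xi>) = 0" by simp
    moreover have "D \<xi> \<in> ell2 A" by (rule bounded_ops_ell2[OF D True])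
    ultimately have "D \<xi> x = 0" for x
      using nonneg_infsum_le_0D[of "\<lambda>x. (cmod (D \<xi> x))\<^sup>2" A x]
      by (cases "x \<in> A") (auto simp: ell2_norm_def ell2_def)
    then show ?thesis by (simp add: fun_eq_iff)
  qed (rule bounded_ops_outside[OF D])
  then show "S \<xi> = T \<xi>" by (simp add: D_def)
qed

lemma reindex_op_bounded:
  assumes f: "bij_betw f A A"
  shows "(\<lambda>\<xi>. if \<xi> \<in> ell2 A then (\<lambda>h. if h \<in> A then \<xi> (f h) else 0) else 0) \<in> bounded_ops A"
    (is "?T \<in> _")
proof -
  have "?T \<xi> \<in> ell2 A \<and> ell2_norm A (?T \<xi>) = ell2_norm A \<xi>" if \<xi>: "\<xi> \<in> ell2 A" for \<xi>
  proof -
    have "(\<lambda>x. (cmod (\<xi> (f x)))\<^sup>2) summable_on A"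
      using summable_on_reindex_bij_betw[OF f, of "\<lambda>x. (cmod (\<xi> x))\<^sup>2"] \<xi> by (simp add: ell2_def)
    moreover have "(\<Sum>\<^sub>\<infinity>x\<in>A. (cmod (\<xi> (f x)))\<^sup>2) = (\<Sum>\<^sub>\<infinity>x\<in>A. (cmod (\<xi> x))\<^sup>2)"
      by (rule infsum_reindex_bij_betw[OF f])
    ultimately show ?thesis
      using \<xi> by (simp add: ell2_def ell2_norm_def cong: summable_on_cong infsum_cong)
  qed
  moreover have "f h \<in> A" if "h \<in> A" for h
    using f that by (auto simp: bij_betw_def)
  ultimately show ?thesis
    unfolding bounded_ops_def
    by (auto simp: ell2_add(1) ell2_scale fun_eq_iff fun_scale_def intro!: exI[of _ 1])
      (auto simp: ell2_scale[unfolded fun_scale_def])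
qed

context
  fixes G :: "('g, 'm) monoid_scheme" (structure)
  assumes G: "group G"
begin

interpretation group G by (rule G)

lemma left_reg_bounded: "g \<in> carrier G \<Longrightarrow> left_reg G g \<in> bounded_ops (carrier G)"
  unfolding left_reg_def
  by (rule reindex_op_bounded) (rule bij_betwI[where g = "\<lambda>h. g \<otimes> h"], auto simp: m_assoc[symmetric])

lemma left_reg_delta:
  assumes "g \<in> carrier G" "h \<in> carrier G"
  shows "left_reg G g (delta h) = delta (g \<otimes> h)"
proof -
  have "m_inv G g \<otimes> k = h \<longleftrightarrow> k = g \<otimes> h" if "k \<in> carrier G" for k
    using assms that by (metis inv_solve_left')
  then show ?thesis
    unfolding left_reg_def if_P[OF delta_in_ell2[OF assms(2)]]
    using assms by (auto simp: fun_eq_iff delta_def)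
qed

definition right_reg :: "'g \<Rightarrow> 'g op" where
  "right_reg g \<xi> =
    (if \<xi> \<in> ell2 (carrier G) then (\<lambda>h. if h \<in> carrier G then \<xi> (h \<otimes> g) else 0) else 0)"

lemma right_reg_bounded: "g \<in> carrier G \<Longrightarrow> right_reg g \<in> bounded_ops (carrier G)"
  unfolding right_reg_def
  by (rule reindex_op_bounded) (rule bij_betwI[where g = "\<lambda>h. h \<otimes> m_inv G g"], auto simp: m_assoc)

lemma right_reg_commutant:
  assumes g: "g \<in> carrier G"
  shows "right_reg g \<in> commutant (carrier G) (left_reg G ` carrier G)"
proof (rule commutantI[OF right_reg_bounded[OF g]])
  show "left_reg G ` carrier G \<subseteq> bounded_ops (carrier G)"
    using left_reg_bounded by blast
  fix R \<xi> assume "R \<in> left_reg G ` carrier G" and \<xi>: "\<xi> \<in> ell2 (carrier G)"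
  then obtain h where h: "h \<in> carrier G" "R = left_reg G h" by blast
  have "left_reg G h \<xi> \<in> ell2 (carrier G)" "right_reg g \<xi> \<in> ell2 (carrier G)"
    using \<xi> g h bounded_ops_ell2 left_reg_bounded right_reg_bounded by blast+
  then show "right_reg g (R \<xi>) = R (right_reg g \<xi>)"
    using g h(1) \<xi> unfolding h(2)
    by (simp add: left_reg_def[of G h "right_reg g \<xi>"] right_reg_def[of g "left_reg G h \<xi>"] fun_eq_iff)
      (simp add: left_reg_def right_reg_def m_assoc)
qed

lemma group_vN_eqI:
  assumes x: "x \<in> group_vN G" and y: "y \<in> group_vN G"
    and eq: "\<And>g. g \<in> carrier G \<Longrightarrow> x (delta \<one>) g = y (delta \<one>) g"
  shows "x = y"
proof (rule bounded_ops_eqI)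
  show b: "x \<in> bounded_ops (carrier G)" "y \<in> bounded_ops (carrier G)"
    using x y unfolding group_vN_def by (auto dest: commutantD(1))
  have e: "delta \<one> \<in> ell2 (carrier G)" by (simp add: delta_in_ell2)
  then have "x (delta \<one>) \<in> ell2 (carrier G)" "y (delta \<one>) \<in> ell2 (carrier G)"
    using b bounded_ops_ell2 by blast+
  then have "x (delta \<one>) = y (delta \<one>)"
    using eq unfolding ell2_def mem_Collect_eq by (metis ext)
  moreover fix k assume k: "k \<in> carrier G"
  have "h \<otimes> m_inv G k = \<one> \<longleftrightarrow> h = k" if "h \<in> carrier G" for h
    using inv_solve_right[OF one_closed that k] k by auto
  then have "delta k = right_reg (m_inv G k) (delta \<one>)"
    using k e by (auto simp: right_reg_def delta_def fun_eq_iff)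
  moreover have "z (right_reg (m_inv G k) (delta \<one>)) = right_reg (m_inv G k) (z (delta \<one>))"
    if "z \<in> group_vN G" for z
    using that unfolding group_vN_def
    by (rule commutantD(2)) (simp add: right_reg_commutant k)
  ultimately show "x (delta k) = y (delta k)"
    using x y by simp
qed

lemma group_algebra_subset_group_vN: "group_algebra G \<subseteq> group_vN G"
  unfolding group_algebra_def group_vN_def
proof (rule op_cspace.span_minimal)
  show "op_cspace.subspace (commutant (carrier G) (commutant (carrier G) (left_reg G ` carrier G)))"
    by (rule op_subspace_commutant) (auto dest: commutantD(1))
  show "left_reg G ` carrier G \<subseteq> commutant (carrier G) (commutant (carrier G) (left_reg G ` carrier G))"
  proof
    fix x assume x: "x \<in> left_reg G ` carrier G"
    show "x \<in> commutant (carrier G) (commutant (carrier G) (left_reg G ` carrier G))"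
    proof (rule commutantI)
      show "x (R \<xi>) = R (x \<xi>)" if "R \<in> commutant (carrier G) (left_reg G ` carrier G)" for R \<xi>
        using commutantD(2)[OF that x] by simp
    qed (use x left_reg_bounded in \<open>auto dest: commutantD(1)\<close>)
  qed
qed

lemma group_algebra_multiplier:
  assumes "x \<in> group_algebra G"
  shows "\<exists>y\<in>group_algebra G. \<forall>g\<in>carrier G. y (delta \<one>) g = m g * x (delta \<one>) g"
  using assms unfolding group_algebra_def
proof (induction rule: op_cspace.span_induct_alt)
  case base
  show ?case by (rule bexI[of _ 0]) (simp_all add: op_cspace.span_zero)
next
  case (step c x y)
  then obtain g where g: "g \<in> carrier G" "x = left_reg G g" by blast
  from step obtain z where z: "z \<in> op_cspace.span (left_reg G ` carrier G)"
    "\<forall>g\<in>carrier G. z (delta \<one>) g = m g * y (delta \<one>) g" by blast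
  have xg: "x (delta \<one>) = delta g"
    unfolding g(2) using left_reg_delta[OF g(1) one_closed] g(1) by simp
  show ?case
  proof (rule bexI[of _ "op_scale (m g * c) x + z"])
    show "op_scale (m g * c) x + z \<in> op_cspace.span (left_reg G ` carrier G)"
      by (intro op_cspace.span_add[OF _ z(1)] op_cspace.span_scale op_cspace.span_base step(1))
    show "\<forall>h\<in>carrier G. (op_scale (m g * c) x + z) (delta \<one>) h = m h * (op_scale c x + y) (delta \<one>) h"
      using z(2) unfolding plus_fun_apply op_scale_def xg
      by (auto simp: fun_scale_def delta_def algebra_simps)
  qed
qed

lemma group_algebra_finite_support:
  assumes "x \<in> group_algebra G"
  shows "\<exists>F. finite F \<and> F \<subseteq> carrier G \<and> (\<forall>g. g \<notin> F \<longrightarrow> x (delta \<one>) g = 0)"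
  using assms unfolding group_algebra_def
proof (induction rule: op_cspace.span_induct_alt)
  case base
  show ?case by (rule exI[of _ "{}"]) simp
next
  case (step c x y)
  then obtain g where g: "g \<in> carrier G" "x = left_reg G g" by blast
  from step obtain F where F: "finite F" "F \<subseteq> carrier G" "\<forall>g. g \<notin> F \<longrightarrow> y (delta \<one>) g = 0" by blast
  have "x (delta \<one>) = delta g"
    unfolding g(2) using left_reg_delta[OF g(1) one_closed] g(1) by simp
  with F g(1) show ?case
    by (intro exI[of _ "insert g F"]) (auto simp: op_scale_def fun_scale_def delta_def)
qed

lemma length_semigroup_coeff:
  assumes "x \<in> group_algebra G"
  shows "length_semigroup G \<psi> t x \<in> group_algebra G"
    and "g \<in> carrier G \<Longrightarrow>
      length_semigroup G \<psi> t x (delta \<one>) g = of_real (exp (- t * \<psi> g)) * x (delta \<one>) g"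
proof -
  obtain y where y: "y \<in> group_algebra G"
    "\<forall>g\<in>carrier G. y (delta \<one>) g = of_real (exp (- t * \<psi> g)) * x (delta \<one>) g"
    using group_algebra_multiplier[OF assms, of "\<lambda>g. of_real (exp (- t * \<psi> g))"] by blast
  have "length_semigroup G \<psi> t x = y"
    unfolding length_semigroup_def
  proof (rule the_equality)
    show "z = y" if "z \<in> group_vN G \<and>
      (\<forall>g\<in>carrier G. z (delta \<one>) g = of_real (exp (- t * \<psi> g)) * x (delta \<one>) g)" for z
      using that y group_algebra_subset_group_vN by (intro group_vN_eqI) auto
  qed (use y group_algebra_subset_group_vN in blast)
  with y show "length_semigroup G \<psi> t x \<in> group_algebra G"
    "g \<in> carrier G \<Longrightarrow>
      length_semigroup G \<psi> t x (delta \<one>) g = of_real (exp (- t * \<psi> g)) * x (delta \<one>) g"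
    by simp_all
qed

lemma group_algebra_off_carrier:
  "x \<in> group_algebra G \<Longrightarrow> g \<notin> carrier G \<Longrightarrow> x (delta \<one>) g = 0"
  using group_algebra_finite_support by blast

lemma generator_coeff:
  assumes x: "x \<in> group_algebra G"
  shows "generator G (length_semigroup G \<psi>) x \<in> group_algebra G"
    and "g \<in> carrier G \<Longrightarrow>
      generator G (length_semigroup G \<psi>) x (delta \<one>) g = of_real (\<psi> g) * x (delta \<one>) g"
proof -
  let ?\<Phi> = "length_semigroup G \<psi>"
  let ?q = "\<lambda>t. fun_scale (of_real (1 / t)) ((x - ?\<Phi> t x) (delta \<one>))"
  let ?N = "ell2_norm (carrier G)"
  obtain y where y: "y \<in> group_algebra G"
    "\<forall>g\<in>carrier G. y (delta \<one>) g = of_real (\<psi> g) * x (delta \<one>) g"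
    using group_algebra_multiplier[OF x, of "\<lambda>g. of_real (\<psi> g)"] by blast
  obtain F where F: "finite F" "F \<subseteq> carrier G" "\<forall>g. g \<notin> F \<longrightarrow> x (delta \<one>) g = 0"
    using group_algebra_finite_support[OF x] by blast
  have q: "?q t g = of_real ((1 - exp (- t * \<psi> g)) / t) * x (delta \<one>) g" for t g
  proof (cases "g \<in> carrier G")
    case True
    then show ?thesis
      using length_semigroup_coeff(2)[OF x True, of \<psi> t]
      by (simp add: fun_scale_def field_simps del: of_real_exp)
  next
    case False
    then show ?thesis
      using group_algebra_off_carrier[OF x] group_algebra_off_carrier[OF length_semigroup_coeff(1)[OF x]]
      by (simp add: fun_scale_def)
  qed
  have lim: "((\<lambda>t. (1 - exp (- t * c)) / t) \<longlongrightarrow> c) (at_right 0)" for c :: real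
  proof -
    have "((\<lambda>t. exp (- t * c)) has_real_derivative (- c)) (at 0)"
      by (auto intro!: derivative_eq_intros)
    then have "((\<lambda>t. - ((exp (- t * c) - 1) / t)) \<longlongrightarrow> - (- c)) (at 0)"
      unfolding DERIV_def by (intro tendsto_minus) simp
    then show ?thesis
      by (auto intro: tendsto_mono[OF at_le] simp: minus_divide_left)
  qed
  have limq: "((\<lambda>t. ?q t g) \<longlongrightarrow> of_real (\<psi> g) * x (delta \<one>) g) (at_right 0)" for g
    unfolding q by (intro tendsto_mult tendsto_of_real lim tendsto_const)
  have supp: "?N (?q t - z) = sqrt (\<Sum>g\<in>F'. (cmod (?q t g - z g))\<^sup>2)"
    if "finite F'" "F \<subseteq> F'" "F' \<subseteq> carrier G" "\<forall>g. g \<notin> F' \<longrightarrow> z g = 0" for z F' t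
  proof -
    have "x (delta \<one>) g = 0" if "g \<notin> F'" for g
      using F(3) \<open>F \<subseteq> F'\<close> that by blast
    then have "(?q t - z) g = 0" if "g \<notin> F'" for g
      unfolding fun_diff_def[of "?q t"] q using that \<open>\<forall>g. g \<notin> F' \<longrightarrow> z g = 0\<close> by simp
    then show ?thesis
      by (subst ell2_finite_support(2)[OF that(1) that(3)]) simp_all
  qed
  have "generator G ?\<Phi> x = y"
    unfolding generator_def
  proof (rule the_equality, intro conjI y(1))
    have "\<forall>g. g \<notin> F \<longrightarrow> y (delta \<one>) g = 0"
      using y group_algebra_off_carrier[OF y(1)] F(3) by (metis mult_zero_right)
    then have "?N (?q t - y (delta \<one>)) = sqrt (\<Sum>g\<in>F. (cmod (?q t g - y (delta \<one>) g))\<^sup>2)" for t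
      by (intro supp F) auto
    moreover have "((\<lambda>t. sqrt (\<Sum>g\<in>F. (cmod (?q t g - y (delta \<one>) g))\<^sup>2)) \<longlongrightarrow>
        sqrt (\<Sum>g\<in>F. (cmod (of_real (\<psi> g) * x (delta \<one>) g - y (delta \<one>) g))\<^sup>2)) (at_right 0)"
      by (intro tendsto_intros limq)
    moreover have "(\<Sum>g\<in>F. (cmod (of_real (\<psi> g) * x (delta \<one>) g - y (delta \<one>) g))\<^sup>2) = 0"
      using y(2) F(2) by (intro sum.neutral) auto
    ultimately show "((\<lambda>t. ?N (?q t - y (delta \<one>))) \<longlongrightarrow> 0) (at_right 0)"
      by simp
  next
    fix z assume z: "z \<in> group_algebra G \<and> ((\<lambda>t. ?N (?q t - z (delta \<one>))) \<longlongrightarrow> 0) (at_right 0)"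
    then obtain F1 where F1: "finite F1" "F1 \<subseteq> carrier G" "\<forall>g. g \<notin> F1 \<longrightarrow> z (delta \<one>) g = 0"
      using group_algebra_finite_support by blast
    have N: "?N (?q t - z (delta \<one>)) = sqrt (\<Sum>g\<in>F \<union> F1. (cmod (?q t g - z (delta \<one>) g))\<^sup>2)" for t
      using F F1 by (intro supp) auto
    have "z (delta \<one>) g = y (delta \<one>) g" if g: "g \<in> carrier G" for g
    proof (cases "g \<in> F \<union> F1")
      case True
      have "cmod (?q t g - z (delta \<one>) g) \<le> ?N (?q t - z (delta \<one>))" for t
        unfolding N using F(1) F1(1) True by (intro real_le_rsqrt member_le_sum) auto
      then have "((\<lambda>t. ?q t g - z (delta \<one>) g) \<longlongrightarrow> 0) (at_right 0)"
        using z by (intro Lim_null_comparison[OF _ conjunct2[OF z]] always_eventually) auto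
      then have "((\<lambda>t. ?q t g) \<longlongrightarrow> z (delta \<one>) g) (at_right 0)"
        by (simp add: LIM_zero_iff)
      from tendsto_unique[OF _ this limq] show ?thesis
        using y(2) g by simp
    next
      case False
      then show ?thesis using F F1 y g by auto
    qed
    then show "z = y"
      using z y group_algebra_subset_group_vN by (intro group_vN_eqI) auto
  qed
  with y show "generator G ?\<Phi> x \<in> group_algebra G"
    "g \<in> carrier G \<Longrightarrow> generator G ?\<Phi> x (delta \<one>) g = of_real (\<psi> g) * x (delta \<one>) g"
    by simp_all
qed

lemma generator_left_reg:
  assumes g: "g \<in> carrier G"
  shows "generator G (length_semigroup G \<psi>) (left_reg G g) = op_scale (of_real (\<psi> g)) (left_reg G g)"
proof -
  have x: "left_reg G g \<in> group_algebra G"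
    unfolding group_algebra_def using g by (intro op_cspace.span_base) blast
  moreover have "op_scale (of_real (\<psi> g)) (left_reg G g) \<in> group_algebra G"
    using x unfolding group_algebra_def by (rule op_cspace.span_scale)
  moreover have "left_reg G g (delta \<one>) = delta g" using g by (simp add: left_reg_delta)
  ultimately show ?thesis
    using group_algebra_subset_group_vN generator_coeff[OF x]
    by (intro group_vN_eqI) (auto simp: op_scale_def fun_scale_def delta_def)
qed

lemma generator_linear:
  assumes x: "x \<in> group_algebra G" and y: "y \<in> group_algebra G"
  shows "generator G (length_semigroup G \<psi>) (op_scale c x + y) =
    op_scale c (generator G (length_semigroup G \<psi>) x) + generator G (length_semigroup G \<psi>) y"
proof -
  have xy: "op_scale c x + y \<in> group_algebra G"
    using x y unfolding group_algebra_def
    by (intro op_cspace.span_add op_cspace.span_scale)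
  moreover have "op_scale c (generator G (length_semigroup G \<psi>) x) +
      generator G (length_semigroup G \<psi>) y \<in> group_algebra G"
    using generator_coeff(1)[OF x] generator_coeff(1)[OF y] unfolding group_algebra_def
    by (intro op_cspace.span_add op_cspace.span_scale)
  ultimately show ?thesis
    using group_algebra_subset_group_vN generator_coeff[OF x] generator_coeff[OF y]
      generator_coeff[OF xy]
    by (intro group_vN_eqI) (auto simp: op_scale_def fun_scale_def algebra_simps)
qed

end

end

(*
  Write |w| for the word length. On group elements, the gradient form of a = lambda_g, b = lambda_h
  sends lambda_w to c(w) lambda_{gwh} with c(w) = |gwh| + |w| - |gw| - |wh|, so it is enough that c has
  finite support: the operator is then given by a finite matrix and lies in every Schatten class. The
  cocycle identities of c in g and h reduce this to generators g = s, h = t, and there the exchange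
  condition shows that c(w) is nonzero only if sw = wt.

  If sw = wt and |sw| > |w|, choose a right descent r of w and split w = u d along the coset of the
  dihedral subgroup of r and t. Then su = uj for some j in {r, t}, m = m(r, t) is finite, d is the
  alternating word of length m - 1 ending in r, and j = r if m is odd, j = t if m is even. Iterating,
  w is a product of such words d along a walk that moves along odd edges and stays put at even edges.
  On a forest the words of the odd edges are the coboundary of a potential g, and the even edges at
  the component of s contribute at most one involution rho, so w = g(s)^-1 z g(t) with z in {1, rho}.
*)
theory Submission
  imports Defs "HOL-Library.Transitive_Closure_Table"
begin

section \<open>Finite kernels\<close>

text \<open>The group is known only through its presentation. Relators give upper bounds: they show
  that words coincide, never that they differ. The lower bounds come from two actions. Conjugation
  on group elements with a sign (\<open>refl_act\<close>) makes the parity of a reflection in a word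
  an invariant of the element, and exchange follows. The contragredient of the geometric
  representation (\<open>fire\<close>) makes a product of two generators act as a rotation, or with
  linear growth if m is infinite; this is why equality of the two alternating words of length k
  forces m to be finite and to divide k.

  The graph hypotheses keep the walks from producing infinitely many elements. Around a cycle of odd
  edges the words could multiply to an element whose powers all occur; on a forest only the ends of
  the walk matter. Two different involutions from even edges could be alternated forever, whereas a
  single one gives just two elements.\<close>

definition kernel_op :: "'a set \<Rightarrow> 'a set \<Rightarrow> ('a \<Rightarrow> 'a \<Rightarrow> complex) \<Rightarrow> 'a op" where
  "kernel_op A F k \<xi> = (if \<xi> \<in> ell2 A then (\<lambda>y. if y \<in> F then \<Sum>x\<in>F. k y x * \<xi> x else 0) else 0)"

lemma sum_fun_apply: "(\<Sum>i\<in>I. f i) x = (\<Sum>i\<in>I. f i x)" for f :: "'i \<Rightarrow> 'a \<Rightarrow> complex"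
  by (induction I rule: infinite_finite_induct) auto

lemma ell2_coord_le:
  assumes "\<xi> \<in> ell2 A" "x \<in> A"
  shows "cmod (\<xi> x) \<le> ell2_norm A \<xi>"
proof -
  have "(\<Sum>y\<in>{x}. (cmod (\<xi> y))\<^sup>2) \<le> (\<Sum>\<^sub>\<infinity>y\<in>A. (cmod (\<xi> y))\<^sup>2)"
    using assms by (intro finite_sum_le_infsum) (auto simp: ell2_def)
  then show ?thesis
    unfolding ell2_norm_def by (intro real_le_rsqrt) simp
qed

lemma kernel_op_outside: "\<xi> \<notin> ell2 A \<Longrightarrow> kernel_op A F k \<xi> = 0"
  by (simp add: kernel_op_def)

text \<open>Bolzano-Weierstrass for one coordinate at a time, with a further subsequence taken for
  each of the finitely many coordinates.\<close>

lemma coordinatewise_convergent_subseq: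
  fixes \<xi> :: "nat \<Rightarrow> 'a \<Rightarrow> complex"
  assumes "finite F" "\<And>n x. x \<in> F \<Longrightarrow> cmod (\<xi> n x) \<le> 1"
  shows "\<exists>r l. strict_mono (r :: nat \<Rightarrow> nat) \<and> (\<forall>x\<in>F. (\<lambda>n. \<xi> (r n) x) \<longlonglongrightarrow> l x)"
  using assms
proof (induction F rule: finite_induct)
  case empty
  show ?case by (rule exI[of _ id]) (auto simp: strict_mono_def)
next
  case (insert a G)
  then obtain r l where r: "strict_mono r" "\<forall>x\<in>G. (\<lambda>n. \<xi> (r n) x) \<longlonglongrightarrow> l x" by auto
  have "bounded (range (\<lambda>n. \<xi> (r n) a))"
    using insert.prems by (auto simp: bounded_iff)
  then obtain c q where q: "strict_mono q" "((\<lambda>n. \<xi> (r n) a) \<circ> q) \<longlonglongrightarrow> c"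
    using bounded_imp_convergent_subsequence by blast
  have "(\<lambda>n. \<xi> ((r \<circ> q) n) x) \<longlonglongrightarrow> (l(a := c)) x" if "x \<in> insert a G" for x
    using that q r(2) LIMSEQ_subseq_LIMSEQ[OF _ q(1), of "\<lambda>n. \<xi> (r n) x"]
    by (auto simp: o_def)
  moreover have "strict_mono (r \<circ> q)" using r q by (simp add: strict_mono_o)
  ultimately show ?case by blast
qed

text \<open>Linearity of \<open>L\<close> is asked only on \<open>V\<close>: the intended
  \<open>L\<close>, the adjoint of T after T, is set to 0 off \<open>ell2 A\<close> and so need not
  be linear on all functions.\<close>

lemma eigenvectors_independent:
  assumes "finite B" "\<forall>v\<in>B. v \<in> V \<and> v \<noteq> 0 \<and> L v = fun_scale (\<mu> v) v" "inj_on \<mu> B"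
    and V: "fun_cspace.subspace V"
    and add: "\<And>\<xi> \<eta>. \<xi> \<in> V \<Longrightarrow> \<eta> \<in> V \<Longrightarrow> L (\<xi> + \<eta>) = L \<xi> + L \<eta>"
    and scale: "\<And>c \<xi>. \<xi> \<in> V \<Longrightarrow> L (fun_scale c \<xi>) = fun_scale c (L \<xi>)"
  shows "fun_cspace.independent B"
proof (rule fun_cspace.independent_if_scalars_zero[OF assms(1)])
  have L0: "L 0 = 0" using scale[OF fun_cspace.subspace_0[OF V], of 0] by simp
  fix f v assume "(\<Sum>x\<in>B. fun_scale (f x) x) = 0" "v \<in> B"
  with assms(1) show "f v = 0"
    using assms(2,3)
  proof (induction B arbitrary: f v rule: finite_induct)
    case (insert w B)
    note wB = insert.prems(3)
    let ?s = "\<lambda>f. \<Sum>x\<in>B. fun_scale (f x) x"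
    have sV: "?s g \<in> V" for g
      using insert.prems V by (auto intro!: fun_cspace.subspace_sum fun_cspace.subspace_scale)
    have "L (\<Sum>x\<in>B'. fun_scale (f x) x) = (\<Sum>x\<in>B'. fun_scale (\<mu> x) (fun_scale (f x) x))"
      if "B' \<subseteq> insert w B" for B'
      using finite_subset[OF that finite.insertI[OF insert(1)]] that
    proof (induction B' rule: finite_induct)
      case (insert x B')
      have "(\<Sum>x\<in>B'. fun_scale (f x) x) \<in> V" "x \<in> V" "fun_scale (f x) x \<in> V"
        using insert.prems wB V
        by (auto intro!: fun_cspace.subspace_sum fun_cspace.subspace_scale)
      then have "L (fun_scale (f x) x + (\<Sum>x\<in>B'. fun_scale (f x) x)) =
          fun_scale (f x) (L x) + L (\<Sum>x\<in>B'. fun_scale (f x) x)"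
        by (simp only: add scale)
      moreover have "L x = fun_scale (\<mu> x) x" using insert.prems wB by blast
      moreover have "L (\<Sum>x\<in>B'. fun_scale (f x) x) = (\<Sum>x\<in>B'. fun_scale (\<mu> x) (fun_scale (f x) x))"
        using insert.IH insert.prems by blast
      ultimately show ?case
        by (simp only: sum.insert[OF insert.hyps] fun_cspace.scale_scale mult.commute)
    qed (simp add: L0)
    from this[of "insert w B", OF order.refl]
    have "(\<Sum>x\<in>insert w B. fun_scale (\<mu> x) (fun_scale (f x) x)) = 0"
      unfolding insert.prems(1) L0 by (rule HOL.sym)
    moreover have "fun_scale (\<mu> w) (\<Sum>x\<in>insert w B. fun_scale (f x) x) = 0"
      unfolding insert.prems(1) by (rule fun_cspace.scale_zero_right)
    \<comment> \<open>Subtracting \<open>\<mu> w\<close> times the relation from its image under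
      \<open>L\<close> removes the term of \<open>w\<close>; the induction hypothesis applies to the
      rest.\<close>
    ultimately have "(\<Sum>x\<in>insert w B. fun_scale (\<mu> x) (fun_scale (f x) x)) -
        (\<Sum>x\<in>insert w B. fun_scale (\<mu> w) (fun_scale (f x) x)) = 0"
      by (simp only: fun_cspace.scale_sum_right diff_0_right)
    then have "(\<Sum>x\<in>insert w B. fun_scale ((\<mu> x - \<mu> w) * f x) x) = 0"
      by (simp only: sum_subtractf[symmetric] fun_cspace.scale_scale
          fun_cspace.scale_left_diff_distrib[symmetric] left_diff_distrib[symmetric])
    then have "?s (\<lambda>x. (\<mu> x - \<mu> w) * f x) = 0"
      by (simp only: sum.insert[OF insert(1,2)] diff_self mult_zero_left fun_cspace.scale_zero_left add_0)
    moreover have "inj_on \<mu> B" using insert.prems by (simp add: inj_on_def)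
    ultimately have "(\<mu> x - \<mu> w) * f x = 0" if "x \<in> B" for x
      using insert.IH[of "\<lambda>x. (\<mu> x - \<mu> w) * f x" x] that insert.prems by blast
    moreover have "\<mu> x \<noteq> \<mu> w" if "x \<in> B" for x
      using insert.prems(4) insert(2) that by (auto simp: inj_on_def)
    ultimately have f0: "f x = 0" if "x \<in> B" for x using that by auto
    then have "?s f = 0" by (intro sum.neutral ballI) (simp only: fun_cspace.scale_zero_left)
    then have "fun_scale (f w) w = 0"
      using insert.prems(1) unfolding sum.insert[OF insert(1,2)] by (simp only: add_0_right)
    then have "f w = 0" using insert.prems(3) fun_cspace.scale_eq_0_iff by blast
    with f0 insert.prems(2) show ?case by blast
  qed simp
qed

context
  fixes A F :: "'a set"
  assumes F: "finite F" "F \<subseteq> A"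
begin

lemma kernel_op_support:
  shows "y \<notin> F \<Longrightarrow> kernel_op A F k \<xi> y = 0"
    and "kernel_op A F k \<xi> \<in> ell2 A"
    and "ell2_norm A (kernel_op A F k \<xi>) = sqrt (\<Sum>y\<in>F. (cmod (kernel_op A F k \<xi> y))\<^sup>2)"
proof -
  show *: "kernel_op A F k \<xi> y = 0" if "y \<notin> F" for y
    using that by (simp add: kernel_op_def)
  show "kernel_op A F k \<xi> \<in> ell2 A"
    "ell2_norm A (kernel_op A F k \<xi>) = sqrt (\<Sum>y\<in>F. (cmod (kernel_op A F k \<xi> y))\<^sup>2)"
    using F * by (intro ell2_finite_support[of F]; simp)+
qed

lemma kernel_op_bounded: "kernel_op A F k \<in> bounded_ops A"
proof -
  \<comment> \<open>A crude bound is enough: each coordinate of \<xi> is at most its norm, so the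
    absolute row sums of \<open>k\<close> control the output.\<close>
  define C where "C = sqrt (\<Sum>y\<in>F. (\<Sum>x\<in>F. cmod (k y x))\<^sup>2)"
  have "ell2_norm A (kernel_op A F k \<xi>) \<le> C * ell2_norm A \<xi>" if \<xi>: "\<xi> \<in> ell2 A" for \<xi>
  proof -
    have "cmod (kernel_op A F k \<xi> y) \<le> (\<Sum>x\<in>F. cmod (k y x)) * ell2_norm A \<xi>" if "y \<in> F" for y
    proof -
      have "cmod (kernel_op A F k \<xi> y) \<le> (\<Sum>x\<in>F. cmod (k y x) * cmod (\<xi> x))"
        using \<xi> that by (simp add: kernel_op_def sum_norm_le norm_mult)
      also have "\<dots> \<le> (\<Sum>x\<in>F. cmod (k y x) * ell2_norm A \<xi>)"
        using F by (intro sum_mono mult_left_mono ell2_coord_le[OF \<xi>]) auto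
      finally show ?thesis by (simp add: sum_distrib_right)
    qed
    then have "(\<Sum>y\<in>F. (cmod (kernel_op A F k \<xi> y))\<^sup>2)
        \<le> (\<Sum>y\<in>F. ((\<Sum>x\<in>F. cmod (k y x)) * ell2_norm A \<xi>)\<^sup>2)"
      by (intro sum_mono power_mono) auto
    also have "\<dots> = (\<Sum>y\<in>F. (\<Sum>x\<in>F. cmod (k y x))\<^sup>2) * (ell2_norm A \<xi>)\<^sup>2"
      by (simp only: power_mult_distrib sum_distrib_right[symmetric])
    finally have "ell2_norm A (kernel_op A F k \<xi>) \<le>
        sqrt ((\<Sum>y\<in>F. (\<Sum>x\<in>F. cmod (k y x))\<^sup>2) * (ell2_norm A \<xi>)\<^sup>2)"
      unfolding kernel_op_support(3) by (rule real_sqrt_le_mono)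
    then show ?thesis
      unfolding real_sqrt_mult real_sqrt_abs abs_of_nonneg[OF ell2_norm_ge_0] C_def .
  qed
  then have "\<exists>C. \<forall>\<xi>\<in>ell2 A. ell2_norm A (kernel_op A F k \<xi>) \<le> C * ell2_norm A \<xi>" by blast
  moreover have "kernel_op A F k (\<xi> + \<eta>) = kernel_op A F k \<xi> + kernel_op A F k \<eta>"
    if "\<xi> \<in> ell2 A" "\<eta> \<in> ell2 A" for \<xi> \<eta>
    using that by (auto simp: kernel_op_def ell2_add(1) fun_eq_iff algebra_simps sum.distrib)
  moreover have "kernel_op A F k (fun_scale c \<xi>) = fun_scale c (kernel_op A F k \<xi>)"
    if "\<xi> \<in> ell2 A" for c \<xi>
    using that by (simp add: kernel_op_def ell2_scale)
      (auto simp: fun_scale_def fun_eq_iff algebra_simps sum_distrib_left)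
  ultimately show ?thesis
    unfolding bounded_ops_def mem_Collect_eq
    using kernel_op_support(2) by (simp add: kernel_op_outside)
qed

text \<open>Only coordinates in \<open>F\<close> are read and written, so a subsequence that
  converges at each of them has images that converge in norm.\<close>

lemma kernel_op_compact: "kernel_op A F k \<in> compact_ops A"
  unfolding compact_ops_def mem_Collect_eq
proof (intro conjI kernel_op_bounded allI impI)
  fix \<xi> :: "nat \<Rightarrow> 'a \<Rightarrow> complex"
  assume \<xi>: "\<forall>n. \<xi> n \<in> ell2 A \<and> ell2_norm A (\<xi> n) \<le> 1"
  then have "cmod (\<xi> n x) \<le> 1" if "x \<in> F" for n x
    using ell2_coord_le[of "\<xi> n" A x] F that by (meson order_trans subsetD)
  then obtain r l where r: "strict_mono (r :: nat \<Rightarrow> nat)" "\<forall>x\<in>F. (\<lambda>n. \<xi> (r n) x) \<longlonglongrightarrow> l x"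
    using coordinatewise_convergent_subseq[OF F(1)] by blast
  define \<eta> where "\<eta> = (\<lambda>y. if y \<in> F then \<Sum>x\<in>F. k y x * l x else 0)"
  have \<eta>: "\<eta> \<in> ell2 A"
    using F by (intro ell2_finite_support(1)[of F]) (auto simp: \<eta>_def)
  have "ell2_norm A (kernel_op A F k (\<xi> (r n)) - \<eta>) =
      sqrt (\<Sum>y\<in>F. (cmod ((\<Sum>x\<in>F. k y x * \<xi> (r n) x) - (\<Sum>x\<in>F. k y x * l x)))\<^sup>2)" for n
    using F \<xi> by (subst ell2_finite_support(2)[of F]) (auto simp: \<eta>_def kernel_op_def)
  moreover have "(\<lambda>n. sqrt (\<Sum>y\<in>F. (cmod ((\<Sum>x\<in>F. k y x * \<xi> (r n) x) - (\<Sum>x\<in>F. k y x * l x)))\<^sup>2))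
      \<longlonglongrightarrow> sqrt (\<Sum>y\<in>F. (cmod ((\<Sum>x\<in>F. k y x * l x) - (\<Sum>x\<in>F. k y x * l x)))\<^sup>2)"
    using r(2) by (intro tendsto_intros) auto
  ultimately have "(\<lambda>n. ell2_norm A (kernel_op A F k (\<xi> (r n)) - \<eta>)) \<longlonglongrightarrow> 0" by simp
  with r(1) \<eta> show "\<exists>r \<eta>. strict_mono r \<and> \<eta> \<in> ell2 A \<and>
      (\<lambda>n. ell2_norm A (kernel_op A F k (\<xi> (r n)) - \<eta>)) \<longlonglongrightarrow> 0" by blast
qed

section \<open>Singular values of a finite kernel\<close>

lemma adjoint_kernel_op:
  assumes "\<xi> \<in> ell2 A"
  shows "adjoint_op A (kernel_op A F k) (kernel_op A F k \<xi>) =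
    (\<lambda>x. if x \<in> F then \<Sum>y\<in>F. kernel_op A F k \<xi> y * cnj (k y x) else 0)"
proof
  fix x
  have d: "kernel_op A F k (delta x) = (\<lambda>y. if y \<in> F \<and> x \<in> F then k y x else 0)" if "x \<in> A"
    using F delta_in_ell2[OF that]
    by (auto simp: kernel_op_def fun_eq_iff) (auto simp: delta_def if_distrib cong: if_cong)
  have "ell2_inner A (kernel_op A F k \<xi>) (kernel_op A F k (delta x)) =
     (if x \<in> F then \<Sum>y\<in>F. kernel_op A F k \<xi> y * cnj (k y x) else 0)" if "x \<in> A"
    unfolding ell2_inner_def d[OF that]
  proof (rule infsumI, cases "x \<in> F")
    case True
    then show "((\<lambda>y. kernel_op A F k \<xi> y * cnj (if y \<in> F \<and> x \<in> F then k y x else 0)) has_sum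
      (if x \<in> F then \<Sum>y\<in>F. kernel_op A F k \<xi> y * cnj (k y x) else 0)) A"
      using F by (intro has_sum_finite_neutralI[of F]) auto
  qed simp
  then show "adjoint_op A (kernel_op A F k) (kernel_op A F k \<xi>) x =
    (if x \<in> F then \<Sum>y\<in>F. kernel_op A F k \<xi> y * cnj (k y x) else 0)"
    using F by (auto simp: adjoint_op_def kernel_op_support(2))
qed

text \<open>An eigenvector for a nonzero eigenvalue is supported in \<open>F\<close>. Eigenvectors
  for different eigenvalues are independent, and the functions supported in \<open>F\<close> leave
  room for at most \<open>card F\<close> of them.\<close>

lemma finite_singular_values_kernel_op:
  "finite {\<sigma>. 0 < \<sigma> \<and> singular_mult A (kernel_op A F k) \<sigma> \<noteq> 0}" (is "finite ?\<Sigma>")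
proof (rule ccontr)
  assume inf: "infinite ?\<Sigma>"
  let ?T = "kernel_op A F k"
  define L where "L \<xi> = adjoint_op A ?T (?T \<xi>)" for \<xi>
  have "\<exists>v. v \<in> ell2 A \<and> L v = fun_scale (of_real (\<sigma>\<^sup>2)) v \<and> v \<noteq> 0" if "\<sigma> \<in> ?\<Sigma>" for \<sigma>
  proof (rule ccontr)
    assume "\<not> ?thesis"
    \<comment> \<open>The zero space has dimension 0, while \<open>singular_mult\<close> is nonzero
      on the set in question.\<close>
    then have "{\<xi> \<in> ell2 A. L \<xi> = fun_scale (of_real (\<sigma>\<^sup>2)) \<xi>} \<subseteq> fun_cspace.span {}"
      by (auto simp: zero_fun_def)
    from fun_cspace.dim_le_card[OF this] that show False
      by (simp add: singular_mult_def L_def)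
  qed
  then obtain v where v: "\<And>\<sigma>. \<sigma> \<in> ?\<Sigma> \<Longrightarrow>
      v \<sigma> \<in> ell2 A \<and> L (v \<sigma>) = fun_scale (of_real (\<sigma>\<^sup>2)) (v \<sigma>) \<and> v \<sigma> \<noteq> 0"
    by metis
  obtain \<Sigma> where \<Sigma>: "finite \<Sigma>" "\<Sigma> \<subseteq> ?\<Sigma>" "card \<Sigma> = Suc (card F)"
    using infinite_arbitrarily_large[OF inf] by blast
  have eq: "\<sigma> = \<tau>" if "\<sigma> \<in> \<Sigma>" "\<tau> \<in> \<Sigma>" "v \<sigma> = v \<tau>" for \<sigma> \<tau>
  proof -
    have "\<sigma> \<in> ?\<Sigma>" "\<tau> \<in> ?\<Sigma>" using that(1,2) \<Sigma>(2) by blast+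
    from v[OF this(1)] v[OF this(2)] have
      "L (v \<sigma>) = fun_scale (of_real (\<sigma>\<^sup>2)) (v \<sigma>)"
      "L (v \<sigma>) = fun_scale (of_real (\<tau>\<^sup>2)) (v \<sigma>)"
      unfolding that(3) by simp_all
    then have "fun_scale (of_real (\<sigma>\<^sup>2)) (v \<sigma>) = fun_scale (of_real (\<tau>\<^sup>2)) (v \<sigma>)"
      by metis
    moreover have "v \<sigma> \<noteq> 0" using v that \<Sigma>(2) by blast
    ultimately have "(complex_of_real \<sigma>)\<^sup>2 = (of_real \<tau>)\<^sup>2" by simp
    then have "\<sigma>\<^sup>2 = \<tau>\<^sup>2" by (metis of_real_eq_iff of_real_power)
    then show ?thesis using that(1,2) \<Sigma>(2) power2_eq_imp_eq[of \<sigma> \<tau>] by force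
  qed
  then have inj: "inj_on v \<Sigma>" by (simp add: inj_on_def)
  \<comment> \<open>The eigenvalue is recovered from the chosen eigenvector, the form that
    \<open>eigenvectors_independent\<close> expects.\<close>
  define \<mu> where "\<mu> w = complex_of_real ((inv_into \<Sigma> v w)\<^sup>2)" for w
  have \<mu>: "\<mu> (v \<sigma>) = of_real (\<sigma>\<^sup>2)" if "\<sigma> \<in> \<Sigma>" for \<sigma>
    using that inj by (simp add: \<mu>_def)
  have "inj_on \<mu> (v ` \<Sigma>)"
  proof (rule inj_onI, elim imageE)
    fix x y \<sigma> \<tau> assume *: "\<mu> x = \<mu> y" "x = v \<sigma>" "y = v \<tau>" "\<sigma> \<in> \<Sigma>" "\<tau> \<in> \<Sigma>"
    then have "\<sigma>\<^sup>2 = \<tau>\<^sup>2" using \<mu>[of \<sigma>] \<mu>[of \<tau>] by (metis of_real_eq_iff)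
    then have "\<sigma> = \<tau>" using *(4,5) \<Sigma>(2) power2_eq_imp_eq[of \<sigma> \<tau>] by force
    then show "x = y" using * by simp
  qed
  then have ind: "fun_cspace.independent (v ` \<Sigma>)"
  proof (rule eigenvectors_independent[where V = "ell2 A" and L = L and \<mu> = \<mu>, rotated 2])
    show "\<forall>w\<in>v ` \<Sigma>. w \<in> ell2 A \<and> w \<noteq> 0 \<and> L w = fun_scale (\<mu> w) w"
    proof
      fix w assume "w \<in> v ` \<Sigma>"
      then obtain \<sigma> where "\<sigma> \<in> \<Sigma>" "w = v \<sigma>" by blast
      moreover from this have "\<sigma> \<in> ?\<Sigma>" using \<Sigma>(2) by blast
      ultimately show "w \<in> ell2 A \<and> w \<noteq> 0 \<and> L w = fun_scale (\<mu> w) w"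
        using v[of \<sigma>] \<mu>[of \<sigma>] by simp
    qed
    show "fun_cspace.subspace (ell2 A)"
      by (rule fun_cspace.subspaceI) (simp_all add: zero_in_ell2 ell2_add(1) ell2_scale)
    show "L (\<xi> + \<eta>) = L \<xi> + L \<eta>" if "\<xi> \<in> ell2 A" "\<eta> \<in> ell2 A" for \<xi> \<eta>
      unfolding L_def adjoint_kernel_op[OF that(1)] adjoint_kernel_op[OF that(2)]
        adjoint_kernel_op[OF ell2_add(1)[OF that]]
      unfolding bounded_ops_add[OF kernel_op_bounded that]
      by (auto simp: fun_eq_iff algebra_simps sum.distrib)
    show "L (fun_scale c \<xi>) = fun_scale c (L \<xi>)" if "\<xi> \<in> ell2 A" for c \<xi>
      unfolding L_def adjoint_kernel_op[OF that] adjoint_kernel_op[OF ell2_scale[OF that]]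
      unfolding bounded_ops_scale[OF kernel_op_bounded that]
      by (auto simp: fun_eq_iff fun_scale_def algebra_simps sum_distrib_left)
  qed (use \<Sigma> in simp)
  have "v \<sigma> \<in> fun_cspace.span (delta ` F)" if "\<sigma> \<in> \<Sigma>" for \<sigma>
  proof -
    have \<sigma>: "0 < \<sigma>" "v \<sigma> \<in> ell2 A" "L (v \<sigma>) = fun_scale (of_real (\<sigma>\<^sup>2)) (v \<sigma>)"
      using that \<Sigma>(2) v by auto
    have "v \<sigma> x = 0" if "x \<notin> F" for x
      using fun_cong[OF \<sigma>(3), of x] that \<sigma>(1)
      unfolding L_def adjoint_kernel_op[OF \<sigma>(2)] by (simp add: fun_scale_def)
    then have "v \<sigma> = (\<Sum>x\<in>F. fun_scale (v \<sigma> x) (delta x))"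
      using F by (auto simp: fun_eq_iff sum_fun_apply fun_scale_def delta_def if_distrib cong: if_cong)
    also have "\<dots> \<in> fun_cspace.span (delta ` F)"
      by (intro fun_cspace.span_sum fun_cspace.span_scale fun_cspace.span_base) simp
    finally show ?thesis .
  qed
  then have "card (v ` \<Sigma>) \<le> card (delta ` F)"
    using fun_cspace.independent_span_bound[OF _ ind, of "delta ` F"] F(1) by blast
  also have "\<dots> \<le> card F" using F(1) by (rule card_image_le)
  finally show False using inj \<Sigma>(3) by (simp add: card_image)
qed

text \<open>A series with finitely many nonzero terms is summable for every exponent; at p =
  \<infinity> compactness is the whole claim.\<close>

lemma kernel_op_schatten: "kernel_op A F k \<in> schatten A p"
proof -
  have "(\<lambda>\<sigma>. real (singular_mult A (kernel_op A F k) \<sigma>) * \<sigma> powr enn2real p) summable_on {0<..}"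
    by (rule finite_nonzero_values_imp_summable_on, rule finite_subset[OF _ finite_singular_values_kernel_op[of k]])
       auto
  then show ?thesis by (simp add: schatten_def kernel_op_compact)
qed

end

section \<open>Reduction of the gradient property to group elements\<close>

text \<open>Padding with zeros puts two kernels on a common index set before they are added.\<close>

lemma kernel_op_extend:
  assumes "finite F'" "F \<subseteq> F'"
  shows "kernel_op A F k = kernel_op A F' (\<lambda>y x. if x \<in> F \<and> y \<in> F then k y x else 0)"
proof (intro ext)
  fix \<xi> y
  have "(\<Sum>x\<in>F'. (if x \<in> F \<and> y \<in> F then k y x else 0) * \<xi> x) = (\<Sum>x\<in>F. k y x * \<xi> x)" if "y \<in> F"
    using assms that by (intro sum.mono_neutral_cong_right) auto
  then show "kernel_op A F k \<xi> y = kernel_op A F' (\<lambda>y x. if x \<in> F \<and> y \<in> F then k y x else 0) \<xi> y"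
    using assms(2) by (auto simp: kernel_op_def)
qed

definition kernel_ops :: "'a set \<Rightarrow> 'a op set" where
  "kernel_ops A = {kernel_op A F k |F k. finite F \<and> F \<subseteq> A}"

lemma kernel_ops_subspace: "op_cspace.subspace (kernel_ops A)"
proof (rule op_cspace.subspaceI)
  have "kernel_op A {} (\<lambda>_ _. 0) = 0" by (auto simp: kernel_op_def fun_eq_iff)
  then show "0 \<in> kernel_ops A" unfolding kernel_ops_def by force
next
  fix T T' assume "T \<in> kernel_ops A" "T' \<in> kernel_ops A"
  then obtain F k F' k' where F: "finite F" "F \<subseteq> A" "finite F'" "F' \<subseteq> A"
    "T = kernel_op A F k" "T' = kernel_op A F' k'"
    by (auto simp: kernel_ops_def)
  define G where "G = F \<union> F'"
  have G: "finite G" "G \<subseteq> A" "F \<subseteq> G" "F' \<subseteq> G" using F by (auto simp: G_def)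
  obtain l l' where "T = kernel_op A G l" "T' = kernel_op A G l'"
    using kernel_op_extend[OF G(1,3), of A k] kernel_op_extend[OF G(1,4), of A k'] F(5,6) by blast
  then have "T + T' = kernel_op A G (\<lambda>y x. l y x + l' y x)"
    by (auto simp: kernel_op_def fun_eq_iff algebra_simps sum.distrib)
  with G show "T + T' \<in> kernel_ops A" unfolding kernel_ops_def by blast
next
  fix c T assume "T \<in> kernel_ops A"
  then obtain F k where F: "finite F" "F \<subseteq> A" "T = kernel_op A F k" by (auto simp: kernel_ops_def)
  then have "op_scale c T = kernel_op A F (\<lambda>y x. c * k y x)"
    by (auto simp: op_scale_def fun_scale_def kernel_op_def fun_eq_iff algebra_simps sum_distrib_left)
  with F show "op_scale c T \<in> kernel_ops A" unfolding kernel_ops_def by blast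
qed

lemma kernel_ops_schatten: "kernel_ops A \<subseteq> schatten A p"
  unfolding kernel_ops_def using kernel_op_schatten by blast

lemma zero_comp: "(0 :: 'g op) \<circ> x = 0"
  by (simp add: fun_eq_iff)

text \<open>The signs are those of the four terms of \<open>gradient_map\<close>, so its linearity
  in each argument becomes pure rewriting.\<close>

lemma op_scale_collect:
  "(op_scale c p + p') + (op_scale c q + q') - (op_scale c r + r') - (op_scale c s + s') =
    op_scale c (p + q - r - s) + (p' + q' - r' - s')"
  by (simp only: op_cspace.scale_right_distrib op_cspace.scale_right_diff_distrib) (simp only: algebra_simps)

lemma op_comp_linear_left: "(op_scale c S + T) \<circ> R = op_scale c (S \<circ> R) + (T \<circ> R)"
  by (simp add: fun_eq_iff op_scale_def)

text \<open>\<open>R\<close> is linear only on \<open>ell2 A\<close>; boundedness of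
  \<open>S\<close> and \<open>T\<close> ensures that all their values lie there, including those at
  arguments off \<open>ell2 A\<close>.\<close>

lemma op_comp_linear_right:
  assumes R: "R \<in> bounded_ops A" and S: "S \<in> bounded_ops A" and T: "T \<in> bounded_ops A"
  shows "R \<circ> (op_scale c S + T) = op_scale c (R \<circ> S) + (R \<circ> T)"
proof
  fix \<xi>
  have S0: "S \<xi> \<in> ell2 A" and T0: "T \<xi> \<in> ell2 A"
    using bounded_ops_ell2 bounded_ops_outside zero_in_ell2 S T by metis+
  show "(R \<circ> (op_scale c S + T)) \<xi> = (op_scale c (R \<circ> S) + (R \<circ> T)) \<xi>"
    unfolding o_apply plus_fun_apply op_scale_def
      bounded_ops_add[OF R ell2_scale[OF S0] T0] bounded_ops_scale[OF R S0] ..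
qed

context
  fixes G :: "('g, 'm) monoid_scheme" (structure) and \<psi> :: "'g \<Rightarrow> real"
  assumes G: "group G"
begin

interpretation group G by (rule G)

abbreviation gm where "gm \<equiv> gradient_map G (length_semigroup G \<psi>)"
abbreviation \<Delta> where "\<Delta> \<equiv> generator G (length_semigroup G \<psi>)"
abbreviation ga where "ga \<equiv> group_algebra G"

lemma group_algebra_bounded: "x \<in> ga \<Longrightarrow> x \<in> bounded_ops (carrier G)"
  using group_algebra_subset_group_vN[OF G] unfolding group_vN_def by (auto dest: commutantD(1))

lemma group_algebra_linear: "x \<in> ga \<Longrightarrow> y \<in> ga \<Longrightarrow> op_scale c x + y \<in> ga"
  unfolding group_algebra_def by (intro op_cspace.span_add op_cspace.span_scale)

lemma left_reg_in_group_algebra: "g \<in> carrier G \<Longrightarrow> left_reg G g \<in> ga"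
  unfolding group_algebra_def by (intro op_cspace.span_base imageI)

text \<open>Since the linear step may assume \<open>P\<close> for the group element, a property
  stable under linear combinations has to be checked on group elements only.\<close>

lemma group_algebra_induct [consumes 1, case_names zero step]:
  assumes "x \<in> ga" "P 0"
    and "\<And>c g y. g \<in> carrier G \<Longrightarrow> y \<in> ga \<Longrightarrow> P (left_reg G g) \<Longrightarrow> P y \<Longrightarrow> P (op_scale c (left_reg G g) + y)"
    and "\<And>g. g \<in> carrier G \<Longrightarrow> P (left_reg G g)"
  shows "P x"
proof -
  have "x \<in> ga \<and> P x"
    using assms(1) unfolding group_algebra_def
  proof (induction rule: op_cspace.span_induct_alt)
    case base
    show ?case using assms(2) by (simp only: op_cspace.span_zero simp_thms)
  next
    case (step c x y)
    then obtain g where g: "g \<in> carrier G" "x = left_reg G g" by blast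
    have y: "y \<in> ga" "P y" using step(2) unfolding group_algebra_def by blast+
    show ?case
      unfolding g(2) group_algebra_def[symmetric]
      using assms(3)[OF g(1) y(1) assms(4)[OF g(1)] y(2)]
        group_algebra_linear[OF left_reg_in_group_algebra[OF g(1)] y(1)] by blast
  qed
  then show ?thesis by blast
qed

lemma left_reg_comp:
  assumes "g \<in> carrier G" "h \<in> carrier G"
  shows "left_reg G g \<circ> left_reg G h = left_reg G (g \<otimes> h)"
proof
  fix \<xi>
  show "(left_reg G g \<circ> left_reg G h) \<xi> = left_reg G (g \<otimes> h) \<xi>"
  proof (cases "\<xi> \<in> ell2 (carrier G)")
    case True
    then have "left_reg G h \<xi> \<in> ell2 (carrier G)"
      by (rule bounded_ops_ell2[OF left_reg_bounded[OF G assms(2)]])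
    with True assms show ?thesis
      by (auto simp: left_reg_def[of G g] left_reg_def[of G "g \<otimes> h"] fun_eq_iff)
        (simp add: left_reg_def inv_mult_group m_assoc)
  next
    case False
    have "left_reg G h \<xi> = 0" "left_reg G (g \<otimes> h) \<xi> = 0"
      using False by (simp_all add: left_reg_def)
    then show ?thesis
      using bounded_ops_0[OF left_reg_bounded[OF G assms(1)]] by (simp only: o_apply)
  qed
qed

lemma comp_zero: "x \<in> ga \<Longrightarrow> x \<circ> (0 :: 'g op) = 0"
  using bounded_ops_0[OF group_algebra_bounded] by (simp add: fun_eq_iff)

lemma zero_in_group_algebra: "0 \<in> ga"
  unfolding group_algebra_def by (rule op_cspace.span_zero)

lemma group_algebra_comp: "x \<in> ga \<Longrightarrow> y \<in> ga \<Longrightarrow> x \<circ> y \<in> ga"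
proof (induction rule: group_algebra_induct)
  case zero
  show ?case by (simp only: zero_comp zero_in_group_algebra)
next
  case (step c g z)
  then show ?case unfolding op_comp_linear_left by (intro group_algebra_linear) blast+
next
  fix g assume g: "g \<in> carrier G" and "y \<in> ga"
  from this(2) show "left_reg G g \<circ> y \<in> ga"
  proof (induction rule: group_algebra_induct)
    case zero
    show ?case by (simp only: comp_zero[OF left_reg_in_group_algebra[OF g]] zero_in_group_algebra)
  next
    case (step c h z)
    have *: "left_reg G g \<circ> (op_scale c (left_reg G h) + z) =
        op_scale c (left_reg G g \<circ> left_reg G h) + (left_reg G g \<circ> z)"
      using step(1,2) g by (intro op_comp_linear_right[where A = "carrier G"] left_reg_bounded[OF G] group_algebra_bounded)
    show ?case unfolding * using step by (intro group_algebra_linear)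
  next
    fix h assume "h \<in> carrier G"
    then show "left_reg G g \<circ> left_reg G h \<in> ga"
      using g by (simp add: left_reg_comp left_reg_in_group_algebra)
  qed
qed

lemma generator_in_group_algebra: "x \<in> ga \<Longrightarrow> \<Delta> x \<in> ga"
  by (rule generator_coeff(1)[OF G])

lemma generator_zero: "\<Delta> 0 = 0"
  using generator_linear[OF G zero_in_group_algebra zero_in_group_algebra, of \<psi> "-1"]
  by (simp only: op_cspace.scale_zero_right add_0 op_cspace.scale_minus_left op_cspace.scale_one) simp

lemma
  assumes a: "a \<in> ga" and b: "b \<in> ga" and x: "x \<in> ga" and y: "y \<in> ga"
  shows gradient_map_linear_left: "gm (op_scale c x + y) a b = op_scale c (gm x a b) + gm y a b"
    and gradient_map_linear_right: "gm a (op_scale c x + y) b = op_scale c (gm a x b) + gm a y b"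
    and gradient_map_linear: "gm a b (op_scale c x + y) = op_scale c (gm a b x) + gm a b y"
proof -
  note right = op_comp_linear_right[where A = "carrier G", OF group_algebra_bounded group_algebra_bounded group_algebra_bounded]
  note simps = op_comp_linear_left right generator_linear[OF G] group_algebra_comp generator_in_group_algebra
    op_scale_collect gradient_map_def Let_def a b x y group_algebra_linear
  show "gm (op_scale c x + y) a b = op_scale c (gm x a b) + gm y a b" by (simp only: simps)
  show "gm a (op_scale c x + y) b = op_scale c (gm a x b) + gm a y b" by (simp only: simps)
  show "gm a b (op_scale c x + y) = op_scale c (gm a b x) + gm a b y" by (simp only: simps)
qed

lemma gradient_map_zero:
  assumes "a \<in> ga" "b \<in> ga"
  shows "gm 0 a b = 0" "gm a 0 b = 0" "gm a b 0 = 0"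
  by (simp_all only: gradient_map_def Let_def zero_comp comp_zero generator_zero assms group_algebra_comp
      generator_in_group_algebra add_0 diff_0_right diff_self)

section \<open>Coefficients of the gradient form and the finiteness of their support\<close>

definition gradient_coeff :: "'g \<Rightarrow> 'g \<Rightarrow> 'g \<Rightarrow> real" where
  "gradient_coeff g h w = \<psi> (g \<otimes> w \<otimes> h) + \<psi> w - \<psi> (g \<otimes> w) - \<psi> (w \<otimes> h)"

lemma gradient_map_left_reg:
  assumes "g \<in> carrier G" "h \<in> carrier G" "w \<in> carrier G"
  shows "gm (left_reg G g) (left_reg G h) (left_reg G w) =
    op_scale (of_real (gradient_coeff g h w)) (left_reg G (g \<otimes> w \<otimes> h))"
proof -
  have "gm (left_reg G g) (left_reg G h) (left_reg G w) =
    op_scale (of_real (\<psi> (g \<otimes> w \<otimes> h))) (left_reg G (g \<otimes> w \<otimes> h)) +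
    op_scale (of_real (\<psi> w)) (left_reg G (g \<otimes> w \<otimes> h)) -
    op_scale (of_real (\<psi> (g \<otimes> w))) (left_reg G (g \<otimes> w \<otimes> h)) -
    op_scale (of_real (\<psi> (w \<otimes> h))) (left_reg G (g \<otimes> w \<otimes> h))"
  proof -
    have lin: "R \<circ> op_scale c S = op_scale c (R \<circ> S)" if "R \<in> ga" "S \<in> ga" for R S c
      using op_comp_linear_right[OF group_algebra_bounded[OF that(1)] group_algebra_bounded[OF that(2)]
          group_algebra_bounded[OF zero_in_group_algebra], of c]
      by (simp only: add_0_right comp_zero that)
    have lin': "op_scale c S \<circ> R = op_scale c (S \<circ> R)" for R S c
      by (simp add: fun_eq_iff op_scale_def)
    show ?thesis
      using assms
      by (simp only: gradient_map_def Let_def left_reg_comp generator_left_reg[OF G] m_closed lin lin'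
          left_reg_in_group_algebra m_assoc)
  qed
  then show ?thesis
    by (simp only: gradient_coeff_def of_real_add of_real_diff op_cspace.scale_left_distrib
        op_cspace.scale_left_diff_distrib)
qed

lemma finite_translate:
  assumes g: "g \<in> carrier G" and fin: "finite {w \<in> carrier G. P w}"
  shows "finite {w \<in> carrier G. P (g \<otimes> w)}" "finite {w \<in> carrier G. P (w \<otimes> g)}"
proof -
  have "{w \<in> carrier G. P (g \<otimes> w)} \<subseteq> (\<lambda>w. m_inv G g \<otimes> w) ` {w \<in> carrier G. P w}"
  proof
    fix w assume w: "w \<in> {w \<in> carrier G. P (g \<otimes> w)}"
    then have "w = m_inv G g \<otimes> (g \<otimes> w)" using g by (simp add: m_assoc[symmetric])
    then show "w \<in> (\<lambda>w. m_inv G g \<otimes> w) ` {w \<in> carrier G. P w}" using w g by blast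
  qed
  then show "finite {w \<in> carrier G. P (g \<otimes> w)}" using fin finite_subset by blast
  have "{w \<in> carrier G. P (w \<otimes> g)} \<subseteq> (\<lambda>w. w \<otimes> m_inv G g) ` {w \<in> carrier G. P w}"
  proof
    fix w assume w: "w \<in> {w \<in> carrier G. P (w \<otimes> g)}"
    then have "w = w \<otimes> g \<otimes> m_inv G g" using g by (simp add: m_assoc)
    then show "w \<in> (\<lambda>w. w \<otimes> m_inv G g) ` {w \<in> carrier G. P w}" using w g by blast
  qed
  then show "finite {w \<in> carrier G. P (w \<otimes> g)}" using fin finite_subset by blast
qed

lemma finite_gradient_coeff_mult_left:
  assumes "g \<in> carrier G" "g' \<in> carrier G" "h \<in> carrier G"
    and "finite {w \<in> carrier G. gradient_coeff g h w \<noteq> 0}" "finite {w \<in> carrier G. gradient_coeff g' h w \<noteq> 0}"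
  shows "finite {w \<in> carrier G. gradient_coeff (g \<otimes> g') h w \<noteq> 0}"
proof -
  \<comment> \<open>The values of \<psi> at g'w and g'wh enter the two summands with opposite signs
    and cancel.\<close>
  have "gradient_coeff (g \<otimes> g') h w = gradient_coeff g h (g' \<otimes> w) + gradient_coeff g' h w"
    if "w \<in> carrier G" for w
    using assms(1-3) that by (simp add: gradient_coeff_def m_assoc)
  then have "{w \<in> carrier G. gradient_coeff (g \<otimes> g') h w \<noteq> 0} \<subseteq>
      {w \<in> carrier G. gradient_coeff g h (g' \<otimes> w) \<noteq> 0} \<union> {w \<in> carrier G. gradient_coeff g' h w \<noteq> 0}"
    by auto
  then show ?thesis
    using finite_translate(1)[OF assms(2,4)] assms(5) finite_subset by blast
qed

lemma finite_gradient_coeff_mult_right: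
  assumes "g \<in> carrier G" "h \<in> carrier G" "h' \<in> carrier G"
    and "finite {w \<in> carrier G. gradient_coeff g h w \<noteq> 0}" "finite {w \<in> carrier G. gradient_coeff g h' w \<noteq> 0}"
  shows "finite {w \<in> carrier G. gradient_coeff g (h \<otimes> h') w \<noteq> 0}"
proof -
  have "gradient_coeff g (h \<otimes> h') w = gradient_coeff g h' (w \<otimes> h) + gradient_coeff g h w"
    if "w \<in> carrier G" for w
    using assms(1-3) that by (simp add: gradient_coeff_def m_assoc)
  then have "{w \<in> carrier G. gradient_coeff g (h \<otimes> h') w \<noteq> 0} \<subseteq>
      {w \<in> carrier G. gradient_coeff g h' (w \<otimes> h) \<noteq> 0} \<union> {w \<in> carrier G. gradient_coeff g h w \<noteq> 0}"
    by auto
  then show ?thesis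
    using finite_translate(2)[OF assms(2,5)] assms(4) finite_subset by blast
qed

lemma gradient_schatten_if_finite_coeff:
  assumes fin: "\<And>g h. g \<in> carrier G \<Longrightarrow> h \<in> carrier G \<Longrightarrow>
    finite {w \<in> carrier G. gradient_coeff g h w \<noteq> 0}"
  shows "gradient_schatten G (length_semigroup G \<psi>) p"
proof -
  let ?K = "kernel_ops (carrier G)"
  \<comment> \<open>Asking for a finite kernel makes the claim stable under linear combinations in
    \<open>a\<close> and \<open>b\<close>, because \<open>kernel_ops\<close> is a subspace. Closure
    of the Schatten classes under addition never has to be proved.\<close>
  define P where "P a b T \<longleftrightarrow> T \<in> ?K \<and> (\<forall>x\<in>ga. T (x (delta \<one>)) = gm a b x (delta \<one>))" for a b T
  have P_zero: "P a b 0" if "\<And>x. x \<in> ga \<Longrightarrow> gm a b x = 0" for a b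
    unfolding P_def using that op_cspace.subspace_0[OF kernel_ops_subspace] by simp
  have lin: "P a b (op_scale c T + T')" if "P a1 b1 T" "P a2 b2 T'"
    "\<And>x. x \<in> ga \<Longrightarrow> gm a b x = op_scale c (gm a1 b1 x) + gm a2 b2 x" for a b a1 b1 a2 b2 T T' c
    unfolding P_def
  proof (intro conjI ballI)
    show "op_scale c T + T' \<in> ?K"
      using that(1,2) unfolding P_def
      by (intro op_cspace.subspace_add[OF kernel_ops_subspace] op_cspace.subspace_scale[OF kernel_ops_subspace]) blast+
    show "(op_scale c T + T') (x (delta \<one>)) = gm a b x (delta \<one>)" if "x \<in> ga" for x
      using that \<open>P a1 b1 T\<close> \<open>P a2 b2 T'\<close> unfolding P_def \<open>\<And>x. x \<in> ga \<Longrightarrow> gm a b x = _\<close>[OF that]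
      by (simp add: op_scale_def)
  qed
  have left: "\<exists>T. P (left_reg G g) (left_reg G h) T" if g: "g \<in> carrier G" and h: "h \<in> carrier G" for g h
  proof -
    define E where "E = {w \<in> carrier G. gradient_coeff g h w \<noteq> 0}"
    \<comment> \<open>\<open>kernel_op\<close> has one index set for rows and columns, so
      \<open>F\<close> holds both the sources w and the targets gwh.\<close>
    define F where "F = E \<union> (\<lambda>w. g \<otimes> w \<otimes> h) ` E"
    define k where "k y x = (if y = g \<otimes> x \<otimes> h then complex_of_real (gradient_coeff g h x) else 0)" for y x
    have F: "finite F" "F \<subseteq> carrier G"
      using fin[OF g h] g h by (auto simp: F_def E_def)
    define T where "T = kernel_op (carrier G) F k"
    have T: "T \<in> bounded_ops (carrier G)" unfolding T_def by (rule kernel_op_bounded[OF F])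
    have Td: "T (delta w) = fun_scale (of_real (gradient_coeff g h w)) (delta (g \<otimes> w \<otimes> h))"
      if w: "w \<in> carrier G" for w
    proof
      fix y
      have "T (delta w) y = (if y \<in> F \<and> w \<in> F then k y w else 0)"
        unfolding T_def kernel_op_def if_P[OF delta_in_ell2[OF w]]
        using F by (simp add: delta_def if_distrib cong: if_cong)
      also have "\<dots> = (if y = g \<otimes> w \<otimes> h then of_real (gradient_coeff g h w) else 0)"
        using w by (auto simp: k_def F_def E_def)
      finally show "T (delta w) y = fun_scale (of_real (gradient_coeff g h w)) (delta (g \<otimes> w \<otimes> h)) y"
        by (simp add: fun_scale_def delta_def)
    qed
    have "T (x (delta \<one>)) = gm (left_reg G g) (left_reg G h) x (delta \<one>)" if "x \<in> ga" for x
      using that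
    proof (induction rule: group_algebra_induct)
      case zero
      have "(0 :: 'g op) (delta \<one>) = 0" by simp
      then show ?case
        unfolding gradient_map_zero(3)[OF left_reg_in_group_algebra[OF g] left_reg_in_group_algebra[OF h]]
        using bounded_ops_0[OF T] by metis
    next
      case (step c w y)
      have e: "z (delta \<one>) \<in> ell2 (carrier G)" if "z \<in> ga" for z
        using bounded_ops_ell2[OF group_algebra_bounded[OF that]] by (simp add: delta_in_ell2)
      have "T ((op_scale c (left_reg G w) + y) (delta \<one>)) =
          fun_scale c (T (left_reg G w (delta \<one>))) + T (y (delta \<one>))"
        unfolding plus_fun_apply op_scale_def
          bounded_ops_add[OF T ell2_scale[OF e[OF left_reg_in_group_algebra[OF step(1)]]] e[OF step(2)]]
          bounded_ops_scale[OF T e[OF left_reg_in_group_algebra[OF step(1)]]] ..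
      also have "\<dots> = (op_scale c (gm (left_reg G g) (left_reg G h) (left_reg G w)) +
          gm (left_reg G g) (left_reg G h) y) (delta \<one>)"
        unfolding step.IH plus_fun_apply op_scale_def ..
      finally show ?case
        unfolding gradient_map_linear[OF left_reg_in_group_algebra[OF g] left_reg_in_group_algebra[OF h]
            left_reg_in_group_algebra[OF step(1)] step(2)] .
    next
      fix w assume w: "w \<in> carrier G"
      then show "T (left_reg G w (delta \<one>)) = gm (left_reg G g) (left_reg G h) (left_reg G w) (delta \<one>)"
        using g h by (simp add: gradient_map_left_reg left_reg_delta[OF G] Td op_scale_def)
    qed
    moreover have "T \<in> ?K" unfolding kernel_ops_def T_def using F by blast
    ultimately show ?thesis unfolding P_def by blast
  qed
  have left': "\<exists>T. P (left_reg G g) b T" if g: "g \<in> carrier G" and b: "b \<in> ga" for g b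
    using b
  proof (induction rule: group_algebra_induct)
    case zero
    show ?case
      by (rule exI, rule P_zero, rule gradient_map_zero(2)[OF left_reg_in_group_algebra[OF g]])
  next
    case (step c h b)
    then obtain T T' where T: "P (left_reg G g) (left_reg G h) T" "P (left_reg G g) b T'" by blast
    show ?case
      by (rule exI, rule lin[OF T],
          rule gradient_map_linear_right[OF left_reg_in_group_algebra[OF g] _ left_reg_in_group_algebra[OF step(1)] step(2)])
  qed (use left g in blast)
  have "\<exists>T. P a b T" if a: "a \<in> ga" and b: "b \<in> ga" for a b
    using a
  proof (induction rule: group_algebra_induct)
    case zero
    show ?case by (rule exI, rule P_zero, rule gradient_map_zero(1)[OF b])
  next
    case (step c g a)
    then obtain T T' where T: "P (left_reg G g) b T" "P a b T'" by blast
    show ?case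
      by (rule exI, rule lin[OF T],
          rule gradient_map_linear_left[OF b _ left_reg_in_group_algebra[OF step(1)] step(2)])
  qed (use left' b in blast)
  then show ?thesis
    unfolding gradient_schatten_def P_def using kernel_ops_schatten by blast
qed

end

section \<open>Words in a Coxeter group\<close>

primrec letter_gen :: "'s letter \<Rightarrow> 's" where
  "letter_gen (Gen s) = s"
| "letter_gen (Inv s) = s"

lemma fold_concat_replicate:
  "fold f (concat (replicate m xs)) = (fold f xs) ^^ m"
  by (induction m) (simp_all add: funpow_swap1 fun_eq_iff)

locale coxeter_system =
  fixes S :: "'s set" and M :: "'s \<Rightarrow> 's \<Rightarrow> enat"
  assumes coxeter: "coxeter_matrix S M"
begin

abbreviation W where "W \<equiv> coxeter_group S M"

sublocale group W by (rule group_coxeter_group)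

abbreviation mul (infixl "\<cdot>" 70) where "x \<cdot> y \<equiv> x \<otimes>\<^bsub>W\<^esub> y"
abbreviation ident ("\<e>") where "\<e> \<equiv> \<one>\<^bsub>W\<^esub>"
abbreviation ginv where "ginv x \<equiv> m_inv W x"
abbreviation len where "len x \<equiv> coxeter_length S M x"

definition wd :: "'s list \<Rightarrow> 's letter list set" where
  "wd ws = pres_class S (coxeter_relators S M) (map Gen ws)"

abbreviation gen where "gen s \<equiv> wd [s]"

lemma map_Gen_lists: "set ws \<subseteq> S \<Longrightarrow> map Gen ws \<in> lists (letters S)"
  by (induction ws) (auto simp: letters_def)

lemma wd_closed [simp]: "set ws \<subseteq> S \<Longrightarrow> wd ws \<in> carrier W"
  unfolding wd_def coxeter_group_def by (auto simp: presented_group_def map_Gen_lists)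

lemma wd_Nil [simp]: "wd [] = \<e>"
  by (simp add: wd_def coxeter_group_def presented_group_def)

lemma wd_append: "set u \<subseteq> S \<Longrightarrow> set v \<subseteq> S \<Longrightarrow> wd (u @ v) = wd u \<cdot> wd v"
  unfolding wd_def coxeter_group_def
  by (subst presented_group_mult) (simp_all add: map_Gen_lists)

lemma wd_Cons: "s \<in> S \<Longrightarrow> set v \<subseteq> S \<Longrightarrow> wd (s # v) = gen s \<cdot> wd v"
  using wd_append[of "[s]" v] by simp

lemma coxeter_relator_trivial:
  assumes "s \<in> S" "t \<in> S" "M s t = enat m"
  shows "wd (concat (replicate m [s, t])) = \<e>"
proof -
  have *: "map Gen (concat (replicate m [s, t])) = concat (replicate m [Gen s, Gen t])"
    by (simp add: map_concat map_replicate)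
  have "set (concat (replicate m [s, t])) \<subseteq> S"
    using assms by auto
  then have l: "concat (replicate m [Gen s, Gen t]) \<in> lists (letters S)"
    unfolding *[symmetric] by (rule map_Gen_lists)
  then have "pres_cong S (coxeter_relators S M) ([] @ concat (replicate m [Gen s, Gen t]) @ []) ([] @ [])"
    using assms by (intro pres_cong.relator) (auto simp: coxeter_relators_def)
  then show ?thesis
    using l unfolding wd_Nil[symmetric] wd_def * by (subst pres_class_eq_iff) auto
qed

lemma gen_sq [simp]: "s \<in> S \<Longrightarrow> gen s \<cdot> gen s = \<e>"
  using coxeter_relator_trivial[of s s 1] coxeter wd_Cons[of s "[s]"]
  by (simp add: coxeter_matrix_def one_enat_def)

lemma gen_sq_left [simp]: "s \<in> S \<Longrightarrow> x \<in> carrier W \<Longrightarrow> gen s \<cdot> (gen s \<cdot> x) = x"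
  by (simp add: m_assoc[symmetric])

lemma inv_gen [simp]: "s \<in> S \<Longrightarrow> ginv (gen s) = gen s"
  by (rule inv_equality) auto

lemma inv_wd: "set ws \<subseteq> S \<Longrightarrow> ginv (wd ws) = wd (rev ws)"
proof (induction ws)
  case (Cons s ws)
  then show ?case
    by (subst wd_Cons) (auto simp: inv_mult_group wd_append)
qed simp

lemma wd_surj:
  assumes "x \<in> carrier W"
  shows "\<exists>ws. set ws \<subseteq> S \<and> x = wd ws"
proof -
  let ?c = "pres_class S (coxeter_relators S M)"
  have Inv: "?c [Inv s] = gen s" if s: "s \<in> S" for s
  proof -
    have l: "[Inv s] \<in> lists (letters S)" "[Gen s] \<in> lists (letters S)" using s by (auto simp: letters_def)
    have "pres_cong S (coxeter_relators S M) ([] @ [Inv s, Gen s] @ []) ([] @ [])"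
      by (rule pres_cong.cancel[OF _ _ s]) auto
    then have "?c [Inv s] \<cdot> gen s = \<e>"
      unfolding coxeter_group_def wd_def list.map presented_group_mult[OF l]
      using l by (simp add: presented_group_def pres_class_eq_iff)
    moreover have "?c [Inv s] \<in> carrier W"
      using l by (auto simp: coxeter_group_def presented_group_def)
    ultimately show ?thesis
      using s inv_equality[of "?c [Inv s]" "gen s"] by simp
  qed
  from assms obtain w where w: "w \<in> lists (letters S)" "x = ?c w"
    by (auto simp: coxeter_group_def presented_group_def)
  have "?c w = wd (map letter_gen w) \<and> set (map letter_gen w) \<subseteq> S"
    using w(1)
  proof (induction w)
    case (Cons a w)
    then obtain s where s: "s \<in> S" "a = Gen s \<or> a = Inv s" by (auto simp: letters_def)
    have "[a] \<in> lists (letters S)" using Cons by simp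
    then have "?c (a # w) = ?c [a] \<cdot> ?c w"
      using presented_group_mult[of "[a]" S w "coxeter_relators S M"] Cons by (simp add: coxeter_group_def)
    also have "?c [a] = gen s" using s Inv by (auto simp: wd_def)
    finally show ?case
      using Cons s wd_Cons[of s "map letter_gen w"] by auto
  qed (simp add: wd_def)
  with w(2) show ?thesis by blast
qed

text \<open>The universal property of the presentation, for actions by involutions.\<close>
lemma fold_eq_if_wd_eq:
  assumes act: "\<And>s x. s \<in> S \<Longrightarrow> x \<in> X \<Longrightarrow> act s x \<in> X \<and> act s (act s x) = x"
    and rel: "\<And>s t m x. s \<in> S \<Longrightarrow> t \<in> S \<Longrightarrow> M s t = enat m \<Longrightarrow> x \<in> X \<Longrightarrow> ((act t \<circ> act s) ^^ m) x = x"
    and uv: "wd u = wd v" "set u \<subseteq> S" "set v \<subseteq> S" and x: "x \<in> X"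
  shows "fold act u x = fold act v x"
proof -
  let ?f = "fold (\<lambda>a. act (letter_gen a))"
  have X: "?f w x \<in> X" if "w \<in> lists (letters S)" "x \<in> X" for w x
    using that
  proof (induction w arbitrary: x)
    case (Cons a w)
    then have "letter_gen a \<in> S" by (auto simp: letters_def)
    with Cons act show ?case by simp
  qed simp
  \<comment> \<open>A cancelled pair acts trivially because each generator acts as an involution on
    \<open>X\<close>. A relator does so by \<open>rel\<close>; as \<open>fold\<close> applies the
    first letter first, the relator of s and t becomes a power of
    \<open>act t \<circ> act s\<close>.\<close>
  have "?f a x = ?f b x" if "pres_cong S (coxeter_relators S M) a b" "x \<in> X" for a b x
    using that
  proof (induction arbitrary: x rule: pres_cong.induct)
    case (cancel u v s r)
    then have "?f u x \<in> X" using X by blast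
    with cancel have "?f r (?f u x) = ?f u x" using act by auto
    then show ?case by simp
  next
    case (relator u v r)
    then obtain s t m where r: "s \<in> S" "t \<in> S" "M s t = enat m" "r = concat (replicate m [Gen s, Gen t])"
      by (auto simp: coxeter_relators_def)
    have "?f r = (act t \<circ> act s) ^^ m"
      unfolding r(4) fold_concat_replicate by simp
    then have "?f r (?f u x) = ?f u x" using rel[OF r(1-3)] X relator by simp
    then show ?case by simp
  qed auto
  moreover have "pres_cong S (coxeter_relators S M) (map Gen u) (map Gen v)"
    using uv by (simp add: wd_def pres_class_eq_iff map_Gen_lists)
  ultimately have "?f (map Gen u) x = ?f (map Gen v) x" using x by blast
  moreover have "?f (map Gen w) = fold act w" for w
    by (simp add: fold_map o_def)
  ultimately show ?thesis by simp
qed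

section \<open>Word length\<close>

lemma len_eq_Least: "len x = (LEAST n. \<exists>ws. set ws \<subseteq> S \<and> length ws = n \<and> wd ws = x)"
proof -
  have foldr_gen: "foldr (\<otimes>\<^bsub>W\<^esub>) (map gen ws) \<e> = wd ws" if "set ws \<subseteq> S" for ws
    using that
  proof (induction ws)
    case (Cons s ws)
    then show ?case by (simp add: wd_Cons[of s ws])
  qed simp
  have gens: "coxeter_gens S M = gen ` S" by (simp add: coxeter_gens_def wd_def)
  have *: "xs \<in> lists (coxeter_gens S M) \<longleftrightarrow> (\<exists>ws. set ws \<subseteq> S \<and> xs = map gen ws)" for xs
    unfolding gens lists_image unfolding lists_eq_set by blast
  then have "(\<exists>xs\<in>lists (coxeter_gens S M). length xs = n \<and> foldr (\<otimes>\<^bsub>W\<^esub>) xs \<e> = x) \<longleftrightarrow>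
      (\<exists>ws. set ws \<subseteq> S \<and> length ws = n \<and> wd ws = x)" for n
    unfolding Bex_def * using foldr_gen by (smt (verit, best) length_map)
  then show ?thesis by (simp add: coxeter_length_def word_length_def)
qed

lemma len_wd_le: "set ws \<subseteq> S \<Longrightarrow> len (wd ws) \<le> length ws"
  unfolding len_eq_Least by (rule Least_le) blast

lemma reduced_word:
  assumes "x \<in> carrier W"
  obtains ws where "set ws \<subseteq> S" "wd ws = x" "length ws = len x"
proof -
  have "\<exists>n. \<exists>ws. set ws \<subseteq> S \<and> length ws = n \<and> wd ws = x" using wd_surj[OF assms] by blast
  from LeastI_ex[OF this] show ?thesis
    using that unfolding len_eq_Least by blast
qed

lemma len_inv [simp]: "x \<in> carrier W \<Longrightarrow> len (ginv x) = len x"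
proof -
  have le: "len (ginv x) \<le> len x" if x: "x \<in> carrier W" for x
  proof -
    obtain ws where ws: "set ws \<subseteq> S" "wd ws = x" "length ws = len x" by (rule reduced_word[OF x])
    have "set (rev ws) \<subseteq> S" using ws(1) by simp
    then show ?thesis using len_wd_le[of "rev ws"] ws inv_wd[OF ws(1)] by simp
  qed
  assume x: "x \<in> carrier W"
  from le[OF x] le[of "ginv x"] x show ?thesis by simp
qed

lemma len_gen_mult_le:
  assumes "s \<in> S" "x \<in> carrier W"
  shows "len (gen s \<cdot> x) \<le> Suc (len x)"
proof -
  obtain ws where "set ws \<subseteq> S" "wd ws = x" "length ws = len x" by (rule reduced_word[OF assms(2)])
  then show ?thesis using len_wd_le[of "s # ws"] wd_Cons[of s ws] assms(1) by simp
qed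

end

section \<open>The exchange condition\<close>

lemma sum_lessThan_add: "(\<Sum>i<m + n. f i) = (\<Sum>i<m. f i) + (\<Sum>i<n. f (m + i))" for f :: "nat \<Rightarrow> nat"
  by (induction n) auto

context coxeter_system
begin

text \<open>For a word \<open>s1 ... sn\<close>, the parity of the number of indices i with
  \<open>t = s1 ... si ... s1\<close>, that is, of the occurrences of \<open>t\<close> among the
  reflections attached to the letters.\<close>

primrec refl_parity :: "'s list \<Rightarrow> 's letter list set \<Rightarrow> bool" where
  "refl_parity [] t = False"
| "refl_parity (s # ws) t = ((t = gen s) \<noteq> refl_parity ws (gen s \<cdot> t \<cdot> gen s))"

text \<open>The classical action on reflections with a sign, here on all of the group with a Boolean
  as sign. The sign component of a word's action is its \<open>refl_parity\<close>, so
  well-definedness on the group makes this parity an invariant of the element.\<close>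

definition refl_act :: "'s \<Rightarrow> 's letter list set \<times> bool \<Rightarrow> 's letter list set \<times> bool" where
  "refl_act s x = (gen s \<cdot> fst x \<cdot> gen s, snd x \<noteq> (fst x = gen s))"

lemma gen_mult_cancel: "s \<in> S \<Longrightarrow> x \<in> carrier W \<Longrightarrow> y \<in> carrier W \<Longrightarrow> gen s \<cdot> x = gen s \<cdot> y \<longleftrightarrow> x = y"
  by (metis gen_sq_left)

lemma gen_conj_eq_iff:
  "s \<in> S \<Longrightarrow> x \<in> carrier W \<Longrightarrow> y \<in> carrier W \<Longrightarrow> gen s \<cdot> x \<cdot> gen s = y \<longleftrightarrow> x = gen s \<cdot> y \<cdot> gen s"
  by (auto simp: m_assoc)

lemma snd_fold_refl_act: "snd (fold refl_act ws x) = (snd x \<noteq> refl_parity ws (fst x))"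
  by (induction ws arbitrary: x) (auto simp: refl_act_def)

text \<open>The element \<open>(ab)^i a\<close>, the reflection attached to letter number i, counted
  from 0, of the alternating word \<open>abab...\<close>.\<close>

primrec dihedral_refl :: "'s \<Rightarrow> 's \<Rightarrow> nat \<Rightarrow> 's letter list set" where
  "dihedral_refl a b 0 = gen a"
| "dihedral_refl a b (Suc i) = gen a \<cdot> gen b \<cdot> dihedral_refl a b i"

lemma dihedral_refl:
  assumes ab: "a \<in> S" "b \<in> S"
  shows "dihedral_refl a b i \<in> carrier W"
    and "dihedral_refl a b (Suc i) = dihedral_refl a b i \<cdot> gen b \<cdot> gen a"
    and "dihedral_refl a b (n + i) = (gen a \<cdot> gen b) [^]\<^bsub>W\<^esub> n \<cdot> dihedral_refl a b i"
proof -
  show *: "dihedral_refl a b i \<in> carrier W" for i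
    by (induction i) (use ab in auto)
  show "dihedral_refl a b (Suc i) = dihedral_refl a b i \<cdot> gen b \<cdot> gen a"
  proof (induction i)
    case (Suc i)
    have "dihedral_refl a b (Suc (Suc i)) = gen a \<cdot> gen b \<cdot> (dihedral_refl a b i \<cdot> gen b \<cdot> gen a)"
      by (simp only: dihedral_refl.simps(2)[of a b "Suc i"] Suc.IH)
    also have "\<dots> = dihedral_refl a b (Suc i) \<cdot> gen b \<cdot> gen a"
      using ab * by (simp add: m_assoc)
    finally show ?case .
  qed (use ab in \<open>simp add: m_assoc\<close>)
  show "dihedral_refl a b (n + i) = (gen a \<cdot> gen b) [^]\<^bsub>W\<^esub> n \<cdot> dihedral_refl a b i"
  proof (induction n)
    case (Suc n)
    then show ?case
      using ab * nat_pow_Suc2[of "gen a \<cdot> gen b" n] by (simp add: m_assoc del: nat_pow_Suc)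
  qed (use * in simp)
qed

text \<open>Each of the n rounds applies two letters, so the sign is flipped once for every
  occurrence of \<open>fst x\<close> among the first 2n reflections of
  \<open>abab...\<close>.\<close>

lemma refl_act_funpow:
  assumes ab: "a \<in> S" "b \<in> S" and "fst x \<in> carrier W"
  shows "((refl_act b \<circ> refl_act a) ^^ n) x =
    (ginv ((gen a \<cdot> gen b) [^]\<^bsub>W\<^esub> n) \<cdot> fst x \<cdot> (gen a \<cdot> gen b) [^]\<^bsub>W\<^esub> n,
     snd x \<noteq> odd (\<Sum>i<2 * n. of_bool (fst x = dihedral_refl a b i) :: nat))"
  using assms(3)
proof (induction n arbitrary: x)
  case 0
  then show ?case by (simp add: prod_eq_iff)
next
  case (Suc n)
  define t where "t = fst x"
  define t' where "t' = gen b \<cdot> (gen a \<cdot> t \<cdot> gen a) \<cdot> gen b"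
  have t: "t \<in> carrier W" "t' \<in> carrier W" using Suc.prems ab by (auto simp: t_def t'_def)
  let ?z = "gen a \<cdot> gen b" and ?q = "dihedral_refl a b"
  have z: "?z \<in> carrier W" using ab by simp
  have "((refl_act b \<circ> refl_act a) ^^ Suc n) x = ((refl_act b \<circ> refl_act a) ^^ n) (refl_act b (refl_act a x))"
    by (simp add: funpow_swap1)
  also have "refl_act b (refl_act a x) = (t', (snd x \<noteq> (t = gen a)) \<noteq> (gen a \<cdot> t \<cdot> gen a = gen b))"
    by (simp add: refl_act_def t_def t'_def)
  also have "((refl_act b \<circ> refl_act a) ^^ n) \<dots> = (ginv (?z [^]\<^bsub>W\<^esub> n) \<cdot> t' \<cdot> ?z [^]\<^bsub>W\<^esub> n,
     ((snd x \<noteq> (t = gen a)) \<noteq> (gen a \<cdot> t \<cdot> gen a = gen b)) \<noteq>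
     odd (\<Sum>i<2 * n. of_bool (t' = ?q i) :: nat))"
    by (subst Suc.IH) (use t in simp_all)
  \<comment> \<open>Undoing the conjugation by the first round moves the list of reflections on by
    two places.\<close>
  also have "(\<lambda>i. t' = ?q i) = (\<lambda>i. t = ?q (Suc (Suc i)))"
  proof
    fix i
    have q: "?q i \<in> carrier W" by (rule dihedral_refl(1)[OF ab])
    have "t' = ?q i \<longleftrightarrow> t = gen a \<cdot> (gen b \<cdot> ?q i \<cdot> gen b) \<cdot> gen a"
      unfolding t'_def using ab t q by (simp add: gen_conj_eq_iff)
    also have "gen a \<cdot> (gen b \<cdot> ?q i \<cdot> gen b) \<cdot> gen a = ?q (Suc (Suc i))"
      unfolding dihedral_refl(2)[OF ab, of "Suc i"] using ab q by (simp add: m_assoc)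
    finally show "t' = ?q i \<longleftrightarrow> t = ?q (Suc (Suc i))" .
  qed
  also have "gen a \<cdot> t \<cdot> gen a = gen b \<longleftrightarrow> t = ?q 1"
    using ab t by (simp add: gen_conj_eq_iff)
  also have "ginv (?z [^]\<^bsub>W\<^esub> n) \<cdot> t' \<cdot> ?z [^]\<^bsub>W\<^esub> n = ginv (?z [^]\<^bsub>W\<^esub> Suc n) \<cdot> t \<cdot> ?z [^]\<^bsub>W\<^esub> Suc n"
    using ab t z unfolding t'_def nat_pow_Suc2[OF z] by (simp add: inv_mult_group m_assoc)
  also have "(\<Sum>i<2 * Suc n. of_bool (t = ?q i) :: nat) =
      of_bool (t = gen a) + of_bool (t = ?q 1) + (\<Sum>i<2 * n. of_bool (t = ?q (Suc (Suc i))))"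
    by (simp add: sum.lessThan_Suc_shift del: sum.lessThan_Suc dihedral_refl.simps(2))
  then have "(((snd x \<noteq> (t = gen a)) \<noteq> (t = ?q 1)) \<noteq>
      odd (\<Sum>i<2 * n. of_bool (t = ?q (Suc (Suc i))) :: nat)) =
      (snd x \<noteq> odd (\<Sum>i<2 * Suc n. of_bool (t = ?q i) :: nat))"
    by auto
  finally show ?case unfolding t_def[symmetric] .
qed

lemma concat_replicate_wd:
  "s \<in> S \<Longrightarrow> t \<in> S \<Longrightarrow> wd (concat (replicate m [s, t])) = (gen s \<cdot> gen t) [^]\<^bsub>W\<^esub> m"
proof (induction m)
  case (Suc m)
  have "set (concat (replicate m [s, t])) \<subseteq> S" using Suc.prems by auto
  then show ?case
    using Suc wd_Cons[of s "t # concat (replicate m [s, t])"] wd_Cons[of t "concat (replicate m [s, t])"]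
      nat_pow_Suc2[of "gen s \<cdot> gen t" m]
    by (simp add: m_assoc del: nat_pow_Suc)
qed simp

text \<open>For a relator, (ab)^m = e makes the 2m reflections repeat with period m. Each is counted
  twice, every sign flip cancels, and the action descends to the group.\<close>

lemma refl_parity_cong:
  assumes "wd u = wd v" "set u \<subseteq> S" "set v \<subseteq> S" "t \<in> carrier W"
  shows "refl_parity u t = refl_parity v t"
proof -
  have "fold refl_act u (t, False) = fold refl_act v (t, False)"
  proof (rule fold_eq_if_wd_eq[where X = "carrier W \<times> UNIV"])
    show "refl_act s x \<in> carrier W \<times> UNIV \<and> refl_act s (refl_act s x) = x"
      if "s \<in> S" "x \<in> carrier W \<times> UNIV" for s x
    proof -
      have x: "fst x \<in> carrier W" using that(2) by (cases x) simp
      have "gen s \<cdot> fst x \<cdot> gen s = gen s \<longleftrightarrow> fst x = gen s"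
        using gen_conj_eq_iff[OF that(1) x, of "gen s"] that(1) by simp
      then have "refl_act s (refl_act s x) = (gen s \<cdot> (gen s \<cdot> fst x \<cdot> gen s) \<cdot> gen s,
          (snd x \<noteq> (fst x = gen s)) \<noteq> (fst x = gen s))"
        by (simp only: refl_act_def fst_conv snd_conv)
      also have "gen s \<cdot> (gen s \<cdot> fst x \<cdot> gen s) \<cdot> gen s = fst x"
        using that(1) x by (simp add: m_assoc)
      also have "((snd x \<noteq> (fst x = gen s)) \<noteq> (fst x = gen s)) = snd x" by blast
      finally have "refl_act s (refl_act s x) = x" by simp
      moreover have "fst (refl_act s x) \<in> carrier W" using that(1) x by (simp add: refl_act_def)
      ultimately show ?thesis by (simp add: mem_Times_iff)
    qed
    fix a b m and x :: "'s letter list set \<times> bool"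
    assume ab: "a \<in> S" "b \<in> S" and m: "M a b = enat m" and x: "x \<in> carrier W \<times> UNIV"
    have z: "(gen a \<cdot> gen b) [^]\<^bsub>W\<^esub> m = \<e>"
      using coxeter_relator_trivial[OF ab m] concat_replicate_wd[OF ab] by simp
    have "dihedral_refl a b (m + i) = dihedral_refl a b i" for i
      using dihedral_refl(1,3)[OF ab] z by simp
    then have "even (\<Sum>i<2 * m. of_bool (fst x = dihedral_refl a b i) :: nat)"
      unfolding mult_2 sum_lessThan_add by simp
    then show "((refl_act b \<circ> refl_act a) ^^ m) x = x"
      using x z refl_act_funpow[OF ab, of x m] by (auto simp: prod_eq_iff)
  qed (use assms in auto)
  then show ?thesis using snd_fold_refl_act[of _ "(t, False)"] by (metis fst_conv snd_conv)
qed

text \<open>An odd count means that \<open>t\<close> is the reflection attached to some letter, and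
  multiplication by that reflection deletes the letter.\<close>

lemma refl_parity_imp_deletion:
  "set ws \<subseteq> S \<Longrightarrow> t \<in> carrier W \<Longrightarrow> refl_parity ws t \<Longrightarrow>
    \<exists>u a v. ws = u @ a # v \<and> t \<cdot> wd ws = wd (u @ v)"
proof (induction ws arbitrary: t)
  case (Cons s ws)
  then have s: "s \<in> S" "set ws \<subseteq> S" by auto
  show ?case
  proof (cases "t = gen s")
    case True
    then have "t \<cdot> wd (s # ws) = wd ([] @ ws)" using s by (simp add: wd_Cons[of s ws])
    then show ?thesis by blast
  next
    case False
    then have "refl_parity ws (gen s \<cdot> t \<cdot> gen s)" using Cons.prems by simp
    then obtain u a v where uv: "ws = u @ a # v" "gen s \<cdot> t \<cdot> gen s \<cdot> wd ws = wd (u @ v)"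
      using Cons.IH[of "gen s \<cdot> t \<cdot> gen s"] Cons.prems by auto
    have "t \<cdot> wd (s # ws) = gen s \<cdot> (gen s \<cdot> t \<cdot> gen s \<cdot> wd ws)"
      using s Cons.prems by (simp add: wd_Cons[of s ws] m_assoc)
    also have "\<dots> = wd ((s # u) @ v)"
      using uv s wd_Cons[of s "u @ v"] by simp
    finally show ?thesis using uv(1) by (metis append_Cons)
  qed
qed simp

text \<open>If \<open>s\<close> has even parity in \<open>ws\<close>, it has odd parity in
  \<open>s # ws\<close>, hence also in a reduced word of the product. Deletion there makes
  \<open>wd ws\<close> shorter than the product, against the assumption.\<close>

lemma exchange_left:
  assumes s: "s \<in> S" and ws: "set ws \<subseteq> S" and le: "len (gen s \<cdot> wd ws) \<le> len (wd ws)"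
  shows "\<exists>u a v. ws = u @ a # v \<and> gen s \<cdot> wd ws = wd (u @ v)"
proof (rule refl_parity_imp_deletion[OF ws])
  show "refl_parity ws (gen s)"
  proof (rule ccontr)
    assume "\<not> refl_parity ws (gen s)"
    then have 1: "refl_parity (s # ws) (gen s)" using s by simp
    have "gen s \<cdot> wd ws \<in> carrier W" using s ws by simp
    then obtain vs where vs: "set vs \<subseteq> S" "wd vs = gen s \<cdot> wd ws" "length vs = len (gen s \<cdot> wd ws)"
      by (rule reduced_word)
    have "refl_parity vs (gen s)"
      using refl_parity_cong[of "s # ws" vs "gen s"] 1 vs s ws by (simp add: wd_Cons[of s ws])
    then obtain u a v where "vs = u @ a # v" "gen s \<cdot> wd vs = wd (u @ v)"
      using refl_parity_imp_deletion[of vs "gen s"] vs s by auto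
    then have "len (wd ws) < length vs"
      using vs s ws len_wd_le[of "u @ v"] by simp
    then show False using vs le by simp
  qed
qed (use s in simp)

lemma exchange_right:
  assumes s: "s \<in> S" and ws: "set ws \<subseteq> S" and le: "len (wd ws \<cdot> gen s) \<le> len (wd ws)"
  shows "\<exists>u a v. ws = u @ a # v \<and> wd ws \<cdot> gen s = wd (u @ v)"
proof -
  have inv: "gen s \<cdot> wd (rev ws) = ginv (wd ws \<cdot> gen s)"
    using s ws by (simp add: inv_mult_group inv_wd)
  have "len (gen s \<cdot> wd (rev ws)) \<le> len (wd (rev ws))"
    unfolding inv using le s ws inv_wd[OF ws] len_inv[of "wd ws"] by simp
  then obtain u a v where uv: "rev ws = u @ a # v" "gen s \<cdot> wd (rev ws) = wd (u @ v)"
    using exchange_left[OF s, of "rev ws"] ws by auto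
  then have "ws = rev v @ a # rev u" by (metis rev_append rev_rev_ident rev.simps(2) append_assoc append_Cons append_Nil)
  moreover have "wd ws \<cdot> gen s = wd (rev v @ rev u)"
  proof -
    have "set (u @ v) \<subseteq> S" using ws set_rev[of ws] unfolding uv(1) by auto
    then have "wd (rev (u @ v)) = ginv (wd (u @ v))" by (rule inv_wd[symmetric])
    also have "\<dots> = wd ws \<cdot> gen s" unfolding uv(2)[symmetric] inv using s ws by simp
    finally show ?thesis by simp
  qed
  ultimately show ?thesis by blast
qed

section \<open>Change of length under multiplication by generators\<close>

lemma
  assumes s: "s \<in> S" and x: "x \<in> carrier W"
  shows len_gen_mult_cases: "len (gen s \<cdot> x) = Suc (len x) \<or> len x = Suc (len (gen s \<cdot> x))"
    and len_mult_gen_cases: "len (x \<cdot> gen s) = Suc (len x) \<or> len x = Suc (len (x \<cdot> gen s))"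
proof -
  have *: "len (gen s \<cdot> x) = Suc (len x) \<or> len x = Suc (len (gen s \<cdot> x))" if x: "x \<in> carrier W" for x
  proof (cases "len (gen s \<cdot> x) \<le> len x")
    case True
    obtain ws where ws: "set ws \<subseteq> S" "wd ws = x" "length ws = len x" by (rule reduced_word[OF x])
    \<comment> \<open>Deletion of a letter from a reduced word excludes equal lengths: if the length
      does not grow, it drops.\<close>
    then obtain u a v where uv: "ws = u @ a # v" "gen s \<cdot> x = wd (u @ v)"
      using exchange_left[OF s, of ws] True by auto
    then have "len (gen s \<cdot> x) < len x" using ws len_wd_le[of "u @ v"] by simp
    moreover have "len x \<le> Suc (len (gen s \<cdot> x))"
      using len_gen_mult_le[OF s, of "gen s \<cdot> x"] s x by simp
    ultimately show ?thesis by simp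
  next
    case False
    then show ?thesis using len_gen_mult_le[OF s x] by simp
  qed
  show "len (gen s \<cdot> x) = Suc (len x) \<or> len x = Suc (len (gen s \<cdot> x))" by (rule *[OF x])
  have "len (x \<cdot> gen s) = len (gen s \<cdot> ginv x)"
    using len_inv[of "x \<cdot> gen s"] s x by (simp add: inv_mult_group)
  then show "len (x \<cdot> gen s) = Suc (len x) \<or> len x = Suc (len (x \<cdot> gen s))"
    using *[of "ginv x"] x by simp
qed

text \<open>Exchange with \<open>t\<close> in the reduced word \<open>s # ws\<close> either deletes
  the leading \<open>s\<close>, which is the conclusion, or a letter of \<open>ws\<close>, which
  would make wt shorter than w.\<close>

lemma up_up_down_imp_eq:
  assumes s: "s \<in> S" and t: "t \<in> S" and w: "w \<in> carrier W"
    and "len w < len (gen s \<cdot> w)" "len w < len (w \<cdot> gen t)" "len (gen s \<cdot> w \<cdot> gen t) < len (gen s \<cdot> w)"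
  shows "gen s \<cdot> w = w \<cdot> gen t"
proof -
  obtain ws where ws: "set ws \<subseteq> S" "wd ws = w" "length ws = len w" by (rule reduced_word[OF w])
  have sw: "wd (s # ws) = gen s \<cdot> w" using ws s by (simp add: wd_Cons[of s ws])
  obtain u a v where uv: "s # ws = u @ a # v" "gen s \<cdot> w \<cdot> gen t = wd (u @ v)"
    using exchange_right[OF t, of "s # ws"] sw ws s assms(6) by auto
  show ?thesis
  proof (cases u)
    case Nil
    then have "gen s \<cdot> w \<cdot> gen t = w" using uv ws by simp
    then show ?thesis using s t w
      by (metis gen_sq m_assoc m_closed r_one wd_closed list.set(1) list.simps(15) empty_subsetI insert_subset)
  next
    case (Cons b u')
    then have u': "u = s # u'" "ws = u' @ a # v" using uv by auto
    then have "gen s \<cdot> (w \<cdot> gen t) = gen s \<cdot> wd (u' @ v)"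
      using uv s t w ws wd_Cons[of s "u' @ v"] by (simp add: m_assoc)
    then have "w \<cdot> gen t = wd (u' @ v)"
      using gen_mult_cancel[OF s] t w ws u' by simp
    then have "len (w \<cdot> gen t) < len w" using len_wd_le[of "u' @ v"] u' ws by simp
    then show ?thesis using assms by simp
  qed
qed

text \<open>All four sides of the square w, sw, wt, swt change the length by one. If the sums
  differ, then w and swt are both shorter or both longer than sw and wt. The first case is
  \<open>up_up_down_imp_eq\<close> for w, the second is the same lemma for sw.\<close>

lemma length_defect_imp_eq:
  assumes s: "s \<in> S" and t: "t \<in> S" and w: "w \<in> carrier W"
    and ne: "gen s \<cdot> w \<noteq> w \<cdot> gen t"
  shows "len (gen s \<cdot> w \<cdot> gen t) + len w = len (gen s \<cdot> w) + len (w \<cdot> gen t)"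
proof -
  have a: "gen s \<cdot> w \<cdot> gen t = gen s \<cdot> (w \<cdot> gen t)" using s t w by (simp add: m_assoc)
  have "gen s \<cdot> w \<in> carrier W" "w \<cdot> gen t \<in> carrier W" using s t w by auto
  note c = len_gen_mult_cases[OF s w] len_mult_gen_cases[OF t w]
    len_mult_gen_cases[OF t \<open>gen s \<cdot> w \<in> carrier W\<close>] len_gen_mult_cases[OF s \<open>w \<cdot> gen t \<in> carrier W\<close>, folded a]
  show ?thesis
  proof (cases "len w < len (gen s \<cdot> w)")
    case True
    have "\<not> (len w < len (w \<cdot> gen t) \<and> len (gen s \<cdot> w \<cdot> gen t) < len (gen s \<cdot> w))"
      using up_up_down_imp_eq[OF s t w True] ne by blast
    with c True show ?thesis by linarith
  next
    case False
    let ?w = "gen s \<cdot> w"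
    have "gen s \<cdot> ?w = w" using s w by simp
    moreover have "w \<noteq> gen s \<cdot> w \<cdot> gen t"
    proof
      assume "w = gen s \<cdot> w \<cdot> gen t"
      then have "gen s \<cdot> w = gen s \<cdot> (gen s \<cdot> w \<cdot> gen t)" by simp
      then show False using ne s t w a by simp
    qed
    ultimately have "\<not> (len ?w < len w \<and> len ?w < len (?w \<cdot> gen t) \<and> len (w \<cdot> gen t) < len w)"
      using up_up_down_imp_eq[OF s t, of ?w] s w by auto
    with c False show ?thesis by linarith
  qed
qed

end

section \<open>The order of a product of two generators\<close>

lemma sin_pi_div_pos:
  assumes "2 \<le> m" shows "0 < sin (pi / real m)"
proof (rule sin_gt_zero)
  have "pi < pi * real m" using assms by simp
  then show "pi / real m < pi" using assms by (simp add: pos_divide_less_eq)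
qed (use assms in simp)

context coxeter_system
begin

lemma coxeter_sym: "s \<in> S \<Longrightarrow> t \<in> S \<Longrightarrow> M s t = M t s"
  and coxeter_diag: "s \<in> S \<Longrightarrow> M s s = 1"
  and coxeter_ge_2: "s \<in> S \<Longrightarrow> t \<in> S \<Longrightarrow> s \<noteq> t \<Longrightarrow> 2 \<le> M s t"
  using coxeter by (auto simp: coxeter_matrix_def)

text \<open>
  The contragredient of the geometric representation, acting on functions on the generators.
\<close>
definition weight :: "'s \<Rightarrow> 's \<Rightarrow> real" where
  "weight s t = (case M s t of enat m \<Rightarrow> 2 * cos (pi / m) | \<infinity> \<Rightarrow> 2)"

definition fire :: "'s \<Rightarrow> ('s \<Rightarrow> real) \<Rightarrow> 's \<Rightarrow> real" where
  "fire s f u = (if u = s then - f s else f u + weight s u * f s)"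

lemma fire_fire: "fire s (fire s f) = f"
  by (auto simp: fire_def fun_eq_iff)

lemma fire_pair:
  assumes "s \<in> S" "t \<in> S" "s \<noteq> t"
  shows "(fire t \<circ> fire s) f s = ((weight s t)\<^sup>2 - 1) * f s + weight s t * f t"
    and "(fire t \<circ> fire s) f t = - f t - weight s t * f s"
proof -
  have "weight t s = weight s t" using coxeter_sym[OF assms(1,2)] by (simp add: weight_def)
  then show "(fire t \<circ> fire s) f s = ((weight s t)\<^sup>2 - 1) * f s + weight s t * f t"
    "(fire t \<circ> fire s) f t = - f t - weight s t * f s"
    using assms(3) by (auto simp: fire_def algebra_simps power2_eq_square)
qed

text \<open>In the coordinates \<open>f s\<close> and \<open>P\<close> the pair acts as a rotation
  through \<open>2 * \<theta>\<close>; \<open>P\<close> is the coordinate that turns the oblique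
  basis of s and t into an orthogonal one.\<close>

lemma fire_pair_funpow:
  assumes st: "s \<in> S" "t \<in> S" "s \<noteq> t" and \<theta>: "weight s t = 2 * cos \<theta>"
    and P: "f t = sin \<theta> * P - cos \<theta> * f s"
  shows "((fire t \<circ> fire s) ^^ n) f s = f s * cos (n * (2 * \<theta>)) + P * sin (n * (2 * \<theta>))"
    and "((fire t \<circ> fire s) ^^ n) f t = sin \<theta> * (P * cos (n * (2 * \<theta>)) - f s * sin (n * (2 * \<theta>)))
      - cos \<theta> * (f s * cos (n * (2 * \<theta>)) + P * sin (n * (2 * \<theta>)))"
proof -
  have "((fire t \<circ> fire s) ^^ n) f s = f s * cos (n * (2 * \<theta>)) + P * sin (n * (2 * \<theta>)) \<and>
    ((fire t \<circ> fire s) ^^ n) f t = sin \<theta> * (P * cos (n * (2 * \<theta>)) - f s * sin (n * (2 * \<theta>)))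
      - cos \<theta> * (f s * cos (n * (2 * \<theta>)) + P * sin (n * (2 * \<theta>)))"
  proof (induction n)
    case 0
    show ?case using P by (simp add: algebra_simps)
  next
    case (Suc n)
    define x where "x = f s * cos (n * (2 * \<theta>)) + P * sin (n * (2 * \<theta>))"
    define y where "y = P * cos (n * (2 * \<theta>)) - f s * sin (n * (2 * \<theta>))"
    have ang: "real (Suc n) * (2 * \<theta>) = n * (2 * \<theta>) + 2 * \<theta>" by (simp add: algebra_simps)
    have "f s * cos (Suc n * (2 * \<theta>)) + P * sin (Suc n * (2 * \<theta>)) = cos (2 * \<theta>) * x + sin (2 * \<theta>) * y"
      unfolding ang cos_add sin_add x_def y_def by (simp add: algebra_simps)
    moreover have "P * cos (Suc n * (2 * \<theta>)) - f s * sin (Suc n * (2 * \<theta>)) = cos (2 * \<theta>) * y - sin (2 * \<theta>) * x"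
      unfolding ang cos_add sin_add x_def y_def by (simp add: algebra_simps)
    moreover have "((fire t \<circ> fire s) ^^ Suc n) f s = cos (2 * \<theta>) * x + sin (2 * \<theta>) * y"
      "((fire t \<circ> fire s) ^^ Suc n) f t = sin \<theta> * (cos (2 * \<theta>) * y - sin (2 * \<theta>) * x)
        - cos \<theta> * (cos (2 * \<theta>) * x + sin (2 * \<theta>) * y)"
    proof -
      let ?g = "((fire t \<circ> fire s) ^^ n) f"
      have g: "?g s = x" "?g t = sin \<theta> * y - cos \<theta> * x"
        unfolding x_def y_def by (rule Suc.IH[THEN conjunct1], rule Suc.IH[THEN conjunct2])
      have S: "((fire t \<circ> fire s) ^^ Suc n) f = (fire t \<circ> fire s) ?g" by simp
      have "(4 * (cos \<theta>)\<^sup>2 - 1) * x + 2 * cos \<theta> * (sin \<theta> * y - cos \<theta> * x) =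
          (2 * (cos \<theta>)\<^sup>2 - 1) * x + 2 * sin \<theta> * cos \<theta> * y"
        by (simp add: algebra_simps power2_eq_square)
      then show "((fire t \<circ> fire s) ^^ Suc n) f s = cos (2 * \<theta>) * x + sin (2 * \<theta>) * y"
        unfolding S fire_pair[OF st] g \<theta> cos_double_cos sin_double
        by (simp add: power_mult_distrib algebra_simps)
      have "- (sin \<theta> * y - cos \<theta> * x) - 2 * cos \<theta> * x = - sin \<theta> * y - cos \<theta> * x" by simp
      \<comment> \<open>Multiplying by a sum of squares equal to 1 makes both sides of the same
        degree in sine and cosine.\<close>
      also have "\<dots> = - sin \<theta> * ((sin \<theta>)\<^sup>2 + (cos \<theta>)\<^sup>2) * y - cos \<theta> * ((sin \<theta>)\<^sup>2 + (cos \<theta>)\<^sup>2) * x"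
        by (simp only: sin_cos_squared_add mult_1_right)
      also have "\<dots> = sin \<theta> * (cos (2 * \<theta>) * y - sin (2 * \<theta>) * x)
        - cos \<theta> * (cos (2 * \<theta>) * x + sin (2 * \<theta>) * y)"
        unfolding cos_double sin_double
        by (simp add: algebra_simps power2_eq_square
            del: sin_cos_squared_add sin_cos_squared_add2 sin_cos_squared_add3)
      finally show "((fire t \<circ> fire s) ^^ Suc n) f t = sin \<theta> * (cos (2 * \<theta>) * y - sin (2 * \<theta>) * x)
        - cos \<theta> * (cos (2 * \<theta>) * x + sin (2 * \<theta>) * y)"
        unfolding S fire_pair[OF st] g \<theta> .
    qed
    ultimately show ?case by (simp only:)
  qed
  then show "((fire t \<circ> fire s) ^^ n) f s = f s * cos (n * (2 * \<theta>)) + P * sin (n * (2 * \<theta>))"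
    "((fire t \<circ> fire s) ^^ n) f t = sin \<theta> * (P * cos (n * (2 * \<theta>)) - f s * sin (n * (2 * \<theta>)))
      - cos \<theta> * (f s * cos (n * (2 * \<theta>)) + P * sin (n * (2 * \<theta>)))"
    by auto
qed

text \<open>At s and t, m rotations through 2 pi / m are a full turn. Any other coordinate differs
  from an invariant by a combination of these two, so it returns as well.\<close>

lemma fire_pair_relation:
  assumes st: "s \<in> S" "t \<in> S" and m: "M s t = enat m"
  shows "((fire t \<circ> fire s) ^^ m) f = f"
proof (cases "s = t")
  case True
  then have "m = 1" using m coxeter_diag[OF st(1)] by (simp add: one_enat_def)
  then show ?thesis using True by (simp add: fire_fire)
next
  case False
  have m2: "2 \<le> m" using coxeter_ge_2[OF st False] m by (simp add: numeral_eq_enat)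
  define \<theta> where "\<theta> = pi / m"
  have c: "weight s t = 2 * cos \<theta>" by (simp add: weight_def m \<theta>_def)
  have c': "weight t s = 2 * cos \<theta>" using m coxeter_sym[OF st] unfolding weight_def \<theta>_def by (metis enat.simps(4))
  have sin: "0 < sin \<theta>" using sin_pi_div_pos[OF m2] by (simp add: \<theta>_def)
  define P where "P = (f t + cos \<theta> * f s) / sin \<theta>"
  have P: "f t = sin \<theta> * P - cos \<theta> * f s" using sin by (simp add: P_def)
  have ang: "real m * (2 * \<theta>) = 2 * pi" using m2 by (simp add: \<theta>_def)
  have fs: "((fire t \<circ> fire s) ^^ m) f s = f s" and ft: "((fire t \<circ> fire s) ^^ m) f t = f t"
    using fire_pair_funpow[OF st False c P, of m] unfolding ang P by simp_all
  show ?thesis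
  proof
    fix u
    show "((fire t \<circ> fire s) ^^ m) f u = f u"
    proof (cases "u = s \<or> u = t")
      case False
      let ?c = "weight s t"
      have "?c\<^sup>2 - 4 = - 4 * (sin \<theta>)\<^sup>2" unfolding c by (simp add: power_mult_distrib sin_squared_eq)
      then have d: "?c\<^sup>2 - 4 \<noteq> 0" using sin by simp
      \<comment> \<open>\<open>a\<close> and \<open>b\<close> are chosen to make \<open>I\<close> invariant: it is the projection onto the orthogonal
        complement of the plane of \<open>s\<close> and \<open>t\<close>\<close>
      define a where "a = (2 * weight s u + ?c * weight t u) / (?c\<^sup>2 - 4)"
      define b where "b = (a * ?c - weight t u) / 2"
      define I where "I g = g u - a * g s - b * g t" for g :: "'s \<Rightarrow> real"
      have a: "a * (?c\<^sup>2 - 4) = 2 * weight s u + ?c * weight t u" using d by (simp add: a_def)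
      have b: "2 * b = a * ?c - weight t u" by (simp add: b_def)
      have "I (fire s g) = I g" for g
      proof -
        have "2 * (I (fire s g) - I g) = (2 * weight s u + 4 * a - (2 * b) * ?c) * g s"
          using False \<open>s \<noteq> t\<close> by (simp add: I_def fire_def algebra_simps)
        also have "\<dots> = (2 * weight s u + ?c * weight t u - a * (?c\<^sup>2 - 4)) * g s"
          unfolding b by (simp add: algebra_simps power2_eq_square)
        finally show ?thesis unfolding a by simp
      qed
      moreover have "I (fire t g) = I g" for g
      proof -
        have "I (fire t g) - I g = (weight t u - a * weight t s + 2 * b) * g t"
          using False \<open>s \<noteq> t\<close> by (simp add: I_def fire_def algebra_simps)
        then show ?thesis unfolding b c c' by simp
      qed
      ultimately have "I (((fire t \<circ> fire s) ^^ n) f) = I f" for n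
        by (induction n) simp_all
      from this[of m] show ?thesis unfolding I_def fs ft by simp
    qed (use fs ft in auto)
  qed
qed

text \<open>If the k-th power is trivial in the group, it is trivial in the representation: a
  rotation through 2 pi k / m must be the identity, and linear growth in the infinite case is
  impossible.\<close>

lemma order_gen_mult_gen:
  assumes st: "s \<in> S" "t \<in> S" "s \<noteq> t" and k: "0 < k" "(gen s \<cdot> gen t) [^]\<^bsub>W\<^esub> k = \<e>"
  shows "\<exists>m. M s t = enat m \<and> m dvd k"
proof -
  have periodic: "((fire t \<circ> fire s) ^^ k) f = f" for f
  proof -
    have "fold fire (concat (replicate k [s, t])) f = fold fire [] f"
      by (rule fold_eq_if_wd_eq[where X = UNIV])
        (use st k concat_replicate_wd[OF st(1,2)] in \<open>auto simp: fire_fire fire_pair_relation\<close>)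
    then show ?thesis by (simp add: fold_concat_replicate)
  qed
  show ?thesis
  proof (cases "M s t")
    case (enat m)
    have m2: "2 \<le> m" using coxeter_ge_2[OF st] enat by (simp add: numeral_eq_enat)
    define \<theta> where "\<theta> = pi / m"
    have c: "weight s t = 2 * cos \<theta>" by (simp add: weight_def enat \<theta>_def)
    have sin: "0 < sin \<theta>" using sin_pi_div_pos[OF m2] by (simp add: \<theta>_def)
    \<comment> \<open>The starting point has rotation coordinates 0 and 1, so the angle can be read
      off.\<close>
    define f where "f u = (if u = t then sin \<theta> else 0)" for u
    have f: "f s = 0" "f t = sin \<theta>" using st by (auto simp: f_def)
    have "f t = sin \<theta> * 1 - cos \<theta> * f s" by (simp add: f)
    from fire_pair_funpow[OF st c this, of k]
    have "sin (k * (2 * \<theta>)) = 0" "sin \<theta> * cos (k * (2 * \<theta>)) = sin \<theta>"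
      unfolding periodic f by simp_all
    then have "cos (k * (2 * \<theta>)) = 1" using sin by simp
    then obtain n :: int where "k * (2 * \<theta>) = real_of_int n * 2 * pi"
      using cos_one_2pi_int by blast
    then have "real k = real_of_int n * real m" using m2 by (simp add: \<theta>_def field_simps)
    then have "int k = n * int m"
      by (metis of_int_eq_iff of_int_mult of_int_of_nat_eq)
    then have "m dvd k" by (metis dvd_triv_right int_dvd_int_iff)
    then show ?thesis using enat by blast
  next
    case infinity
    then have c: "weight s t = 2" by (simp add: weight_def)
    \<comment> \<open>With weight 2 the pair acts unipotently on the two coordinates, and from this
      start the value at s grows by 2 in each round.\<close>
    define f where "f u = (if u = t then 1 else 0 :: real)" for u
    have "((fire t \<circ> fire s) ^^ n) f s = 2 * real n \<and> ((fire t \<circ> fire s) ^^ n) f t = 1 - 2 * real n" for n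
    proof (induction n)
      case (Suc n)
      define g where "g = ((fire t \<circ> fire s) ^^ n) f"
      have S: "((fire t \<circ> fire s) ^^ Suc n) f = (fire t \<circ> fire s) g" by (simp add: g_def)
      have "g s = 2 * real n" "g t = 1 - 2 * real n" unfolding g_def using Suc.IH by blast+
      then show ?case
        unfolding S fire_pair[OF st] c by (simp add: algebra_simps)
    qed (use st in \<open>simp add: f_def\<close>)
    from this[of k] periodic[of f] show ?thesis using k st by (simp add: f_def)
  qed
qed

section \<open>Rank two parabolic subgroups\<close>

text \<open>Minimality is among words over \<open>J\<close> only. That these words are also shortest
  over \<open>S\<close> is the case u = e of \<open>len_mult_parabolic\<close>.\<close>

definition reduced_in :: "'s set \<Rightarrow> 's list \<Rightarrow> bool" where
  "reduced_in J v \<longleftrightarrow> set v \<subseteq> J \<and> (\<forall>v'. set v' \<subseteq> J \<and> wd v' = wd v \<longrightarrow> length v \<le> length v')"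

lemma reduced_in_butlast:
  assumes "J \<subseteq> S" "reduced_in J (v @ [x])"
  shows "reduced_in J v"
  unfolding reduced_in_def
proof (intro conjI allI impI)
  have vx: "set v \<subseteq> J" "x \<in> J" using assms by (auto simp: reduced_in_def)
  then show "set v \<subseteq> J" by simp
  fix v' assume v': "set v' \<subseteq> J \<and> wd v' = wd v"
  then have "wd (v' @ [x]) = wd (v @ [x])"
    using vx assms(1) wd_append[of v' "[x]"] wd_append[of v "[x]"] by auto
  moreover have "set (v' @ [x]) \<subseteq> J" using v' vx by simp
  ultimately have "length (v @ [x]) \<le> length (v' @ [x])" using assms(2) unfolding reduced_in_def by blast
  then show "length v \<le> length v'" by simp
qed

lemma reduced_in_exists:
  assumes "set v \<subseteq> J"
  shows "\<exists>v'. reduced_in J v' \<and> wd v' = wd v"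
proof -
  have "\<exists>v'. (set v' \<subseteq> J \<and> wd v' = wd v) \<and> (\<forall>v''. set v'' \<subseteq> J \<and> wd v'' = wd v \<longrightarrow> length v' \<le> length v'')"
    by (rule ex_has_least_nat[where k = v]) (use assms in blast)
  then show ?thesis unfolding reduced_in_def by metis
qed

text \<open>If appending \<open>x\<close> did not lengthen the product, exchange would delete a
  letter. A letter of \<open>us\<close> would give an element of the coset shorter than
  \<open>u\<close>; a letter of \<open>v\<close> would give a word over \<open>J\<close> shorter
  than \<open>v @ [x]\<close>.\<close>

lemma len_mult_parabolic:
  assumes J: "J \<subseteq> S" and u: "u \<in> carrier W" and min: "\<And>v. set v \<subseteq> J \<Longrightarrow> len u \<le> len (u \<cdot> wd v)"
  shows "reduced_in J v \<Longrightarrow> len (u \<cdot> wd v) = len u + length v"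
proof (induction v rule: rev_induct)
  case Nil
  show ?case using u by simp
next
  case (snoc x v)
  have IH: "len (u \<cdot> wd v) = len u + length v"
    using snoc.IH reduced_in_butlast[OF J snoc.prems] by blast
  have vx: "set v \<subseteq> J" "x \<in> J" "set v \<subseteq> S" "x \<in> S" using snoc.prems J by (auto simp: reduced_in_def)
  let ?y = "u \<cdot> wd v"
  have yx: "u \<cdot> wd (v @ [x]) = ?y \<cdot> gen x" using u vx by (simp add: wd_append m_assoc)
  have "\<not> len (?y \<cdot> gen x) \<le> len ?y"
  proof
    assume le: "len (?y \<cdot> gen x) \<le> len ?y"
    obtain us where us: "set us \<subseteq> S" "wd us = u" "length us = len u" by (rule reduced_word[OF u])
    have y: "wd (us @ v) = ?y" using us vx by (simp add: wd_append)
    obtain p a q where pq: "us @ v = p @ a # q" "?y \<cdot> gen x = wd (p @ q)"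
      using exchange_right[OF vx(4), of "us @ v"] le us vx y by auto
    have sub: "set p \<subseteq> S" "set q \<subseteq> S" using us vx arg_cong[OF pq(1), of set] by auto
    show False
    proof (cases "length p < length us")
      case True
      then obtain q' where q': "us = p @ a # q'" "q = q' @ v"
        using pq(1) by (auto simp: append_eq_append_conv2 Cons_eq_append_conv append_eq_Cons_conv)
      have sq: "set q' \<subseteq> S" using us q' by simp
      have "wd (p @ q') \<cdot> wd v = u \<cdot> wd (v @ [x])"
        unfolding yx pq(2) q'(2) using sub sq vx by (simp add: wd_append m_assoc)
      then have "wd (p @ q') = u \<cdot> wd (v @ [x]) \<cdot> wd (rev v)"
        using inv_solve_right[of "wd (p @ q')" "u \<cdot> wd (v @ [x])" "wd v"] inv_wd[of v] u sub sq vx by simp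
      also have "\<dots> = u \<cdot> wd ((v @ [x]) @ rev v)"
        using u vx by (subst wd_append[of "v @ [x]" "rev v"]) (simp_all add: m_assoc)
      finally have "wd (p @ q') = u \<cdot> wd (v @ [x] @ rev v)" by simp
      moreover have "set (v @ [x] @ rev v) \<subseteq> J" using vx by simp
      ultimately have "len u \<le> len (wd (p @ q'))" using min by metis
      also have "\<dots> \<le> length (p @ q')" using sub sq by (intro len_wd_le) simp
      finally show False using us(3) q'(1) by simp
    next
      case False
      then obtain p' where p': "p = us @ p'" "v = p' @ a # q"
        using pq(1) by (auto simp: append_eq_append_conv2 Cons_eq_append_conv append_eq_Cons_conv)
      have sp: "set p' \<subseteq> S" using sub p' by simp
      have "u \<cdot> wd (v @ [x]) = u \<cdot> wd (p' @ q)"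
        unfolding yx pq(2) p'(1) using sub sp us by (simp add: wd_append m_assoc)
      then have "ginv u \<cdot> (u \<cdot> wd (v @ [x])) = ginv u \<cdot> (u \<cdot> wd (p' @ q))" by simp
      then have "wd (p' @ q) = wd (v @ [x])"
        using u sp sub vx by (simp add: m_assoc[symmetric])
      moreover have "set (p' @ q) \<subseteq> J" using vx(1) p'(2) by simp
      ultimately have "length (v @ [x]) \<le> length (p' @ q)"
        using snoc.prems unfolding reduced_in_def by blast
      then show False using p'(2) by simp
    qed
  qed
  then have "len (?y \<cdot> gen x) = Suc (len ?y)"
    using len_mult_gen_cases[OF vx(4), of ?y] u vx by auto
  then show ?case unfolding yx using IH by simp
qed

lemma parabolic_decomposition:
  assumes J: "J \<subseteq> S" and w: "w \<in> carrier W"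
  obtains u v where "u \<in> carrier W" "reduced_in J v" "w = u \<cdot> wd v"
    "\<And>v'. set v' \<subseteq> J \<Longrightarrow> len u \<le> len (u \<cdot> wd v')"
proof -
  obtain v0 where v0: "set v0 \<subseteq> J" "\<And>v. set v \<subseteq> J \<Longrightarrow> len (w \<cdot> wd v0) \<le> len (w \<cdot> wd v)"
    using ex_has_least_nat[of "\<lambda>v. set v \<subseteq> J" "[]" "\<lambda>v. len (w \<cdot> wd v)"] by auto
  define u where "u = w \<cdot> wd v0"
  have S0: "set v0 \<subseteq> S" using v0 J by blast
  obtain v where v: "reduced_in J v" "wd v = wd (rev v0)"
    using reduced_in_exists[of "rev v0" J] v0(1) by auto
  show thesis
  proof (rule that[OF _ v(1)])
    show "u \<in> carrier W" using w S0 by (simp add: u_def)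
    show "w = u \<cdot> wd v" unfolding v(2) u_def inv_wd[OF S0, symmetric] using w S0 by (simp add: m_assoc)
    fix v' assume v': "set v' \<subseteq> J"
    then have "u \<cdot> wd v' = w \<cdot> wd (v0 @ v')"
      using w S0 J by (simp add: u_def wd_append m_assoc)
    then show "len u \<le> len (u \<cdot> wd v')" using v0(2)[of "v0 @ v'"] v0(1) v' by (simp add: u_def)
  qed
qed

section \<open>Alternating words and the braid relation\<close>

primrec alt :: "nat \<Rightarrow> 's \<Rightarrow> 's \<Rightarrow> 's list" where
  "alt 0 x y = []"
| "alt (Suc n) x y = alt n y x @ [x]"

lemma length_alt [simp]: "length (alt n x y) = n"
  by (induction n arbitrary: x y) auto

lemma set_alt: "set (alt n x y) \<subseteq> {x, y}"
  by (induction n arbitrary: x y) auto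

lemma set_alt_S: "x \<in> S \<Longrightarrow> y \<in> S \<Longrightarrow> set (alt n x y) \<subseteq> S"
  using set_alt[of n x y] by auto

text \<open>\<open>alt\<close> grows at its right end, where descents are taken; its last letter is
  fixed and the parity of the length determines the first.\<close>

lemma alt_Suc_Cons: "alt (Suc n) x y = (if even n then x else y) # alt n x y"
  by (induction n arbitrary: x y) auto

lemma rev_alt: "rev (alt n x y) = (if even n then alt n y x else alt n x y)"
proof (induction n arbitrary: x y)
  case (Suc n)
  then show ?case using alt_Suc_Cons[of n] by (auto simp del: alt.simps(2) simp: alt.simps(2)[of n])
qed simp

lemma alt_double: "alt (2 * k) y x = concat (replicate k [x, y])"
proof (induction k)
  case (Suc k)
  have "alt (2 * Suc k) y x = x # y # alt (2 * k) y x"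
    using alt_Suc_Cons[of "Suc (2 * k)" y x] alt_Suc_Cons[of "2 * k" y x] by (simp del: alt.simps)
  then show ?case using Suc by simp
qed simp

text \<open>Two equal neighbours would cancel, so the letters of a reduced word alternate.\<close>

lemma alt_of_reduced:
  assumes "x \<in> S" "y \<in> S" "reduced_in {x, y} v"
  shows "v = alt (length v) x y \<or> v = alt (length v) y x"
  using assms(3)
proof (induction v rule: rev_induct)
  case (snoc a v)
  have J: "{x, y} \<subseteq> S" using assms by simp
  have a: "a \<in> {x, y}" "set v \<subseteq> {x, y}" using snoc.prems by (auto simp: reduced_in_def)
  have IH: "v = alt (length v) x y \<or> v = alt (length v) y x"
    using snoc.IH reduced_in_butlast[OF J snoc.prems] by blast
  show ?case
  proof (cases "length v")
    case 0
    then show ?thesis using a by auto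
  next
    case (Suc n)
    have ne: "v \<noteq> u @ [a]" for u
    proof
      assume v: "v = u @ [a]"
      have u: "set u \<subseteq> S" "a \<in> S" using v a J by auto
      have "wd (v @ [a]) = wd u" using u wd_Cons[of a "[a]"] by (simp add: v wd_append)
      moreover have "set u \<subseteq> {x, y}" using v a by simp
      ultimately have "length (v @ [a]) \<le> length u" using snoc.prems unfolding reduced_in_def by metis
      then show False using v by simp
    qed
    have "v = alt n y x @ [x] \<or> v = alt n x y @ [y]" using IH Suc by auto
    then show ?thesis
      using ne a(1) IH Suc by auto
  qed
qed simp

text \<open>One alternating word followed by the reverse of the other is the alternating word of
  length 2k, which is a k-th power.\<close>

lemma wd_alt_mult_inv:
  assumes "x \<in> S" "y \<in> S" "wd (alt k x y) = wd (alt k y x)"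
  shows "(gen x \<cdot> gen y) [^]\<^bsub>W\<^esub> k = \<e>"
proof -
  have app: "alt (m + n) a b = (if even n then alt m a b else alt m b a) @ alt n a b" for m n a b
    by (induction n arbitrary: a b) auto
  have s: "set (alt k a b) \<subseteq> S" if "{a, b} \<subseteq> S" for a b using set_alt_S[of a b] that by auto
  have "alt (2 * k) y x = alt k x y @ rev (alt k y x) \<or> alt (2 * k) y x = alt k y x @ rev (alt k x y)"
    using app[of k k y x] by (auto simp: mult_2 rev_alt)
  then have "wd (alt (2 * k) y x) = \<e>"
  proof
    assume "alt (2 * k) y x = alt k x y @ rev (alt k y x)"
    then show ?thesis using assms s by (simp add: wd_append inv_wd[symmetric])
  next
    assume "alt (2 * k) y x = alt k y x @ rev (alt k x y)"
    then show ?thesis using assms s by (simp add: wd_append inv_wd[symmetric])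
  qed
  then show ?thesis unfolding alt_double concat_replicate_wd[OF assms(1,2)] .
qed

lemma wd_alt_braid:
  assumes "x \<in> S" "y \<in> S" "M x y = enat m"
  shows "wd (alt m x y) = wd (alt m y x)"
proof -
  have s: "set (alt k a b) \<subseteq> S" if "{a, b} \<subseteq> S" for a b k using set_alt_S[of a b] that by auto
  have app: "alt (m + n) a b = (if even n then alt m a b else alt m b a) @ alt n a b" for n a b
    by (induction n arbitrary: a b) auto
  have "wd (alt (2 * m) y x) = \<e>"
    unfolding alt_double using coxeter_relator_trivial[OF assms] .
  moreover have "alt (2 * m) y x = (if even m then alt m y x else alt m x y) @ alt m y x"
    using app[of m y x] by (simp add: mult_2)
  moreover have "wd (if even m then alt m y x else alt m x y) = ginv (wd (alt m x y))"
    using assms s by (simp add: inv_wd rev_alt)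
  ultimately have "ginv (wd (alt m x y)) \<cdot> wd (alt m y x) = \<e>"
    using assms s by (simp add: wd_append)
  then have "wd (alt m x y) \<cdot> (ginv (wd (alt m x y)) \<cdot> wd (alt m y x)) = wd (alt m x y)"
    using assms s by simp
  then show ?thesis using assms s by (simp add: m_assoc[symmetric])
qed

text \<open>In an alternating word of length m + 1 the braid relation rewrites the first m letters
  so that the last two become equal and cancel.\<close>

lemma reduced_alt_le:
  assumes xy: "x \<in> S" "y \<in> S" and m: "M x y = enat m" "M y x = enat m" "0 < m"
  shows "reduced_in {x, y} (alt n x y) \<Longrightarrow> n \<le> m"
proof -
  have "\<not> reduced_in {x, y} (alt (Suc m) a b)" if ab: "{a, b} = {x, y}" "M a b = enat m" for a b
  proof
    assume red: "reduced_in {x, y} (alt (Suc m) a b)"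
    have S: "a \<in> S" "b \<in> S" using ab xy by auto
    obtain k where k: "m = Suc k" using m(3) by (cases m) auto
    have "wd (alt (Suc m) a b) = wd (alt m b a) \<cdot> gen a"
      using S by (simp add: wd_append set_alt_S)
    also have "\<dots> = wd (alt m a b) \<cdot> gen a" using wd_alt_braid[OF S ab(2)] by simp
    also have "\<dots> = wd (alt k b a)"
      unfolding k using S by (simp add: wd_append set_alt_S m_assoc)
    finally have "length (alt (Suc m) a b) \<le> length (alt k b a)"
      using red set_alt[of k b a] ab(1) unfolding reduced_in_def by (metis insert_commute)
    then show False using k by simp
  qed
  note not_reduced = this
  have "\<not> reduced_in {x, y} (alt (Suc m + i) a b)" if "{a, b} = {x, y}" for i a b
    using that
  proof (induction i arbitrary: a b)
    case 0
    then have "M a b = enat m" using m by (auto simp: doubleton_eq_iff)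
    with 0 not_reduced show ?case by simp
  next
    case (Suc i)
    have "{b, a} = {x, y}" using Suc.prems by auto
    from Suc.IH[OF this] have "\<not> reduced_in {x, y} (alt (Suc m + i) b a @ [a])"
      using reduced_in_butlast[of "{x, y}" "alt (Suc m + i) b a" a] xy by auto
    then show ?case by simp
  qed
  note * = this
  assume red: "reduced_in {x, y} (alt n x y)"
  show "n \<le> m"
  proof (rule ccontr)
    assume "\<not> n \<le> m"
    then obtain i where "n = Suc m + i" by (metis less_natE not_le add_Suc)
    with * red show False by blast
  qed
qed

text \<open>Let w = uv with u shortest in its coset for \<open>J = {r, t}\<close>. Then su = u(v t
  v^-1) lies in the same coset, where lengths add, and s changes the length by at most one. So v t
  v^-1 is a single letter j, and jv = vt is an equality of two reduced words in rank two, which can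
  only be the braid relation.\<close>

lemma reflection_step:
  assumes s: "s \<in> S" and t: "t \<in> S" and w: "w \<in> carrier W" and eq: "gen s \<cdot> w = w \<cdot> gen t"
    and up: "len w < len (gen s \<cdot> w)" and ne: "w \<noteq> \<e>"
  obtains r u m where "r \<in> S" "r \<noteq> t" "M r t = enat m" "u \<in> carrier W" "w = u \<cdot> wd (alt (m - 1) r t)"
    "gen s \<cdot> u = u \<cdot> gen (if odd m then r else t)" "len u < len (gen s \<cdot> u)" "len u < len w"
proof -
  obtain ws where ws: "set ws \<subseteq> S" "wd ws = w" "length ws = len w" by (rule reduced_word[OF w])
  with ne have "ws \<noteq> []" by auto
  then obtain ws' r where ws': "ws = ws' @ [r]" by (metis rev_exhaust)
  have r: "r \<in> S" "set ws' \<subseteq> S" using ws ws' by auto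
  have "w = wd ws' \<cdot> gen r" using ws(2) r by (simp add: ws' wd_append)
  then have "w \<cdot> gen r = wd ws'" using r by (simp add: m_assoc)
  then have down: "len (w \<cdot> gen r) < len w" using len_wd_le[OF r(2)] ws(3) ws' by simp
  have up': "len (w \<cdot> gen t) = Suc (len w)" using len_gen_mult_cases[OF s w] up eq by auto
  \<comment> \<open>The product with r is shorter than w, the product with t is longer.\<close>
  have rt: "r \<noteq> t" using down up' by auto
  define J where "J = {r, t}"
  have J: "J \<subseteq> S" using r t by (simp add: J_def)
  obtain u v where u: "u \<in> carrier W" and v: "reduced_in J v" and wuv: "w = u \<cdot> wd v"
    and min: "\<And>v'. set v' \<subseteq> J \<Longrightarrow> len u \<le> len (u \<cdot> wd v')"
    using parabolic_decomposition[OF J w] by blast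
  have len_u: "len (u \<cdot> wd v') = len u + length v'" if "reduced_in J v'" for v'
    using len_mult_parabolic[OF J u _ that] min by blast
  have vJ: "set v \<subseteq> J" "set v \<subseteq> S" using v J by (auto simp: reduced_in_def)
  have lw: "len w = len u + length v" using len_u[OF v] wuv by simp
  have "v \<noteq> []"
  proof
    assume "v = []"
    then have "w = u" using wuv u by simp
    moreover have "len u \<le> len (u \<cdot> gen r)" by (rule min) (simp add: J_def)
    ultimately show False using down by simp
  qed
  then obtain n where n: "length v = Suc n" by (cases v) auto
  \<comment> \<open>If \<open>v\<close> ended in t, then t would be a right descent of w.\<close>
  have v_alt: "v = alt (Suc n) r t"
  proof (rule ccontr)
    assume "v \<noteq> alt (Suc n) r t"
    then have "v = alt (Suc n) t r" using alt_of_reduced[OF r(1) t v[unfolded J_def]] n by auto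
    then have "w \<cdot> gen t = u \<cdot> wd (alt n r t)"
      using wuv u r t set_alt_S[of r t n] by (simp add: wd_append m_assoc)
    moreover obtain v' where v': "reduced_in J v'" "wd v' = wd (alt n r t)"
      using reduced_in_exists[OF set_alt[of n r t]] unfolding J_def by blast
    ultimately have "len (w \<cdot> gen t) = len u + length v'" using len_u[OF v'(1)] by simp
    moreover have "length v' \<le> n"
      using v' set_alt[of n r t] unfolding reduced_in_def J_def by (metis length_alt)
    ultimately show False using up' lw n by simp
  qed
  have su: "gen s \<cdot> u = u \<cdot> wd ((v @ [t]) @ rev v)"
  proof -
    have "u = w \<cdot> wd (rev v)" using wuv u vJ by (simp add: inv_wd[symmetric] m_assoc)
    then have "gen s \<cdot> u = (gen s \<cdot> w) \<cdot> wd (rev v)" using s w vJ by (simp add: m_assoc)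
    also have "\<dots> = u \<cdot> (wd v \<cdot> gen t \<cdot> wd (rev v))"
      unfolding eq unfolding wuv using u t vJ by (simp add: m_assoc)
    finally show ?thesis using t vJ wd_append[of "v @ [t]" "rev v"] wd_append[of v "[t]"] by simp
  qed
  have "set ((v @ [t]) @ rev v) \<subseteq> J" using vJ by (simp add: J_def)
  then obtain jv where jv: "reduced_in J jv" "wd jv = wd ((v @ [t]) @ rev v)"
    using reduced_in_exists by blast
  have lsu: "len (gen s \<cdot> u) = len u + length jv" using len_u[OF jv(1)] su jv(2) by simp
  have "jv \<noteq> []"
  proof
    assume "jv = []"
    then have "gen s \<cdot> u = u" using su jv(2)[symmetric] u by simp
    then have "gen s \<cdot> w = w" using wuv u s vJ by (simp add: m_assoc[symmetric])
    then show False using up by simp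
  qed
  moreover have "length jv \<le> 1" using lsu len_gen_mult_le[OF s u] by simp
  ultimately obtain j where j: "jv = [j]" by (cases jv) auto
  have jJ: "j \<in> J" "j \<in> S" using jv(1) j J by (auto simp: reduced_in_def)
  have suj: "gen s \<cdot> u = u \<cdot> gen j" using su jv(2) j by simp
  have "u \<cdot> wd (j # v) = u \<cdot> wd (v @ [t])"
  proof -
    have "u \<cdot> wd (j # v) = gen s \<cdot> u \<cdot> wd v"
      unfolding suj using u jJ vJ by (simp add: wd_Cons[of j v] m_assoc)
    also have "\<dots> = gen s \<cdot> w" using wuv u s vJ by (simp add: m_assoc)
    also have "\<dots> = u \<cdot> wd (v @ [t])" unfolding eq unfolding wuv using u t vJ by (simp add: wd_append m_assoc)
    finally show ?thesis .
  qed
  then have "ginv u \<cdot> (u \<cdot> wd (j # v)) = ginv u \<cdot> (u \<cdot> wd (v @ [t]))" by simp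
  then have jv_vt: "wd (j # v) = wd (v @ [t])"
    using u jJ vJ t by (simp add: m_assoc[symmetric])
  \<comment> \<open>The common length of \<open>v @ [t]\<close> and \<open>j # v\<close>. It will
    equal m, which gives \<open>v\<close> its length m - 1.\<close>
  define k where "k = Suc (Suc n)"
  have vt: "v @ [t] = alt k t r" by (simp add: v_alt k_def)
  have vtJ: "set (v @ [t]) \<subseteq> J" using vJ by (simp add: J_def)
  obtain v2 where v2: "reduced_in J v2" "wd v2 = wd (v @ [t])"
    using reduced_in_exists[OF vtJ] by blast
  have "len u + length v2 = len (w \<cdot> gen t)"
    using len_u[OF v2(1)] v2(2) wuv u t vJ by (simp add: wd_append m_assoc)
  then have lv2: "length v2 = k" using up' lw n by (simp add: k_def)
  have red: "reduced_in J v'" if "set v' \<subseteq> J" "wd v' = wd (v @ [t])" "length v' = k" for v'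
    using that v2 lv2 unfolding reduced_in_def by metis
  have red1: "reduced_in J (v @ [t])" using red[OF vtJ] n by (simp add: k_def)
  have red2: "reduced_in J (j # v)" using red[of "j # v"] jJ vJ jv_vt n by (simp add: k_def)
  have j_alt: "j # v = alt k r t"
  proof -
    have "j # v = alt k r t \<or> j # v = alt k t r"
      using alt_of_reduced[OF r(1) t red2[unfolded J_def]] n by (simp add: k_def)
    moreover have "last (j # v) \<noteq> last (alt k t r)" using rt by (simp add: v_alt k_def)
    ultimately show ?thesis by metis
  qed
  \<comment> \<open>Equality of the two alternating words makes m a divisor of k; reducedness bounds
    k by m.\<close>
  have "wd (alt k r t) = wd (alt k t r)" using jv_vt unfolding j_alt vt .
  from wd_alt_mult_inv[OF r(1) t this] obtain m where m: "M r t = enat m" "m dvd k"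
    using order_gen_mult_gen[OF r(1) t rt, of k] by (auto simp: k_def)
  have "0 < m" using coxeter_ge_2[OF r(1) t rt] m(1) by (simp add: numeral_eq_enat)
  moreover have "k \<le> m"
    using reduced_alt_le[OF r(1) t m(1) _ \<open>0 < m\<close>] red2 coxeter_sym[OF r(1) t] m(1)
    unfolding j_alt J_def by simp
  moreover have "m \<le> k" using m(2) by (rule dvd_imp_le) (simp add: k_def)
  ultimately have mk: "m = k" by simp
  have "j = hd (alt k r t)" by (metis j_alt list.sel(1))
  also have "\<dots> = (if odd m then r else t)"
    unfolding mk using alt_Suc_Cons[of "Suc n" r t] by (simp add: k_def del: alt.simps)
  finally have j_eq: "j = (if odd m then r else t)" .
  show thesis
  proof (rule that[OF r(1) rt m(1) u])
    show "w = u \<cdot> wd (alt (m - 1) r t)" unfolding mk wuv v_alt k_def by simp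
    show "gen s \<cdot> u = u \<cdot> gen (if odd m then r else t)" using suj j_eq by simp
    show "len u < len (gen s \<cdot> u)" using lsu j by simp
    show "len u < len w" using lw n by simp
  qed
qed

end

section \<open>Potentials on a forest\<close>

lemma graph_forest_subset: "graph_forest E' \<Longrightarrow> E \<subseteq> E' \<Longrightarrow> graph_forest E"
  unfolding graph_forest_def graph_cycle_def by blast

text \<open>A simple path from b to a is closed to a cycle by the new edge. Its length is at least
  two because the edge itself is not in \<open>E\<close>, so the cycle has at least three
  vertices.\<close>

lemma graph_forest_insert_not_connected:
  assumes forest: "graph_forest (insert {a, b} E)" and ab: "a \<noteq> b" "{a, b} \<notin> E"
  shows "(b, a) \<notin> {(x, y). {x, y} \<in> E}\<^sup>*"
proof
  assume "(b, a) \<in> {(x, y). {x, y} \<in> E}\<^sup>*"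
  then have "(\<lambda>x y. {x, y} \<in> E)\<^sup>*\<^sup>* b a"
    by (simp add: rtranclp_rtrancl_eq)
  then obtain xs0 where "rtrancl_path (\<lambda>x y. {x, y} \<in> E) b xs0 a"
    by (auto simp: rtranclp_eq_rtrancl_path)
  then obtain xs where xs: "rtrancl_path (\<lambda>x y. {x, y} \<in> E) b xs a" "distinct (b # xs)"
    by (rule rtrancl_path_distinct)
  have ne: "xs \<noteq> []" using xs(1) ab(1) by (auto elim: rtrancl_path.cases)
  have last: "last xs = a" by (rule rtrancl_path_last[OF xs(1) ne])
  have step: "{(b # xs) ! i, xs ! i} \<in> E" if "i < length xs" for i
    using rtrancl_path_nth[OF xs(1) that] .
  have "length xs \<noteq> 1"
  proof
    assume "length xs = 1"
    then have "xs = [a]" using last by (cases xs) auto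
    then show False using step[of 0] ab(2) by (simp add: insert_commute)
  qed
  then have "3 \<le> length (b # xs)" using ne by (cases xs) (auto simp: Suc_le_eq)
  moreover have "{(b # xs) ! i, (b # xs) ! (Suc i mod length (b # xs))} \<in> insert {a, b} E"
    if i: "i < length (b # xs)" for i
  proof (cases "i < length xs")
    case True
    then show ?thesis using step by simp
  next
    case False
    then have "i = length xs" using i by simp
    then have "(b # xs) ! i = a" using last ne by (simp add: last_conv_nth nth_Cons' )
    then show ?thesis using \<open>i = length xs\<close> by simp
  qed
  ultimately have "graph_cycle (insert {a, b} E) (b # xs)"
    using xs(2) by (simp only: graph_cycle_def) blast
  then show False using forest unfolding graph_forest_def by blast
qed

text \<open>The last edge joins two different components. Left multiplication by a constant on one
  of them preserves all earlier equations, since \<open>d\<close> acts on the right. Edges are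
  unordered, so each equation is required in both directions; this is where \<open>d b a\<close>
  must be the inverse.\<close>

lemma forest_potential:
  fixes G (structure)
  assumes "group G" "finite E" "graph_forest E"
    and "\<And>a. {a} \<notin> E"
    and "\<And>e. e \<in> E \<Longrightarrow> \<exists>a b. e = {a, b}"
    and "\<And>a b. {a, b} \<in> E \<Longrightarrow> d a b \<in> carrier G \<and> d b a = m_inv G (d a b)"
  shows "\<exists>g. (\<forall>x. g x \<in> carrier G) \<and> (\<forall>a b. {a, b} \<in> E \<longrightarrow> g a \<otimes> d a b = g b)"
  using assms(2-)
proof (induction E rule: finite_induct)
  case empty
  interpret group G by fact
  show ?case by (rule exI[of _ "\<lambda>_. \<one>"]) simp
next
  case (insert e E)
  interpret group G by fact
  obtain a b where e: "e = {a, b}" using insert.prems(3)[of e] by blast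
  have ab: "a \<noteq> b" using insert.prems(2)[of a] e by auto
  have "\<exists>g. (\<forall>x. g x \<in> carrier G) \<and> (\<forall>a b. {a, b} \<in> E \<longrightarrow> g a \<otimes> d a b = g b)"
  proof (rule insert.IH)
    show "graph_forest E" by (rule graph_forest_subset[OF insert.prems(1)]) blast
    show "{a} \<notin> E" for a using insert.prems(2)[of a] by blast
    show "\<exists>a b. e = {a, b}" if "e \<in> E" for e using insert.prems(3)[of e] that by blast
    show "d a b \<in> carrier G \<and> d b a = m_inv G (d a b)" if "{a, b} \<in> E" for a b
      using insert.prems(4)[of a b] that by blast
  qed
  then obtain g where g: "\<And>x. g x \<in> carrier G" "\<And>x y. {x, y} \<in> E \<Longrightarrow> g x \<otimes> d x y = g y" by blast
  have d: "d x y \<in> carrier G" "d y x = m_inv G (d x y)" if "{x, y} \<in> insert e E" for x y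
    using insert.prems(4)[OF that] by auto
  define C where "C = {x. (b, x) \<in> {(x, y). {x, y} \<in> E}\<^sup>*}"
  have aC: "a \<notin> C" and bC: "b \<in> C"
    using graph_forest_insert_not_connected[of a b E] insert.prems(1) insert.hyps(2) ab
    unfolding e C_def by auto
  have closed: "x \<in> C \<longleftrightarrow> y \<in> C" if "{x, y} \<in> E" for x y
  proof -
    have "(x, y) \<in> {(x, y). {x, y} \<in> E}" "(y, x) \<in> {(x, y). {x, y} \<in> E}"
      using that by (auto simp: insert_commute)
    then show ?thesis unfolding C_def by (auto intro: rtrancl_into_rtrancl)
  qed
  \<comment> \<open>The solution of the equation at the new edge,
    \<open>h \<otimes> g b = g a \<otimes> d a b\<close>.\<close>
  define h where "h = g a \<otimes> d a b \<otimes> m_inv G (g b)"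
  have dab: "d a b \<in> carrier G" "d b a = m_inv G (d a b)" using d[of a b] e by auto
  have h: "h \<in> carrier G" using g(1) dab by (simp add: h_def)
  define g' where "g' x = (if x \<in> C then h \<otimes> g x else g x)" for x
  have "g' x \<otimes> d x y = g' y" if xy: "{x, y} \<in> insert e E" for x y
  proof (cases "{x, y} \<in> E")
    case True
    then show ?thesis
      using closed[OF True] g h d(1)[OF xy] by (simp add: g'_def m_assoc)
  next
    case False
    then have "x = a \<and> y = b \<or> x = b \<and> y = a" using xy e by (auto simp: doubleton_eq_iff)
    then show ?thesis
      using aC bC g(1) dab h by (auto simp: g'_def h_def m_assoc)
  qed
  moreover have "g' x \<in> carrier G" for x using g(1) h by (simp add: g'_def)
  ultimately show ?case by blast
qed

section \<open>Finiteness of the intertwiners of two generators\<close>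

context coxeter_system
begin

lemma odd_edges_iff:
  "{a, b} \<in> odd_edges S M \<longleftrightarrow> a \<in> S \<and> b \<in> S \<and> a \<noteq> b \<and> (\<exists>k. M a b = enat k \<and> odd k)"
  using coxeter_sym unfolding odd_edges_def by (auto simp: doubleton_eq_iff)

lemma even_edges_iff:
  "{a, b} \<in> even_edges S M \<longleftrightarrow> a \<in> S \<and> b \<in> S \<and> a \<noteq> b \<and> (\<exists>k. M a b = enat k \<and> even k)"
  using coxeter_sym unfolding even_edges_def by (auto simp: doubleton_eq_iff)

lemma gen_inj: "s \<in> S \<Longrightarrow> t \<in> S \<Longrightarrow> gen s = gen t \<Longrightarrow> s = t"
proof (rule ccontr)
  assume st: "s \<in> S" "t \<in> S" "gen s = gen t" "s \<noteq> t"
  then have "(gen s \<cdot> gen t) [^]\<^bsub>W\<^esub> (1 :: nat) = \<e>" by simp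
  then obtain m where "M s t = enat m" "m dvd 1"
    using order_gen_mult_gen[OF st(1,2,4), of 1] by auto
  then show False using coxeter_ge_2[OF st(1,2,4)] by (simp add: numeral_eq_enat)
qed

context
  assumes forest: "graph_forest (odd_edges S M)"
    and one_even: "\<And>C. C \<in> graph_components S (odd_edges S M) \<Longrightarrow>
      \<exists>\<^sub>\<le>\<^sub>1 e. e \<in> even_edges S M \<and> (\<exists>t r. e = {t, r} \<and> t \<in> C \<and> r \<notin> C)"
    and no_even: "\<And>C. C \<in> graph_components S (odd_edges S M) \<Longrightarrow>
      \<not> (\<exists>t t'. {t, t'} \<in> even_edges S M \<and> t \<in> C \<and> t' \<in> C)"
begin

text \<open>For odd m the words have even length m - 1, so reversal swaps the two letters and yields
  the inverse, as a potential requires. Products of these words along a walk then telescope.\<close>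

lemma odd_potential:
  obtains g where "\<And>x. g x \<in> carrier W"
    "\<And>r t m. r \<in> S \<Longrightarrow> t \<in> S \<Longrightarrow> r \<noteq> t \<Longrightarrow> M r t = enat m \<Longrightarrow> odd m \<Longrightarrow>
      g r \<cdot> wd (alt (m - 1) r t) = g t"
proof -
  define d where "d a b = wd (alt (the_enat (M a b) - 1) a b)" for a b
  have "\<exists>g. (\<forall>x. g x \<in> carrier W) \<and> (\<forall>a b. {a, b} \<in> odd_edges S M \<longrightarrow> g a \<cdot> d a b = g b)"
  proof (rule forest_potential[OF is_group _ forest])
    have "odd_edges S M \<subseteq> Pow S" by (auto simp: odd_edges_def)
    moreover have "finite S" using coxeter by (simp add: coxeter_matrix_def)
    ultimately show "finite (odd_edges S M)" by (meson finite_Pow_iff finite_subset)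
    show "{a} \<notin> odd_edges S M" for a using odd_edges_iff[of a a] by simp
    show "\<exists>a b. e = {a, b}" if "e \<in> odd_edges S M" for e using that unfolding odd_edges_def by blast
    show "d a b \<in> carrier W \<and> d b a = ginv (d a b)" if ab: "{a, b} \<in> odd_edges S M" for a b
    proof -
      obtain k where k: "a \<in> S" "b \<in> S" "M a b = enat k" "odd k"
        using ab unfolding odd_edges_iff by blast
      then have "M b a = enat k" using coxeter_sym[of a b] by simp
      moreover have "even (k - 1)" using k(4) by simp
      ultimately show ?thesis using k by (simp add: d_def set_alt_S inv_wd rev_alt)
    qed
  qed
  then obtain g where g: "\<And>x. g x \<in> carrier W" "\<And>a b. {a, b} \<in> odd_edges S M \<Longrightarrow> g a \<cdot> d a b = g b"
    by blast
  show thesis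
  proof (rule that[OF g(1)])
    fix r t m assume *: "r \<in> S" "t \<in> S" "r \<noteq> t" "M r t = enat m" "odd m"
    then have "{r, t} \<in> odd_edges S M" unfolding odd_edges_iff by blast
    from g(2)[OF this] show "g r \<cdot> wd (alt (m - 1) r t) = g t" by (simp add: d_def *(4))
  qed
qed

text \<open>Left multiplication by \<open>s\<close> exchanges the solutions with |sw| > |w| and
  those with |sw| < |w|. It is enough to bound the former, where iterating
  \<open>reflection_step\<close> shortens w down to the identity.\<close>

lemma finite_intertwiners:
  assumes s: "s \<in> S" and t: "t \<in> S"
  shows "finite {w \<in> carrier W. gen s \<cdot> w = w \<cdot> gen t}"
proof -
  obtain g where g: "\<And>x. g x \<in> carrier W"
    and g_odd: "\<And>r t m. r \<in> S \<Longrightarrow> t \<in> S \<Longrightarrow> r \<noteq> t \<Longrightarrow> M r t = enat m \<Longrightarrow> odd m \<Longrightarrow>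
      g r \<cdot> wd (alt (m - 1) r t) = g t"
    using odd_potential by blast
  define C where "C = {x \<in> S. (s, x) \<in> {(x, y). {x, y} \<in> odd_edges S M}\<^sup>*}"
  have C: "C \<in> graph_components S (odd_edges S M)"
    unfolding graph_components_def C_def using s by blast
  \<comment> \<open>The words of the even edges that leave \<open>C\<close>, carried to a common
    base point by the potential.\<close>
  define L where "L = {g v \<cdot> wd (alt (m - 1) r v) \<cdot> ginv (g v) |v r m.
    v \<in> C \<and> r \<in> S \<and> r \<notin> C \<and> M r v = enat m \<and> even m}"
  have CS: "C \<subseteq> S" by (auto simp: C_def)
  have L_unique: "\<rho> = \<rho>'" if "\<rho> \<in> L" "\<rho>' \<in> L" for \<rho> \<rho>'
  proof -
    obtain v r m where 1: "\<rho> = g v \<cdot> wd (alt (m - 1) r v) \<cdot> ginv (g v)"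
      "v \<in> C" "r \<in> S" "r \<notin> C" "M r v = enat m" "even m"
      using \<open>\<rho> \<in> L\<close> unfolding L_def by blast
    obtain v' r' m' where 2: "\<rho>' = g v' \<cdot> wd (alt (m' - 1) r' v') \<cdot> ginv (g v')"
      "v' \<in> C" "r' \<in> S" "r' \<notin> C" "M r' v' = enat m'" "even m'"
      using \<open>\<rho>' \<in> L\<close> unfolding L_def by blast
    have "{r, v} \<in> even_edges S M" "{r', v'} \<in> even_edges S M"
      unfolding even_edges_iff using 1 2 CS by blast+
    then have "{v, r} \<in> even_edges S M" "{v', r'} \<in> even_edges S M"
      by (simp_all add: insert_commute)
    then have "{v, r} = {v', r'}"
      using one_even[OF C] 1(2,4) 2(2,4) unfolding Uniq_def by blast
    \<comment> \<open>The edges agree as sets; membership in \<open>C\<close> tells their ends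
      apart.\<close>
    then have "v = v'" "r = r'" using 1(2,4) 2(2,4) by (auto simp: doubleton_eq_iff)
    then show ?thesis using 1 2 by simp
  qed
  have L_inv: "\<rho> \<in> carrier W \<and> \<rho> \<cdot> \<rho> = \<e>" if "\<rho> \<in> L" for \<rho>
  proof -
    obtain v r m where 1: "\<rho> = g v \<cdot> wd (alt (m - 1) r v) \<cdot> ginv (g v)"
      "v \<in> C" "r \<in> S" "r \<notin> C" "M r v = enat m" "even m"
      using \<open>\<rho> \<in> L\<close> unfolding L_def by blast
    have v: "v \<in> S" "r \<noteq> v" using 1 CS by auto
    \<comment> \<open>This excludes m = 0, for which m - 1 would be even. An alternating word of odd
      length is a palindrome, hence its own inverse.\<close>
    then have "2 \<le> m" using coxeter_ge_2[of r v] 1 by (simp add: numeral_eq_enat)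
    then have "odd (m - 1)" using 1(6) by simp
    then have "ginv (wd (alt (m - 1) r v)) = wd (alt (m - 1) r v)"
      using v 1 by (simp add: inv_wd set_alt_S rev_alt)
    moreover have D: "wd (alt (m - 1) r v) \<in> carrier W" using v 1 by (simp add: set_alt_S)
    ultimately have DD: "wd (alt (m - 1) r v) \<cdot> wd (alt (m - 1) r v) = \<e>" by (metis r_inv)
    have "\<rho> \<cdot> \<rho> = g v \<cdot> (wd (alt (m - 1) r v) \<cdot> wd (alt (m - 1) r v)) \<cdot> ginv (g v)"
    proof -
      have "ginv (g v) \<cdot> (g v \<cdot> x) = x" if "x \<in> carrier W" for x
        using g[of v] that by (simp add: m_assoc[symmetric])
      then show ?thesis unfolding 1(1) using g[of v] D by (simp add: m_assoc)
    qed
    then show ?thesis unfolding DD using g[of v] D 1(1) by simp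
  qed
  define Z where "Z = insert \<e> L"
  \<comment> \<open>\<open>L\<close> has at most one element and it squares to the identity, so
    repeated visits to the even edge never leave \<open>Z\<close>.\<close>
  have Z_mult: "z \<cdot> \<rho> \<in> Z" if "z \<in> Z" "\<rho> \<in> L" for z \<rho>
  proof (cases "z = \<e>")
    case True
    then show ?thesis using that L_inv[of \<rho>] by (simp add: Z_def)
  next
    case False
    then have "z = \<rho>" using that L_unique by (auto simp: Z_def)
    then show ?thesis using that L_inv[of \<rho>] by (simp add: Z_def)
  qed
  have Z_carrier: "Z \<subseteq> carrier W" using L_inv by (auto simp: Z_def)
  have "finite L"
  proof (cases "L = {}")
    case False
    then obtain \<rho> where "\<rho> \<in> L" by blast
    then have "L \<subseteq> {\<rho>}" using L_unique by blast
    then show ?thesis by (rule finite_subset) simp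
  qed simp
  then have Z_finite: "finite Z" by (simp add: Z_def)
  \<comment> \<open>The claim on \<open>t\<close> is carried along because the even case needs it to
    see that \<open>r\<close> is outside \<open>C\<close> and that \<rho> belongs to
    \<open>L\<close>.\<close>
  have main: "t \<in> C \<and> (\<exists>z\<in>Z. w = ginv (g s) \<cdot> z \<cdot> g t)"
    if "w \<in> carrier W" "t \<in> S" "gen s \<cdot> w = w \<cdot> gen t" "len w < len (gen s \<cdot> w)" for w t
    using that
  proof (induction "len w" arbitrary: w t rule: less_induct)
    case less
    show ?case
    proof (cases "w = \<e>")
      case True
      then have "t = s" using gen_inj[OF s less.prems(2)] less.prems(2,3) s by simp
      then show ?thesis using True s g by (auto simp: C_def Z_def)
    next
      case False
      obtain r u m where r: "r \<in> S" "r \<noteq> t" "M r t = enat m" and u: "u \<in> carrier W"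
        and w: "w = u \<cdot> wd (alt (m - 1) r t)"
        and su: "gen s \<cdot> u = u \<cdot> gen (if odd m then r else t)" "len u < len (gen s \<cdot> u)" "len u < len w"
        using reflection_step[OF s less.prems(2,1,3,4) False] by blast
      have D: "wd (alt (m - 1) r t) \<in> carrier W" using r less.prems(2) by (simp add: set_alt_S)
      show ?thesis
      proof (cases "odd m")
        case True
        then obtain z where z: "r \<in> C" "z \<in> Z" "u = ginv (g s) \<cdot> z \<cdot> g r"
          using less.hyps[OF su(3) u r(1)] su by auto
        have "{r, t} \<in> odd_edges S M" unfolding odd_edges_iff using r less.prems(2) True by blast
        then have "t \<in> C" using z(1) less.prems(2) unfolding C_def by (auto intro: rtrancl_into_rtrancl)
        \<comment> \<open>The new word combines with \<open>g r\<close> into \<open>g t\<close>; the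
          element of \<open>Z\<close> stays the same.\<close>
        moreover have "w = ginv (g s) \<cdot> z \<cdot> (g r \<cdot> wd (alt (m - 1) r t))"
          unfolding w z(3) using g[of s] g[of r] z(2) Z_carrier D by (auto simp: m_assoc)
        ultimately show ?thesis
          using z(2) g_odd[OF r(1) less.prems(2) r(2,3) True] by auto
      next
        case even: False
        then obtain z where z: "t \<in> C" "z \<in> Z" "u = ginv (g s) \<cdot> z \<cdot> g t"
          using less.hyps[OF su(3) u less.prems(2)] su by auto
        have "{r, t} \<in> even_edges S M" unfolding even_edges_iff using r less.prems(2) even by blast
        then have "r \<notin> C" using no_even[OF C] z(1) by blast
        define \<rho> where "\<rho> = g t \<cdot> wd (alt (m - 1) r t) \<cdot> ginv (g t)"
        have \<rho>: "\<rho> \<in> L" unfolding L_def \<rho>_def using z(1) r \<open>r \<notin> C\<close> even by blast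
        have "w = ginv (g s) \<cdot> (z \<cdot> \<rho>) \<cdot> g t"
          unfolding w z(3) \<rho>_def using g[of s] g[of t] z(2) Z_carrier D by (auto simp: m_assoc)
        then show ?thesis using z(1) Z_mult[OF z(2) \<rho>] by blast
      qed
    qed
  qed
  define A where "A = (\<lambda>z. ginv (g s) \<cdot> z \<cdot> g t) ` Z"
  have "{w \<in> carrier W. gen s \<cdot> w = w \<cdot> gen t} \<subseteq> A \<union> (\<lambda>w. gen s \<cdot> w) ` A"
  proof
    fix w assume "w \<in> {w \<in> carrier W. gen s \<cdot> w = w \<cdot> gen t}"
    then have w: "w \<in> carrier W" "gen s \<cdot> w = w \<cdot> gen t" by auto
    show "w \<in> A \<union> (\<lambda>w. gen s \<cdot> w) ` A"
    proof (cases "len w < len (gen s \<cdot> w)")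
      case True
      then show ?thesis using main[OF w(1) t w(2)] by (auto simp: A_def)
    next
      case False
      let ?w = "gen s \<cdot> w"
      have "len ?w < len (gen s \<cdot> ?w)" using False len_gen_mult_cases[OF s w(1)] s w(1) by auto
      moreover have "gen s \<cdot> ?w = ?w \<cdot> gen t"
        using w s t by (metis gen_sq_left m_assoc wd_closed gen_sq r_one empty_set list.simps(15) insert_subset empty_subsetI)
      ultimately have "?w \<in> A" using main[of ?w t] w(1) s t by (auto simp: A_def)
      moreover have "w = gen s \<cdot> ?w" using s w(1) by simp
      ultimately show ?thesis by blast
    qed
  qed
  moreover have "finite A" using Z_finite by (simp add: A_def)
  ultimately show ?thesis using finite_subset by blast
qed

end

end

section \<open>The gradient property of the word length semi-group\<close>

context coxeter_system
begin

text \<open>The bound on intertwiners enters for pairs of generators only. Words are then built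
  letter by letter in both arguments, starting from the identity, where the coefficient
  vanishes.\<close>

lemma finite_gradient_coeff:
  assumes intertwiners: "\<And>s t. s \<in> S \<Longrightarrow> t \<in> S \<Longrightarrow> finite {w \<in> carrier W. gen s \<cdot> w = w \<cdot> gen t}"
    and x: "x \<in> carrier W" and y: "y \<in> carrier W"
  shows "finite {w \<in> carrier W. gradient_coeff W (\<lambda>w. real (len w)) x y w \<noteq> 0}"
proof -
  let ?c = "gradient_coeff W (\<lambda>w. real (len w))"
  let ?fin = "\<lambda>x y. finite {w \<in> carrier W. ?c x y w \<noteq> 0}"
  have c: "?c x y w = real (len (x \<cdot> w \<cdot> y)) + real (len w) - real (len (x \<cdot> w)) - real (len (w \<cdot> y))" for x y w
    by (rule gradient_coeff_def[OF is_group])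
  have gens: "?fin (gen s) (gen t)" if s: "s \<in> S" and t: "t \<in> S" for s t
  proof -
    have "{w \<in> carrier W. ?c (gen s) (gen t) w \<noteq> 0} \<subseteq> {w \<in> carrier W. gen s \<cdot> w = w \<cdot> gen t}"
    proof clarify
      fix w assume w: "w \<in> carrier W" "?c (gen s) (gen t) w \<noteq> 0"
      show "gen s \<cdot> w = w \<cdot> gen t"
      proof (rule ccontr)
        assume "gen s \<cdot> w \<noteq> w \<cdot> gen t"
        from length_defect_imp_eq[OF s t w(1) this] w(2) show False unfolding c by linarith
      qed
    qed
    then show ?thesis using intertwiners[OF s t] finite_subset by blast
  qed
  have zero: "?fin \<e> y" "?fin y \<e>" if "y \<in> carrier W" for y
    using that by (simp_all add: c cong: conj_cong)
  obtain us where us: "set us \<subseteq> S" "wd us = x" by (rule reduced_word[OF x])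
  obtain vs where vs: "set vs \<subseteq> S" "wd vs = y" by (rule reduced_word[OF y])
  have left: "?fin (wd us) (gen t)" if t: "t \<in> S" for t
    using us(1)
  proof (induction us)
    case (Cons a us)
    then show ?case
      using finite_gradient_coeff_mult_left[OF is_group, of "gen a" "wd us" "gen t"] gens[OF _ t] t wd_Cons[of a us]
      by simp
  qed (use zero t in simp)
  have "?fin (wd us) (wd vs)"
    using vs(1)
  proof (induction vs)
    case (Cons a vs)
    then show ?case
      using finite_gradient_coeff_mult_right[OF is_group, of "wd us" "gen a" "wd vs"] left[of a] us(1) wd_Cons[of a vs]
      by simp
  qed (use zero(2)[OF x] us in simp)
  then show ?thesis by (simp only: us vs)
qed

end

theorem corollary5p11:
  fixes S :: "'s set" and M :: "'s \<Rightarrow> 's \<Rightarrow> enat" and p :: ennreal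
  assumes "coxeter_matrix S M"
    and "1 \<le> p"
    and "graph_forest (odd_edges S M)"
    and "\<And>C. C \<in> graph_components S (odd_edges S M) \<Longrightarrow>
      \<exists>\<^sub>\<le>\<^sub>1 e. e \<in> even_edges S M \<and> (\<exists>t r. e = {t, r} \<and> t \<in> C \<and> r \<notin> C)"
    and "\<And>C. C \<in> graph_components S (odd_edges S M) \<Longrightarrow>
      \<not> (\<exists>t t'. {t, t'} \<in> even_edges S M \<and> t \<in> C \<and> t' \<in> C)"
  shows "gradient_schatten (coxeter_group S M)
    (length_semigroup (coxeter_group S M) (\<lambda>w. real (coxeter_length S M w))) p"
proof -
  interpret coxeter_system S M by unfold_locales (rule assms(1))
  show ?thesis
    by (rule gradient_schatten_if_finite_coeff[OF is_group], rule finite_gradient_coeff,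
        rule finite_intertwiners[OF assms(3-5)])
qed

end
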